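(* Consider $N$ rollouts of length $T$, each started from the zero initial state, of the linear system $x_{t+1}=Ax_t+Bu_t+B_ww_t$, $y_t=Cx_t+Du_t+D_vv_t$, with Gaussian inputs $u_t\sim\mathcal N(0,\sigma_u^2I_m)$ and Gaussian noises $w_t\sim\mathcal N(0,\sigma_w^2I_q)$, $v_t\sim\mathcal N(0,\sigma_v^2I_l)$, with data matrices $Y,U$ as defined in the context. Let $G=\begin{bmatrix} D & CB & CAB & \cdots & CA^{T-2}B\end{bmatrix}\in\mathbb R^{p\times mT}$, $F=\begin{bmatrix}0 & CB_w & CAB_w & \cdots & CA^{T-2}B_w\end{bmatrix}\in\mathbb R^{p\times qT}$, and let $\hat G=YU^\dagger$ be the ordinary least-squares estimator of $G$. No assumption is made on the spectral radius of $A$. Fix any $0<\delta<1$. If $N\ge 8mT+4(m+q+l+4)\log(3T/\delta)$, then with probability at least $1-\delta$, $$\|\hat G-G\|\le \frac{\sigma_vC_1+\sigma_wC_2}{\sigma_u}\sqrt{\frac1N},$$ where $$C_1=8\|D_v\|\sqrt{2T(T+1)(m+l)\log(27T/\delta)},$$ $$C_2=16\|F\|\sqrt{\left(\frac{T^3}{3}+\frac{T^2}{2}+\frac T6\right)2(m+q)\log(27T/\delta)}.$$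
   Context: Here $\|\cdot\|$ is the spectral norm (largest singular value). The system is $x_{t+1}=Ax_t+Bu_t+B_ww_t$, $y_t=Cx_t+Du_t+D_vv_t$ with real matrices of compatible sizes, $x_t\in\mathbb R^n$, $y_t\in\mathbb R^p$, $u_t\in\mathbb R^m$, $w_t\in\mathbb R^q$, $v_t\in\mathbb R^l$. $N,T\ge1$ are integers, $\sigma_u>0$ and $\sigma_w,\sigma_v\ge0$. For each rollout $i=1,\dots,N$, the system starts at $x_0^{(i)}=0$ and is run for $t=0,\dots,T-1$ with inputs $u_t^{(i)}$ and noises $w_t^{(i)},v_t^{(i)}$, giving outputs $y_t^{(i)}$. Over all $i,t$, the $u_t^{(i)}\sim\mathcal N(0,\sigma_u^2I_m)$ are i.i.d., the $w_t^{(i)}\sim\mathcal N(0,\sigma_w^2I_q)$ are i.i.d., and the $v_t^{(i)}\sim\mathcal N(0,\sigma_v^2I_l)$ are i.i.d.; the family of inputs is independent of the family $(w_t^{(i)})$ and of the family $(v_t^{(i)})$. Put $y^{(i)}=\begin{bmatrix}y_0^{(i)}&\cdots&y_{T-1}^{(i)}\end{bmatrix}\in\mathbb R^{p\times T}$, and let $U^{(i)}\in\mathbb R^{mT\times T}$ be the upper-triangular block Toeplitz matrix whose $(a,b)$ block ($1\le a,b\le T$, each block in $\mathbb R^{m\times1}$) is $u^{(i)}_{b-a}$ if $b\ge a$ and $0$ otherwise. Put $Y=\begin{bmatrix}y^{(1)}&\cdots&y^{(N)}\end{bmatrix}\in\mathbb R^{p\times NT}$ and $U=\begin{bmatrix}U^{(1)}&\cdots&U^{(N)}\end{bmatrix}\in\mathbb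 R^{mT\times NT}$. The ordinary least-squares estimator is $\hat G=\arg\min_{X\in\mathbb R^{p\times mT}}\sum_{i=1}^N\|y^{(i)}-XU^{(i)}\|_{\mathrm F}^2=YU^\dagger$, where $U^\dagger$ is the pseudo-inverse, equal to $U^{\mathsf T}(UU^{\mathsf T})^{-1}$ when $UU^{\mathsf T}$ is invertible. *)

theory Defs
  imports "HOL-Probability.Probability" "Jordan_Normal_Form.Char_Poly"
begin

unbundle no vec_syntax
no_notation Finite_Cartesian_Product.vec_nth (infixl "$" 90)

hide_const (open) Finite_Cartesian_Product.mat Finite_Cartesian_Product.vec
  Finite_Cartesian_Product.row Finite_Cartesian_Product.column
  Finite_Cartesian_Product.transpose Determinants.det

section \<open>Matrices\<close>

text \<open>
  For a wide matrix this set may contain extra zeros compared with the convention that counts only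
  \<open>min (dim_row A) (dim_col A)\<close> singular values; its maximum is the same. For \<open>dim_col A = 0\<close>
  the set is empty and the maximum is unspecified.
\<close>
definition singular_values :: "real mat \<Rightarrow> real set" where
  "singular_values A = {s. 0 \<le> s \<and> eigenvalue (transpose_mat A * A) (s\<^sup>2)}"

definition spectral_norm :: "real mat \<Rightarrow> real" where
  "spectral_norm A = Max (singular_values A)"

definition moore_penrose :: "real mat \<Rightarrow> real mat \<Rightarrow> bool" where
  "moore_penrose A X \<longleftrightarrow>
     X \<in> carrier_mat (dim_col A) (dim_row A) \<and>
     A * X * A = A \<and> X * A * X = X \<and>
     transpose_mat (A * X) = A * X \<and> transpose_mat (X * A) = X * A"

definition pseudo_inverse :: "real mat \<Rightarrow> real mat" where
  "pseudo_inverse A = (THE X. moore_penrose A X)"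

definition ols_estimator :: "real mat \<Rightarrow> real mat \<Rightarrow> real mat" where
  "ols_estimator Y U = Y * pseudo_inverse U"

section \<open>Markov parameters\<close>

text \<open>The block row \<open>[D, C B, C A B, \<dots>, C A^(T-2) B]\<close>, with \<open>T\<close> blocks.\<close>
definition markov_row :: "nat \<Rightarrow> real mat \<Rightarrow> real mat \<Rightarrow> real mat \<Rightarrow> real mat \<Rightarrow> real mat" where
  "markov_row T A B C D =
     mat (dim_row C) (dim_col B * T)
       (\<lambda>(r, c). let k = c div dim_col B; s = c mod dim_col B in
          (if k = 0 then D else C * (A ^\<^sub>m (k - 1)) * B) $$ (r, s))"

section \<open>Data matrices\<close>

text \<open>The columns are \<open>y 0, \<dots>, y (T - 1)\<close>.\<close>
definition output_row :: "nat \<Rightarrow> nat \<Rightarrow> (nat \<Rightarrow> real vec) \<Rightarrow> real mat" where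
  "output_row p T y = mat p T (\<lambda>(r, t). y t $ r)"

text \<open>With blocks counted from \<open>0\<close>, block \<open>(a, b)\<close> is the column \<open>u (b - a)\<close> if \<open>a \<le> b\<close>, and
  \<open>0\<close> otherwise.\<close>
definition toeplitz_input :: "nat \<Rightarrow> nat \<Rightarrow> (nat \<Rightarrow> real vec) \<Rightarrow> real mat" where
  "toeplitz_input m T u =
     mat (m * T) T
       (\<lambda>(r, b). let a = r div m in if a \<le> b then u (b - a) $ (r mod m) else 0)"

text \<open>\<open>[X 1, \<dots>, X N]\<close> for blocks \<open>X i\<close> of size \<open>r\<close> by \<open>T\<close>.\<close>
definition hconcat :: "nat \<Rightarrow> nat \<Rightarrow> nat \<Rightarrow> (nat \<Rightarrow> real mat) \<Rightarrow> real mat" where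
  "hconcat r T N X = mat r (N * T) (\<lambda>(j, c). X (c div T + 1) $$ (j, c mod T))"

section \<open>Gaussian vectors\<close>

text \<open>The Borel structure of \<open>\<real>\<^sup>d\<close>, transported to \<open>carrier_vec d\<close>.\<close>
definition vec_borel :: "nat \<Rightarrow> real vec measure" where
  "vec_borel d =
     vimage_algebra (carrier_vec d) (\<lambda>x. \<lambda>k\<in>{..<d}. x $ k) (PiM {..<d} (\<lambda>_. borel))"

text \<open>The law \<open>\<N>(0, \<sigma>\<^sup>2)\<close> on the reals, a point mass at \<open>0\<close> if \<open>\<sigma> = 0\<close>.\<close>
definition centered_normal :: "real \<Rightarrow> real measure" where
  "centered_normal \<sigma> =
     (if \<sigma> = 0 then return borel 0 else density lborel (\<lambda>x. ennreal (normal_density 0 \<sigma> x)))"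

text \<open>The law \<open>\<N>(0, \<sigma>\<^sup>2 I)\<close> on \<open>\<real>\<^sup>d\<close>.\<close>
definition isotropic_normal :: "nat \<Rightarrow> real \<Rightarrow> real vec measure" where
  "isotropic_normal d \<sigma> =
     distr (PiM {..<d} (\<lambda>_. centered_normal \<sigma>)) (vec_borel d) (vec d)"

definition iid_normal_vecs ::
  "'a measure \<Rightarrow> nat \<Rightarrow> real \<Rightarrow> 'i set \<Rightarrow> ('i \<Rightarrow> 'a \<Rightarrow> real vec) \<Rightarrow> bool" where
  "iid_normal_vecs M d \<sigma> I X \<longleftrightarrow>
     prob_space.indep_vars M (\<lambda>_. vec_borel d) X I \<and>
     (\<forall>j\<in>I. distr M (vec_borel d) (X j) = isotropic_normal d \<sigma>)"

definition indep_families ::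
  "'a measure \<Rightarrow> 'i set \<Rightarrow> nat \<Rightarrow> ('i \<Rightarrow> 'a \<Rightarrow> real vec) \<Rightarrow> nat \<Rightarrow> ('i \<Rightarrow> 'a \<Rightarrow> real vec) \<Rightarrow> bool" where
  "indep_families M I d X d' X' \<longleftrightarrow>
     prob_space.indep_var M
       (PiM I (\<lambda>_. vec_borel d)) (\<lambda>\<omega>. \<lambda>j\<in>I. X j \<omega>)
       (PiM I (\<lambda>_. vec_borel d')) (\<lambda>\<omega>. \<lambda>j\<in>I. X' j \<omega>)"

end

theory Submission
  imports Defs
begin

text \<open>
  Let \<open>P\<close> be the pseudo-inverse of \<open>U\<close>. Since \<open>Y = G U + F W + D\<^sub>v V\<close> for the block Toeplitz matrix \<open>W\<close> of process
  noises and the matrix \<open>V\<close> of measurement noises, the error is \<open>F W P + D\<^sub>v V P\<close> as soon as \<open>U P = I\<close>,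
  and \<open>P z\<close> always lies in the row space of \<open>U\<close>. Two estimates therefore suffice.

  The smallest singular value of \<open>U\<close> is at least \<open>\<sigma>\<^sub>u sqrt N / 4\<close>: the last columns of the rollouts already form a
  Gaussian matrix with independent entries. A unit vector is rounded at random to a lattice point, which changes the
  quadratic form by a small multiple of the Frobenius norm only, and the lattice points are treated by Chernoff bounds
  for chi-square variables and a union bound.

  The noises, restricted to the row space of \<open>U\<close>, have norm of the order of the square root of the dimension, not of \<open>N\<close>:
  given the inputs, the noises applied to a Gram-Schmidt basis of the row space are Gaussian, and bilinear forms are again
  controlled on lattice points. Here only the independence of the inputs from each of the two noise families
  is used. Each of the \<open>T\<close> block rows of \<open>W\<close> is a shift of one noise matrix.

  The event in the conclusion has to be measurable. This is seen from a formula for the pseudo-inverse that is valid for all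
  matrices, and from testing the spectral norm on integer vectors.
\<close>

text \<open>The factor 8 in front of m T leaves little room: a union bound over a net in dimension m
  T must be beaten by the tail of a sum of only N squares. Passing from the net to the sphere
  through the operator norm would call for a finer net and so for more points. Random rounding
  instead charges mesh^2 / 4 times the squared Frobenius norm, which is of order N m T \<sigma>^2,
  and the mesh 1 / (4 sqrt (m T)) cancels the dimension. The net then has at most 27.5^(m T) points,
  and exp (8 \<alpha>) > 27.5 for the decay rate \<alpha> of the chi-square tail at one sixth of the
  mean.

  The noise estimate explains the logarithm: 27.5 is below 81 = 9^2, so \<open>ln 9\<close> per
  dimension pays for the net, and 27 T / \<delta> = 9 * (3 T / \<delta>). The entries of W repeat
  along diagonals and are not independent, which is why W is cut into block rows; T of them cost a
  factor sqrt T in the norm and a union bound over T events, hence the T inside the logarithm. The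
  failure probability is split into thirds: inputs, process noise, measurement noise.\<close>

unbundle no inner_syntax

section \<open>Lattice points and orthonormalization\<close>

text \<open>After scaling by \<open>1 / (4 * sqrt d)\<close> these are the lattice points in the ball of radius \<open>5/4\<close> of \<open>\<real>\<^sup>d\<close>.\<close>
definition lattice_net :: "nat \<Rightarrow> (nat \<Rightarrow> int) set" where
  "lattice_net d = {k \<in> {..<d} \<rightarrow>\<^sub>E UNIV. (\<Sum>j<d. (k j)\<^sup>2) \<le> 25 * int d}"

text \<open>The full two-sided geometric series of ratio 4/5 has sum (1 + 4/5) / (1 - 4/5) = 9. The
  ratio is close to the one minimizing the resulting count per dimension, 9 * (5/4)^5, which is
  about 27.5.\<close>

lemma sum_geometric_abs:
  "(\<Sum>i\<in>{- int n..int n}. (4/5::real) ^ nat \<bar>i\<bar>) = 9 - 8 * (4/5) ^ n"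
proof (induction n)
  case (Suc n)
  have "{- int (Suc n)..int (Suc n)} = insert (- int (Suc n)) (insert (int (Suc n)) {- int n..int n})"
    by auto
  then show ?case by (simp add: Suc nat_add_distrib)
qed simp

text \<open>The l1 bound is the one Cauchy-Schwarz would give, obtained coordinate by coordinate
  from (|k j| - 5)^2 \<ge> 0. The l1 norm is the exponent in the geometric weights used for
  counting.\<close>

lemma lattice_net_sum_abs:
  assumes "k \<in> lattice_net d"
  shows "(\<Sum>j<d. \<bar>k j\<bar>) \<le> 5 * int d"
proof -
  have "10 * \<bar>i\<bar> \<le> i\<^sup>2 + 25" for i :: int
    using zero_le_power2[of "\<bar>i\<bar> - 5"] by (simp add: power2_diff)
  then have "(\<Sum>j<d. 10 * \<bar>k j\<bar>) \<le> (\<Sum>j<d. (k j)\<^sup>2 + 25)" by (intro sum_mono) auto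
  with assms show ?thesis
    by (simp add: lattice_net_def sum.distrib flip: sum_distrib_left)
qed

lemma lattice_net_subset: "lattice_net d \<subseteq> {..<d} \<rightarrow>\<^sub>E {- int (5 * d)..int (5 * d)}"
proof
  fix k assume k: "k \<in> lattice_net d"
  have *: "\<bar>k j\<bar> \<le> 5 * int d" if "j < d" for j
    using member_le_sum[of j "{..<d}" "\<lambda>j. \<bar>k j\<bar>"] that lattice_net_sum_abs[OF k] by auto
  then show "k \<in> {..<d} \<rightarrow>\<^sub>E {- int (5 * d)..int (5 * d)}"
    using k * by (auto simp: lattice_net_def PiE_iff abs_le_iff minus_le_iff)
qed

lemma finite_lattice_net [simp]: "finite (lattice_net d)"
  by (rule finite_subset[OF lattice_net_subset]) (auto intro: finite_PiE)

text \<open>Count with the weights \<open>(4/5) ^ \<bar>k j\<bar>\<close>, whose sum over all integers is \<open>9\<close>.\<close>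
lemma card_lattice_net: "real (card (lattice_net d)) \<le> (9 * (5/4) ^ 5) ^ d"
proof -
  let ?B = "{- int (5 * d)..int (5 * d)}"
  \<comment> \<open>A net point has weight at least (4/5)^(5 d), so after rescaling it contributes
    at least 1. Extending the sum to the whole box makes it a product of one-dimensional
    sums.\<close>
  have 1: "1 \<le> (5/4::real) ^ (5 * d) * (\<Prod>j<d. (4/5) ^ nat \<bar>k j\<bar>)" if k: "k \<in> lattice_net d" for k
  proof -
    have "int (\<Sum>j<d. nat \<bar>k j\<bar>) \<le> int (5 * d)"
      using lattice_net_sum_abs[OF k] by simp
    then have "(\<Sum>j<d. nat \<bar>k j\<bar>) \<le> 5 * d" by (simp only: of_nat_le_iff)
    then have "(4/5::real) ^ (5 * d) \<le> (4/5) ^ (\<Sum>j<d. nat \<bar>k j\<bar>)"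
      by (intro power_decreasing) auto
    then have "(5/4::real) ^ (5 * d) * (4/5) ^ (5 * d) \<le> (5/4) ^ (5 * d) * (\<Prod>j<d. (4/5) ^ nat \<bar>k j\<bar>)"
      by (intro mult_left_mono) (auto simp: power_sum)
    then show ?thesis by (simp flip: power_mult_distrib)
  qed
  have "real (card (lattice_net d)) = (\<Sum>k\<in>lattice_net d. 1)" by simp
  also have "\<dots> \<le> (\<Sum>k\<in>lattice_net d. (5/4) ^ (5 * d) * (\<Prod>j<d. (4/5) ^ nat \<bar>k j\<bar>))"
    by (intro sum_mono 1)
  also have "\<dots> \<le> (\<Sum>k\<in>{..<d} \<rightarrow>\<^sub>E ?B. (5/4) ^ (5 * d) * (\<Prod>j<d. (4/5) ^ nat \<bar>k j\<bar>))"
    by (rule sum_mono2[OF _ lattice_net_subset]) (simp_all add: finite_PiE prod_nonneg)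
  also have "\<dots> = (5/4) ^ (5 * d) * (\<Prod>j<d. \<Sum>i\<in>?B. (4/5) ^ nat \<bar>i\<bar>)"
    by (subst prod_sum_PiE) (simp_all only: sum_distrib_left finite_lessThan finite_atLeastAtMost_int)
  also have "\<dots> \<le> (5/4) ^ (5 * d) * (\<Prod>j<d. 9)"
    by (intro mult_left_mono prod_mono conjI) (simp_all only: sum_geometric_abs sum_nonneg zero_le_power,
        simp_all add: order_trans[OF mult_left_mono[OF power_le_one, of _ 8]])
  also have "\<dots> = (9 * (5/4) ^ 5) ^ d" by (simp add: power_mult power_mult_distrib)
  finally show ?thesis .
qed

section \<open>Rounding unit vectors to lattice points\<close>

lemma rounded_L2_set:
  assumes "d \<ge> 1" "h = 1 / (4 * sqrt (real d))" "\<And>j. j < d \<Longrightarrow> \<bar>h * of_int (k j) - x j\<bar> \<le> h"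
  shows "\<bar>L2_set (\<lambda>j. h * of_int (k j)) {..<d} - L2_set x {..<d}\<bar> \<le> 1/4"
proof -
  let ?e = "\<lambda>j. h * of_int (k j) - x j"
  have h: "h > 0" using assms by simp
  \<comment> \<open>The mesh is chosen so that d errors of size at most h have norm at most h sqrt d
    = 1/4.\<close>
  have "L2_set ?e {..<d} \<le> L2_set (\<lambda>_. h) {..<d}"
    unfolding L2_set_def using assms(3) h
    by (intro real_sqrt_le_mono sum_mono) (metis abs_ge_zero lessThan_iff power2_abs power_mono)
  also have "\<dots> = 1/4" using assms h by (simp add: L2_set_def real_sqrt_mult)
  finally have e: "L2_set ?e {..<d} \<le> 1/4" .
  have "L2_set (\<lambda>j. h * of_int (k j)) {..<d} \<le> L2_set x {..<d} + L2_set ?e {..<d}"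
    using L2_set_triangle_ineq[of x ?e "{..<d}"] by simp
  moreover have "L2_set x {..<d} \<le> L2_set (\<lambda>j. h * of_int (k j)) {..<d} + L2_set (\<lambda>j. - ?e j) {..<d}"
    using L2_set_triangle_ineq[of "\<lambda>j. h * of_int (k j)" "\<lambda>j. - ?e j" "{..<d}"] by simp
  moreover have "L2_set (\<lambda>j. - ?e j) {..<d} = L2_set ?e {..<d}"
    unfolding L2_set_def by (simp only: power2_minus)
  ultimately show ?thesis using e by linarith
qed

lemma L2_set_power2: "(L2_set f A)\<^sup>2 = (\<Sum>i\<in>A. (f i)\<^sup>2)"
  by (simp add: L2_set_def sum_nonneg)

text \<open>The rounded vector has norm between 3/4 and 5/4; dividing the squares by h^2 = 1 / (16
  d) gives 9 d and 25 d. The upper bound is membership in the net, the lower one keeps the variance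
  of a Gaussian linear form at the net point away from 0.\<close>

lemma rounded_in_net:
  assumes d: "d \<ge> 1" and h: "h = 1 / (4 * sqrt (real d))"
    and k: "\<And>j. j < d \<Longrightarrow> \<bar>h * of_int (k j) - x j\<bar> \<le> h" and x: "L2_set x {..<d} = 1"
  shows "restrict k {..<d} \<in> lattice_net d" "9 * real d \<le> (\<Sum>j<d. (of_int (k j))\<^sup>2)"
proof -
  have h0: "h > 0" and hh: "h\<^sup>2 = 1 / (16 * real d)" using d by (simp_all add: h power_divide power_mult_distrib)
  have eq: "(\<Sum>j<d. (h * of_int (k j))\<^sup>2) = (\<Sum>j<d. (of_int (k j))\<^sup>2) / (16 * real d)"
    by (simp add: power_mult_distrib hh flip: sum_divide_distrib)
  have "L2_set (\<lambda>j. h * of_int (k j)) {..<d} \<le> 5/4" "3/4 \<le> L2_set (\<lambda>j. h * of_int (k j)) {..<d}"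
    using rounded_L2_set[OF d h, of k x, OF k] x by linarith+
  then have "(L2_set (\<lambda>j. h * of_int (k j)) {..<d})\<^sup>2 \<le> (5/4)\<^sup>2" "(3/4)\<^sup>2 \<le> (L2_set (\<lambda>j. h * of_int (k j)) {..<d})\<^sup>2"
    by (intro power_mono; simp)+
  then have *: "(\<Sum>j<d. (h * of_int (k j))\<^sup>2) \<le> 25/16" "9/16 \<le> (\<Sum>j<d. (h * of_int (k j))\<^sup>2)"
    unfolding L2_set_power2 by (simp_all add: power_divide)
  then show "9 * real d \<le> (\<Sum>j<d. (of_int (k j))\<^sup>2)"
    using d unfolding eq by (simp add: field_simps)
  have "real_of_int (\<Sum>j<d. (k j)\<^sup>2) \<le> real_of_int (25 * int d)"
    using * d unfolding eq by (simp add: field_simps)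
  then have "(\<Sum>j<d. (k j)\<^sup>2) \<le> 25 * int d" by (simp only: of_int_le_iff)
  then show "restrict k {..<d} \<in> lattice_net d" by (simp add: lattice_net_def)
qed

text \<open>Rounding each coordinate in the direction favoured by \<open>f\<close> does not decrease the form, so passing to the net
  costs only its radius.\<close>
lemma linear_form_le_from_net:
  assumes d: "d \<ge> 1"
    and net: "\<And>k. k \<in> lattice_net d \<Longrightarrow> (\<Sum>j<d. of_int (k j) * f j) \<le> 4 * sqrt (real d) * s"
  shows "(\<Sum>j<d. x j * f j) \<le> L2_set x {..<d} * s"
proof (cases "L2_set x {..<d} = 0")
  case True
  then have "\<forall>j\<in>{..<d}. x j = 0" by (simp add: L2_set_eq_0_iff)
  with True show ?thesis by simp
next
  case False
  then have n: "L2_set x {..<d} > 0" by (simp add: order_less_le)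
  define z where "z j = x j / L2_set x {..<d}" for j
  have z1: "L2_set z {..<d} = 1"
    unfolding z_def using n L2_set_right_distrib[of "1 / L2_set x {..<d}" x "{..<d}"] by simp
  define h where h: "h = 1 / (4 * sqrt (real d))"
  have h0: "h > 0" using d by (simp add: h)
  define k where "k j = (if f j \<ge> 0 then \<lceil>z j / h\<rceil> else \<lfloor>z j / h\<rfloor>)" for j
  have cl: "z j / h \<le> of_int \<lceil>z j / h\<rceil>" "of_int \<lceil>z j / h\<rceil> \<le> z j / h + 1"
    "of_int \<lfloor>z j / h\<rfloor> \<le> z j / h" "z j / h \<le> of_int \<lfloor>z j / h\<rfloor> + 1" for j
    by linarith+
  then have cl: "z j \<le> h * of_int \<lceil>z j / h\<rceil>" "h * of_int \<lceil>z j / h\<rceil> \<le> z j + h"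
    "h * of_int \<lfloor>z j / h\<rfloor> \<le> z j" "z j \<le> h * of_int \<lfloor>z j / h\<rfloor> + h" for j
    using h0 cl[of j] by (simp_all add: field_simps del: le_of_int_ceiling of_int_floor_le)
  have k: "\<bar>h * of_int (k j) - z j\<bar> \<le> h" for j
    using cl[of j] by (auto simp: k_def)
  have kf: "z j * f j \<le> h * of_int (k j) * f j" for j
    using cl[of j] by (auto simp: k_def intro: mult_right_mono mult_right_mono_neg)
  have "(\<Sum>j<d. z j * f j) \<le> (\<Sum>j<d. h * of_int (k j) * f j)" by (intro sum_mono kf)
  also have "\<dots> = h * (\<Sum>j<d. of_int (restrict k {..<d} j) * f j)"
    by (simp add: sum_distrib_left mult.assoc)
  also have "\<dots> \<le> h * (4 * sqrt (real d) * s)"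
    using h0 by (intro mult_left_mono net rounded_in_net(1)[OF d h k z1]) auto
  also have "\<dots> = s" using d by (simp add: h)
  finally have "L2_set x {..<d} * (\<Sum>j<d. z j * f j) \<le> L2_set x {..<d} * s"
    using n by (intro mult_left_mono) auto
  then show ?thesis using n by (simp add: z_def sum_distrib_left)
qed

text \<open>The linear case is used in the second argument for each fixed net point of the first,
  then in the first. Net points are integer vectors, so 16 sqrt r sqrt d is the product of the two
  inverse mesh widths.\<close>

lemma bilinear_form_le_from_net:
  assumes "r \<ge> 1" "d \<ge> 1"
    and net: "\<And>k k'. k \<in> lattice_net r \<Longrightarrow> k' \<in> lattice_net d \<Longrightarrow>
      (\<Sum>i<r. \<Sum>j<d. of_int (k i) * of_int (k' j) * b i j) \<le> 16 * sqrt (real r) * sqrt (real d) * s"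
  shows "(\<Sum>i<r. \<Sum>j<d. x i * y j * b i j) \<le> L2_set x {..<r} * L2_set y {..<d} * s"
proof -
  have 1: "(\<Sum>j<d. y j * (\<Sum>i<r. of_int (k i) * b i j)) \<le> L2_set y {..<d} * (4 * sqrt (real r) * s)"
    if k: "k \<in> lattice_net r" for k
  proof (rule linear_form_le_from_net[OF assms(2)])
    fix k' assume k': "k' \<in> lattice_net d"
    have "(\<Sum>j<d. of_int (k' j) * (\<Sum>i<r. of_int (k i) * b i j)) =
        (\<Sum>i<r. \<Sum>j<d. of_int (k i) * of_int (k' j) * b i j)"
      by (subst sum.swap) (simp add: sum_distrib_left mult_ac)
    then show "(\<Sum>j<d. of_int (k' j) * (\<Sum>i<r. of_int (k i) * b i j)) \<le> 4 * sqrt (real d) * (4 * sqrt (real r) * s)"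
      using net[OF k k'] by (simp add: mult_ac)
  qed
  have "(\<Sum>i<r. x i * (\<Sum>j<d. y j * b i j)) \<le> L2_set x {..<r} * (L2_set y {..<d} * s)"
  proof (rule linear_form_le_from_net[OF assms(1)])
    fix k assume k: "k \<in> lattice_net r"
    have "(\<Sum>i<r. of_int (k i) * (\<Sum>j<d. y j * b i j)) = (\<Sum>j<d. y j * (\<Sum>i<r. of_int (k i) * b i j))"
      unfolding sum_distrib_left by (subst sum.swap) (simp add: mult_ac)
    then show "(\<Sum>i<r. of_int (k i) * (\<Sum>j<d. y j * b i j)) \<le> 4 * sqrt (real r) * (L2_set y {..<d} * s)"
      using 1[OF k] by (simp add: mult_ac)
  qed
  then show ?thesis by (simp add: sum_distrib_left mult_ac)
qed

text \<open>Rounding \<open>v\<close> at random, up or down with mean \<open>v\<close>, adds only a variance term to the expected quadratic form.\<close>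
lemma quadratic_rounding_coordinate:
  fixes v h :: real
  assumes "h > 0"
  shows "\<exists>k::int. \<bar>h * of_int k - v\<bar> \<le> h \<and>
    (\<Sum>i\<in>I. (c i + X i * (h * of_int k))\<^sup>2) \<le> (\<Sum>i\<in>I. (c i + X i * v)\<^sup>2) + h\<^sup>2 / 4 * (\<Sum>i\<in>I. (X i)\<^sup>2)"
proof -
  define k where "k = \<lfloor>v / h\<rfloor>"
  define p where "p = v / h - of_int k"
  have p: "0 \<le> p" "p \<le> 1" unfolding p_def k_def by linarith+
  have v: "v = h * (of_int k + p)" using assms by (simp add: p_def)
  define Q where "Q t = (\<Sum>i\<in>I. (c i + X i * (h * t))\<^sup>2)" for t
  \<comment> \<open>The rounding takes the value k with probability 1 - p and k + 1 with probability
    p, so its mean is k + p and p (1 - p) is its variance, at most 1/4. The identity is the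
    bias-variance decomposition of a quadratic polynomial.\<close>
  have "(1 - p) * Q (of_int k) + p * Q (of_int (k + 1)) = Q (of_int k + p) + p * (1 - p) * h\<^sup>2 * (\<Sum>i\<in>I. (X i)\<^sup>2)"
    unfolding Q_def sum_distrib_left sum.distrib[symmetric]
    by (intro sum.cong refl) (simp add: power2_eq_square algebra_simps)
  also have "p * (1 - p) \<le> 1 / 4"
    using zero_le_power2[of "p - 1/2"] by (simp add: power2_eq_square algebra_simps)
  then have "p * (1 - p) * h\<^sup>2 * (\<Sum>i\<in>I. (X i)\<^sup>2) \<le> 1 / 4 * h\<^sup>2 * (\<Sum>i\<in>I. (X i)\<^sup>2)"
    by (intro mult_right_mono) (auto intro: sum_nonneg)
  finally have le: "(1 - p) * Q (of_int k) + p * Q (of_int (k + 1)) \<le> Q (of_int k + p) + h\<^sup>2 / 4 * (\<Sum>i\<in>I. (X i)\<^sup>2)"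
    (is "_ \<le> ?R") by simp
  \<comment> \<open>One of the two outcomes is no larger than their average. This replaces the
    randomness of the rounding by a choice.\<close>
  have dis: "Q (of_int k) \<le> ?R \<or> Q (of_int (k + 1)) \<le> ?R"
  proof (rule ccontr)
    define R where "R = ?R"
    assume "\<not> ?thesis"
    then have lt: "R < Q (of_int k)" "R < Q (of_int (k + 1))" by (auto simp: R_def)
    have "(1 - p) * R + p * R < (1 - p) * Q (of_int k) + p * Q (of_int (k + 1))"
    proof (cases "p = 0")
      case False
      then show ?thesis
        using p lt by (intro add_le_less_mono mult_left_mono mult_strict_left_mono) auto
    qed (use lt in simp)
    also have "\<dots> \<le> R" using le unfolding R_def .
    finally show False by (simp add: algebra_simps)
  qed
  have dist: "\<bar>h * of_int k - v\<bar> \<le> h" "\<bar>h * of_int (k + 1) - v\<bar> \<le> h"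
    using p assms unfolding v
    by (auto simp: abs_le_iff algebra_simps mult_left_le)
  have Qv: "Q (of_int k + p) = (\<Sum>i\<in>I. (c i + X i * v)\<^sup>2)" unfolding Q_def v ..
  from dis show ?thesis
  proof
    assume "Q (of_int k) \<le> ?R"
    with dist(1) show ?thesis unfolding Qv unfolding Q_def by blast
  next
    assume "Q (of_int (k + 1)) \<le> ?R"
    with dist(2) show ?thesis unfolding Qv unfolding Q_def by blast
  qed
qed

text \<open>Coordinates are rounded one after the other; the offset \<open>c\<close> absorbs those
  already rounded, and the variance terms add up to mesh^2 / 4 times the squared Frobenius norm of
  \<open>X\<close>. Closeness is claimed for all \<open>j\<close>, including those that do not enter
  the form.\<close>

lemma quadratic_rounding:
  fixes v :: "nat \<Rightarrow> real"
  assumes "h > 0"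
  shows "\<exists>k::nat \<Rightarrow> int. (\<forall>j. \<bar>h * of_int (k j) - v j\<bar> \<le> h) \<and>
    (\<Sum>i\<in>I. (c i + (\<Sum>j<d. X i j * (h * of_int (k j))))\<^sup>2)
      \<le> (\<Sum>i\<in>I. (c i + (\<Sum>j<d. X i j * v j))\<^sup>2) + h\<^sup>2 / 4 * (\<Sum>i\<in>I. \<Sum>j<d. (X i j)\<^sup>2)"
proof (induction d arbitrary: c)
  case 0
  have "\<exists>k::int. \<bar>h * of_int k - v j\<bar> \<le> h" for j
    using quadratic_rounding_coordinate[OF assms, where v = "v j" and I = "{}::nat set"] by auto
  then show ?case by simp metis
next
  case (Suc d)
  from quadratic_rounding_coordinate[OF assms, where v = "v d" and I = I and c = "\<lambda>i. c i + (\<Sum>j<d. X i j * v j)" and X = "\<lambda>i. X i d"]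
  obtain l :: int where l: "\<bar>h * of_int l - v d\<bar> \<le> h"
    "(\<Sum>i\<in>I. (c i + (\<Sum>j<d. X i j * v j) + X i d * (h * of_int l))\<^sup>2)
      \<le> (\<Sum>i\<in>I. (c i + (\<Sum>j<d. X i j * v j) + X i d * v d)\<^sup>2) + h\<^sup>2 / 4 * (\<Sum>i\<in>I. (X i d)\<^sup>2)" by blast
  from Suc.IH[of "\<lambda>i. c i + X i d * (h * of_int l)"]
  obtain k where k: "\<And>j. \<bar>h * of_int (k j) - v j\<bar> \<le> h"
    "(\<Sum>i\<in>I. (c i + X i d * (h * of_int l) + (\<Sum>j<d. X i j * (h * of_int (k j))))\<^sup>2)
      \<le> (\<Sum>i\<in>I. (c i + X i d * (h * of_int l) + (\<Sum>j<d. X i j * v j))\<^sup>2) + h\<^sup>2 / 4 * (\<Sum>i\<in>I. \<Sum>j<d. (X i j)\<^sup>2)"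
    by blast
  show ?case
  proof (intro exI[of _ "k(d := l)"] conjI allI)
    fix j show "\<bar>h * of_int ((k(d := l)) j) - v j\<bar> \<le> h" using l k by simp
  next
    show "(\<Sum>i\<in>I. (c i + (\<Sum>j<Suc d. X i j * (h * of_int ((k(d := l)) j))))\<^sup>2)
      \<le> (\<Sum>i\<in>I. (c i + (\<Sum>j<Suc d. X i j * v j))\<^sup>2) + h\<^sup>2 / 4 * (\<Sum>i\<in>I. \<Sum>j<Suc d. (X i j)\<^sup>2)"
      using l(2) k(2) by (simp add: sum.distrib algebra_simps)
  qed
qed

text \<open>A vector that depends linearly on its predecessors is sent to \<open>0\<close>, because \<open>r / 0 = 0\<close>; the recursion is
  explicit so that it depends measurably on \<open>f\<close>.\<close>
fun gram_schmidt_vec :: "'i set \<Rightarrow> (nat \<Rightarrow> 'i \<Rightarrow> real) \<Rightarrow> nat \<Rightarrow> 'i \<Rightarrow> real" where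
  "gram_schmidt_vec I f n =
     (let r = (\<lambda>i. f n i - (\<Sum>a<n. (\<Sum>j\<in>I. f n j * gram_schmidt_vec I f a j) * gram_schmidt_vec I f a i))
      in (\<lambda>i. r i / L2_set r I))"

declare gram_schmidt_vec.simps [simp del]

text \<open>The family is orthonormal up to vectors vanishing on \<open>I\<close>. The squared norm
  is therefore an idempotent, 0 or 1, and later arguments multiply by it where an orthonormal basis
  would have 1.\<close>

lemma gram_schmidt_vec_inner_self:
  assumes "finite I"
  shows "(\<Sum>i\<in>I. (gram_schmidt_vec I f n i)\<^sup>2) = 1 \<or> (\<forall>i\<in>I. gram_schmidt_vec I f n i = 0)"
proof -
  define r where "r = (\<lambda>i. f n i - (\<Sum>a<n. (\<Sum>j\<in>I. f n j * gram_schmidt_vec I f a j) * gram_schmidt_vec I f a i))"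
  have g: "gram_schmidt_vec I f n = (\<lambda>i. r i / L2_set r I)"
    by (subst gram_schmidt_vec.simps) (simp add: Let_def r_def)
  show ?thesis
  proof (cases "L2_set r I = 0")
    case False
    then show ?thesis unfolding g
      by (simp add: power_divide flip: sum_divide_distrib L2_set_power2)
  qed (simp add: g)
qed

lemma gram_schmidt_vec_span:
  assumes "finite I"
  shows "\<exists>c. \<forall>i\<in>I. f n i = (\<Sum>a<Suc n. c a * gram_schmidt_vec I f a i)"
proof -
  define r where "r = (\<lambda>i. f n i - (\<Sum>a<n. (\<Sum>j\<in>I. f n j * gram_schmidt_vec I f a j) * gram_schmidt_vec I f a i))"
  have g: "gram_schmidt_vec I f n = (\<lambda>i. r i / L2_set r I)"
    by (subst gram_schmidt_vec.simps) (simp add: Let_def r_def)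
  have "L2_set r I * gram_schmidt_vec I f n i = r i" if "i \<in> I" for i
    using that assms by (cases "L2_set r I = 0") (auto simp: g L2_set_eq_0_iff)
  then show ?thesis
    by (intro exI[of _ "\<lambda>a. if a < n then (\<Sum>j\<in>I. f n j * gram_schmidt_vec I f a j) else L2_set r I"])
       (simp add: r_def)
qed

text \<open>By strong induction on the larger index: among the subtracted projections only the one
  along \<open>b\<close> survives the inner product with vector \<open>b\<close>. If that vector
  vanishes on \<open>I\<close>, both sides are 0.\<close>

lemma gram_schmidt_vec_orthogonal:
  assumes "finite I"
  shows "a \<noteq> b \<Longrightarrow> (\<Sum>i\<in>I. gram_schmidt_vec I f a i * gram_schmidt_vec I f b i) = 0"
proof -
  let ?g = "gram_schmidt_vec I f"
  have *: "\<forall>b<n. (\<Sum>i\<in>I. ?g n i * ?g b i) = 0" for n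
  proof (induction n rule: less_induct)
    case (less n)
    have orth: "(\<Sum>i\<in>I. ?g a i * ?g b i) = 0" if "a < n" "b < n" "a \<noteq> b" for a b
      using less.IH[of a] less.IH[of b] that by (cases "a < b") (auto simp: mult.commute[of "gram_schmidt_vec I f a _"])
    define r where "r = (\<lambda>i. f n i - (\<Sum>a<n. (\<Sum>j\<in>I. f n j * ?g a j) * ?g a i))"
    have g: "?g n = (\<lambda>i. r i / L2_set r I)"
      by (subst gram_schmidt_vec.simps) (simp add: Let_def r_def)
    show ?case
    proof (intro allI impI)
      fix b assume b: "b < n"
      have "(\<Sum>i\<in>I. r i * ?g b i) =
          (\<Sum>i\<in>I. f n i * ?g b i) - (\<Sum>a<n. (\<Sum>j\<in>I. f n j * ?g a j) * (\<Sum>i\<in>I. ?g a i * ?g b i))"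
        unfolding r_def left_diff_distrib sum_subtractf sum_distrib_right sum_distrib_left
        by (subst (2) sum.swap) (simp add: mult_ac)
      also have "(\<Sum>a<n. (\<Sum>j\<in>I. f n j * ?g a j) * (\<Sum>i\<in>I. ?g a i * ?g b i))
         = (\<Sum>a\<in>{b}. (\<Sum>j\<in>I. f n j * ?g a j) * (\<Sum>i\<in>I. ?g a i * ?g b i))"
        using b orth by (intro sum.mono_neutral_right) auto
      also have "\<dots> = (\<Sum>j\<in>I. f n j * ?g b j)"
      proof (cases "(\<Sum>i\<in>I. (?g b i)\<^sup>2) = 1")
        case True then show ?thesis by (simp add: power2_eq_square)
      next
        case False
        then have "\<forall>i\<in>I. ?g b i = 0" using gram_schmidt_vec_inner_self[OF assms, of f b] by blast
        then show ?thesis by simp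
      qed
      finally have "(\<Sum>i\<in>I. r i * ?g b i) = 0" by simp
      then show "(\<Sum>i\<in>I. ?g n i * ?g b i) = 0" unfolding g by (simp flip: sum_divide_distrib)
    qed
  qed
  show "a \<noteq> b \<Longrightarrow> (\<Sum>i\<in>I. ?g a i * ?g b i) = 0"
    using *[of a] *[of b] by (cases "a < b") (auto simp: mult.commute[of "gram_schmidt_vec I f a _"])
qed

lemma gram_schmidt_vec_norm:
  assumes "finite I"
  shows "(\<Sum>i\<in>I. (\<Sum>a<d. c a * gram_schmidt_vec I f a i)\<^sup>2)
    = (\<Sum>a<d. (c a)\<^sup>2 * (\<Sum>i\<in>I. (gram_schmidt_vec I f a i)\<^sup>2))"
proof -
  let ?g = "gram_schmidt_vec I f"
  have "(\<Sum>i\<in>I. (\<Sum>a<d. c a * ?g a i)\<^sup>2) = (\<Sum>i\<in>I. \<Sum>a<d. \<Sum>b<d. c a * c b * (?g a i * ?g b i))"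
    by (simp add: power2_eq_square sum_product mult_ac)
  also have "\<dots> = (\<Sum>a<d. \<Sum>b<d. c a * c b * (\<Sum>i\<in>I. ?g a i * ?g b i))"
    unfolding sum_distrib_left by (subst sum.swap, intro sum.cong refl, subst sum.swap, simp)
  also have "\<dots> = (\<Sum>a<d. \<Sum>b\<in>{a}. c a * c b * (\<Sum>i\<in>I. ?g a i * ?g b i))"
    by (intro sum.cong refl sum.mono_neutral_right) (auto simp: gram_schmidt_vec_orthogonal[OF assms])
  finally show ?thesis by (simp add: power2_eq_square)
qed

lemma gram_schmidt_vec_norm_le:
  assumes "finite I"
  shows "(\<Sum>i\<in>I. (\<Sum>a<d. c a * gram_schmidt_vec I f a i)\<^sup>2) \<le> (\<Sum>a<d. (c a)\<^sup>2)"
  unfolding gram_schmidt_vec_norm[OF assms]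
proof (intro sum_mono)
  fix a
  have "(\<Sum>i\<in>I. (gram_schmidt_vec I f a i)\<^sup>2) \<le> 1"
    using gram_schmidt_vec_inner_self[OF assms, of f a] by auto
  then show "(c a)\<^sup>2 * (\<Sum>i\<in>I. (gram_schmidt_vec I f a i)\<^sup>2) \<le> (c a)\<^sup>2" by (simp add: mult_left_le)
qed

text \<open>Every combination of the \<open>f b\<close> gets coefficients of exactly the same norm.
  An estimate on lattice points in coefficient space, of dimension \<open>d\<close>, thereby covers
  the whole span, however large \<open>I\<close> is.\<close>

lemma gram_schmidt_vec_coords:
  assumes "finite I"
  shows "\<exists>c. (\<forall>i\<in>I. (\<Sum>b<d. y b * f b i) = (\<Sum>a<d. c a * gram_schmidt_vec I f a i)) \<and>
    L2_set c {..<d} = L2_set (\<lambda>i. \<Sum>b<d. y b * f b i) I"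
proof -
  let ?g = "gram_schmidt_vec I f"
  have "\<forall>b. \<exists>c. \<forall>i\<in>I. f b i = (\<Sum>a<Suc b. c a * ?g a i)"
    using gram_schmidt_vec_span[OF assms] by blast
  then obtain C where C: "\<And>b i. i \<in> I \<Longrightarrow> f b i = (\<Sum>a<Suc b. C b a * ?g a i)" by metis
  define c0 where "c0 a = (\<Sum>b<d. if a < Suc b then y b * C b a else 0)" for a
  \<comment> \<open>Multiplying by the squared norm erases the coefficients of vanishing vectors;
    they do not affect the combination but would spoil the equality of norms.\<close>
  define c where "c a = c0 a * (\<Sum>i\<in>I. (?g a i)\<^sup>2)" for a
  have gg: "(\<Sum>j\<in>I. (?g a j)\<^sup>2) * ?g a i = ?g a i" if "i \<in> I" for a i
    using gram_schmidt_vec_inner_self[OF assms, of f a] that by auto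
  have eq: "(\<Sum>b<d. y b * f b i) = (\<Sum>a<d. c a * ?g a i)" if i: "i \<in> I" for i
  proof -
    have "(\<Sum>b<d. y b * f b i) = (\<Sum>b<d. \<Sum>a<d. (if a < Suc b then y b * C b a else 0) * ?g a i)"
    proof (intro sum.cong refl)
      fix b assume "b \<in> {..<d}"
      then have "(\<Sum>a<d. (if a < Suc b then y b * C b a else 0) * ?g a i)
          = (\<Sum>a<Suc b. (if a < Suc b then y b * C b a else 0) * ?g a i)"
        by (intro sum.mono_neutral_right) auto
      also have "\<dots> = (\<Sum>a<Suc b. y b * (C b a * ?g a i))" by (intro sum.cong) auto
      finally show "y b * f b i = (\<Sum>a<d. (if a < Suc b then y b * C b a else 0) * ?g a i)"
        by (simp only: C[OF i] sum_distrib_left)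
    qed
    also have "\<dots> = (\<Sum>a<d. c0 a * ?g a i)"
      by (subst sum.swap) (simp add: c0_def sum_distrib_right)
    finally show ?thesis by (simp add: c_def mult.assoc gg[OF i])
  qed
  have "(\<Sum>a<d. (c a)\<^sup>2) = (\<Sum>a<d. (c a)\<^sup>2 * (\<Sum>i\<in>I. (?g a i)\<^sup>2))"
  proof (intro sum.cong refl)
    fix a show "(c a)\<^sup>2 = (c a)\<^sup>2 * (\<Sum>i\<in>I. (?g a i)\<^sup>2)"
      using gram_schmidt_vec_inner_self[OF assms, of f a] by (auto simp: c_def)
  qed
  also have "\<dots> = (\<Sum>i\<in>I. (\<Sum>a<d. c a * ?g a i)\<^sup>2)" by (rule gram_schmidt_vec_norm[OF assms, symmetric])
  also have "\<dots> = (\<Sum>i\<in>I. (\<Sum>b<d. y b * f b i)\<^sup>2)" using eq by simp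
  finally show ?thesis using eq by (intro exI[of _ c]) (simp add: L2_set_def)
qed

section \<open>Gaussian vectors\<close>

lemma space_vec_borel [simp]: "space (vec_borel d) = carrier_vec d"
  by (simp add: vec_borel_def)

lemma measurable_vec_borel_index:
  assumes "k < d"
  shows "(\<lambda>x. x $ k) \<in> borel_measurable (vec_borel d)"
proof -
  have "(\<lambda>x. \<lambda>k\<in>{..<d}. x $ k) \<in> measurable (vec_borel d) (PiM {..<d} (\<lambda>_. borel))"
    unfolding vec_borel_def by (rule measurable_vimage_algebra1) (auto simp: space_PiM)
  from measurable_compose[OF this measurable_component_singleton[of k]] assms
  show ?thesis by simp
qed

lemma measurable_vec_vec_borel: "vec d \<in> measurable (PiM {..<d} (\<lambda>_. borel)) (vec_borel d)"
  unfolding vec_borel_def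
proof (rule measurable_vimage_algebra2)
  show "(\<lambda>x. \<lambda>k\<in>{..<d}. vec d x $ k) \<in> PiM {..<d} (\<lambda>_. borel) \<rightarrow>\<^sub>M PiM {..<d} (\<lambda>_. borel :: real measure)"
    by (intro measurable_restrict) (auto intro: measurable_component_singleton)
qed auto

lemma sets_centered_normal [simp, measurable_cong]: "sets (centered_normal \<sigma>) = sets borel"
  by (simp add: centered_normal_def)

lemma space_centered_normal [simp]: "space (centered_normal \<sigma>) = UNIV"
  by (simp add: centered_normal_def)

lemma prob_space_centered_normal:
  "\<sigma> \<ge> 0 \<Longrightarrow> prob_space (centered_normal \<sigma>)"
  by (cases "\<sigma> = 0") (simp_all add: centered_normal_def prob_space_return prob_space_normal_density)

lemma product_prob_space_centered_normal:
  assumes "\<sigma> \<ge> 0"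
  shows "product_prob_space (\<lambda>_. centered_normal \<sigma>)"
  by (rule product_prob_spaceI, rule prob_space_centered_normal, rule assms)

lemma vec_borel_box:
  assumes "\<And>k. k < d \<Longrightarrow> A k \<in> sets borel"
  shows "{x \<in> carrier_vec d. \<forall>k<d. x $ k \<in> A k} \<in> sets (vec_borel d)"
proof -
  have "{x \<in> space (vec_borel d). x $ k \<in> A k} \<in> sets (vec_borel d)" if "k < d" for k
    using measurable_sets[OF measurable_vec_borel_index[OF that] assms[OF that]]
    by (simp add: vimage_def Int_def conj_commute)
  then have "{x \<in> space (vec_borel d). \<forall>k\<in>{..<d}. x $ k \<in> A k} \<in> sets (vec_borel d)"
    by (intro sets.sets_Collect_finite_All) auto
  then show ?thesis by (simp only: space_vec_borel Ball_def lessThan_iff)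
qed

lemma isotropic_normal_box:
  assumes "\<sigma> \<ge> 0" "\<And>k. k < d \<Longrightarrow> A k \<in> sets borel"
  shows "emeasure (isotropic_normal d \<sigma>) {x \<in> carrier_vec d. \<forall>k<d. x $ k \<in> A k}
    = (\<Prod>k<d. emeasure (centered_normal \<sigma>) (A k))"
proof -
  interpret product_prob_space "\<lambda>_. centered_normal \<sigma>" "{..<d}"
    by (rule product_prob_space_centered_normal) fact
  have "emeasure (isotropic_normal d \<sigma>) {x \<in> carrier_vec d. \<forall>k<d. x $ k \<in> A k}
    = emeasure (PiM {..<d} (\<lambda>_. centered_normal \<sigma>))
       (vec d -` {x \<in> carrier_vec d. \<forall>k<d. x $ k \<in> A k} \<inter> space (PiM {..<d} (\<lambda>_. centered_normal \<sigma>)))"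
    unfolding isotropic_normal_def
    by (intro emeasure_distr)
       (auto simp: vec_borel_box assms measurable_vec_vec_borel
         cong: measurable_cong_sets sets_PiM_cong)
  also have "vec d -` {x \<in> carrier_vec d. \<forall>k<d. x $ k \<in> A k} \<inter> space (PiM {..<d} (\<lambda>_. centered_normal \<sigma>))
    = Pi\<^sub>E {..<d} A"
    by (auto simp: space_PiM PiE_iff)
  also have "emeasure (PiM {..<d} (\<lambda>_. centered_normal \<sigma>)) (Pi\<^sub>E {..<d} A) = (\<Prod>k<d. emeasure (centered_normal \<sigma>) (A k))"
    using assms(2) by (subst emeasure_PiM) auto
  finally show ?thesis .
qed

lemma ball_Times: "(\<forall>p\<in>A \<times> B. P p) \<longleftrightarrow> (\<forall>a\<in>A. \<forall>b\<in>B. P (a, b))"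
  by blast

text \<open>On boxes, which determine a product measure, independence of the vectors and the product
  form of \<open>isotropic_normal\<close> combine into one product over pairs (index, coordinate).
  The joint law serves the noises; the marginal laws and the independence serve the inputs.\<close>

lemma iid_normal_vecs_coordinates:
  assumes "prob_space M" and "\<sigma> \<ge> 0" and fin: "finite I" and ne: "I \<noteq> {}" and d: "d \<ge> 1"
    and iid: "iid_normal_vecs M d \<sigma> I X"
  shows "distr M (PiM (I \<times> {..<d}) (\<lambda>_. borel)) (\<lambda>\<omega>. \<lambda>p\<in>I \<times> {..<d}. X (fst p) \<omega> $ snd p)
      = PiM (I \<times> {..<d}) (\<lambda>_. centered_normal \<sigma>)" (is "?D = _")
    and "\<And>j k. j \<in> I \<Longrightarrow> k < d \<Longrightarrow> (\<lambda>\<omega>. X j \<omega> $ k) \<in> borel_measurable M"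
    and "\<And>p. p \<in> I \<times> {..<d} \<Longrightarrow> distr M borel (\<lambda>\<omega>. X (fst p) \<omega> $ snd p) = centered_normal \<sigma>"
    and "prob_space.indep_vars M (\<lambda>_. borel) (\<lambda>p \<omega>. X (fst p) \<omega> $ snd p) (I \<times> {..<d})"
proof -
  interpret prob_space M by fact
  have ind: "indep_vars (\<lambda>_. vec_borel d) X I"
    and law: "\<And>j. j \<in> I \<Longrightarrow> distr M (vec_borel d) (X j) = isotropic_normal d \<sigma>"
    using iid by (auto simp: iid_normal_vecs_def)
  have rv: "X j \<in> measurable M (vec_borel d)" if "j \<in> I" for j
    using ind that by (auto simp: indep_vars_def)
  have car: "X j \<omega> \<in> carrier_vec d" if "j \<in> I" "\<omega> \<in> space M" for j \<omega>
    using measurable_space[OF rv] that by simp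
  show rvc: "(\<lambda>\<omega>. X j \<omega> $ k) \<in> borel_measurable M" if "j \<in> I" "k < d" for j k
    using measurable_compose[OF rv measurable_vec_borel_index] that by simp
  have rvJ: "(\<lambda>\<omega>. \<lambda>p\<in>I \<times> {..<d}. X (fst p) \<omega> $ snd p) \<in> measurable M (PiM (I \<times> {..<d}) (\<lambda>_. borel))"
    by (intro measurable_restrict) (auto intro: rvc)
  interpret P: product_prob_space "\<lambda>_. centered_normal \<sigma>" "I \<times> {..<d}"
    by (rule product_prob_space_centered_normal) fact
  show D: "?D = PiM (I \<times> {..<d}) (\<lambda>_. centered_normal \<sigma>)"
  proof (rule P.PiM_eqI)
    show "finite (I \<times> {..<d})" using fin by simp
    show "sets ?D = sets (PiM (I \<times> {..<d}) (\<lambda>_. centered_normal \<sigma>))"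
      by (auto intro!: sets_PiM_cong)
    fix A assume A: "\<And>p. p \<in> I \<times> {..<d} \<Longrightarrow> A p \<in> sets (centered_normal \<sigma>)"
    define B where "B j = {x \<in> carrier_vec d. \<forall>k<d. x $ k \<in> A (j, k)}" for j
    have B: "B j \<in> sets (vec_borel d)" if "j \<in> I" for j
      unfolding B_def using A that by (intro vec_borel_box) auto
    have "emeasure ?D (Pi\<^sub>E (I \<times> {..<d}) A) =
        emeasure M ((\<lambda>\<omega>. \<lambda>p\<in>I \<times> {..<d}. X (fst p) \<omega> $ snd p) -` Pi\<^sub>E (I \<times> {..<d}) A \<inter> space M)"
      using A fin by (intro emeasure_distr rvJ sets_PiM_I_finite) auto
    also have "(\<lambda>\<omega>. \<lambda>p\<in>I \<times> {..<d}. X (fst p) \<omega> $ snd p) -` Pi\<^sub>E (I \<times> {..<d}) A \<inter> space M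
        = {\<omega> \<in> space M. \<forall>j\<in>I. \<forall>k<d. X j \<omega> $ k \<in> A (j, k)}"
      unfolding vimage_def restrict_PiE_iff Int_def mem_Collect_eq
        ball_Times[of I "{..<d}" "\<lambda>p. X (fst p) _ $ snd p \<in> A p"]
      by (simp only: fst_conv snd_conv Ball_def lessThan_iff conj_commute)
    also have "\<dots> = (\<Inter>j\<in>I. X j -` B j \<inter> space M)"
      using ne by (auto simp: B_def car)
    also have "emeasure M \<dots> = ennreal (\<Prod>j\<in>I. prob (X j -` B j \<inter> space M))"
      unfolding emeasure_eq_measure by (subst indep_varsD_finite[OF ind ne fin]) (auto simp: B)
    also have "\<dots> = (\<Prod>j\<in>I. emeasure M (X j -` B j \<inter> space M))"
      by (simp add: emeasure_eq_measure prod_ennreal)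
    also have "\<dots> = (\<Prod>j\<in>I. emeasure (isotropic_normal d \<sigma>) (B j))"
      by (intro prod.cong refl) (simp add: emeasure_distr rv B flip: law)
    also have "\<dots> = (\<Prod>j\<in>I. \<Prod>k<d. emeasure (centered_normal \<sigma>) (A (j, k)))"
      using A unfolding B_def by (intro prod.cong refl isotropic_normal_box assms) auto
    also have "\<dots> = (\<Prod>p\<in>I \<times> {..<d}. emeasure (centered_normal \<sigma>) (A p))"
      by (simp add: prod.cartesian_product)
    finally show "emeasure ?D (Pi\<^sub>E (I \<times> {..<d}) A) = (\<Prod>p\<in>I \<times> {..<d}. emeasure (centered_normal \<sigma>) (A p))" .
  qed
  show law1: "distr M borel (\<lambda>\<omega>. X (fst p) \<omega> $ snd p) = centered_normal \<sigma>" if p: "p \<in> I \<times> {..<d}" for p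
  proof -
    have "distr M borel (\<lambda>\<omega>. X (fst p) \<omega> $ snd p) = distr ?D borel (\<lambda>f. f p)"
      using p by (subst distr_distr) (auto simp: rvJ comp_def)
    also have "\<dots> = distr (PiM (I \<times> {..<d}) (\<lambda>_. centered_normal \<sigma>)) (centered_normal \<sigma>) (\<lambda>f. f p)"
      unfolding D by (intro distr_cong) auto
    also have "\<dots> = centered_normal \<sigma>"
      using p by (intro P.PiM_component)
    finally show ?thesis .
  qed
  show "indep_vars (\<lambda>_. borel) (\<lambda>p \<omega>. X (fst p) \<omega> $ snd p) (I \<times> {..<d})"
  proof (subst indep_vars_iff_distr_eq_PiM')
    show "I \<times> {..<d} \<noteq> {}" using ne d by (auto simp: lessThan_empty_iff)
    show "(\<lambda>\<omega>. X (fst p) \<omega> $ snd p) \<in> borel_measurable M" if "p \<in> I \<times> {..<d}" for p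
      using that rvc by auto
    show "?D = PiM (I \<times> {..<d}) (\<lambda>p. distr M borel (\<lambda>\<omega>. X (fst p) \<omega> $ snd p))"
      unfolding D by (intro PiM_cong) (auto simp: law1)
  qed
qed

section \<open>Exponential moments and Chernoff bounds\<close>

lemma nn_integral_centered_normal_exp:
  assumes "\<sigma> \<ge> 0"
  shows "(\<integral>\<^sup>+x. ennreal (exp (c * x)) \<partial>centered_normal \<sigma>) = ennreal (exp (\<sigma>\<^sup>2 * c\<^sup>2 / 2))"
proof (cases "\<sigma> = 0")
  case True
  then show ?thesis by (simp add: centered_normal_def nn_integral_return)
next
  case False
  then have \<sigma>: "\<sigma> > 0" using assms by simp
  interpret N: prob_space "density lborel (\<lambda>x. ennreal (normal_density (\<sigma>\<^sup>2 * c) \<sigma> x))"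
    using \<sigma> by (rule prob_space_normal_density)
  have "(\<integral>\<^sup>+x. ennreal (exp (c * x)) \<partial>centered_normal \<sigma>)
      = (\<integral>\<^sup>+x. ennreal (normal_density 0 \<sigma> x) * ennreal (exp (c * x)) \<partial>lborel)"
    using False by (simp add: centered_normal_def nn_integral_density)
  also have "\<dots> = (\<integral>\<^sup>+x. ennreal (exp (\<sigma>\<^sup>2 * c\<^sup>2 / 2)) * ennreal (normal_density (\<sigma>\<^sup>2 * c) \<sigma> x) \<partial>lborel)"
  proof (intro nn_integral_cong)
    fix x
    \<comment> \<open>Completing the square: the tilted density is again normal, with the same
      variance and mean \<open>\<sigma>\<^sup>2 * c\<close>.\<close>
    have "- x\<^sup>2 / (2 * \<sigma>\<^sup>2) + c * x = \<sigma>\<^sup>2 * c\<^sup>2 / 2 + - (x - \<sigma>\<^sup>2 * c)\<^sup>2 / (2 * \<sigma>\<^sup>2)"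
      using \<sigma> by (simp add: field_simps power2_eq_square)
    then have "exp (- x\<^sup>2 / (2 * \<sigma>\<^sup>2)) * exp (c * x) = exp (\<sigma>\<^sup>2 * c\<^sup>2 / 2) * exp (- (x - \<sigma>\<^sup>2 * c)\<^sup>2 / (2 * \<sigma>\<^sup>2))"
      by (simp only: flip: exp_add)
    then show "ennreal (normal_density 0 \<sigma> x) * ennreal (exp (c * x))
      = ennreal (exp (\<sigma>\<^sup>2 * c\<^sup>2 / 2)) * ennreal (normal_density (\<sigma>\<^sup>2 * c) \<sigma> x)"
      by (simp add: normal_density_def flip: ennreal_mult)
  qed
  also have "\<dots> = ennreal (exp (\<sigma>\<^sup>2 * c\<^sup>2 / 2)) * (\<integral>\<^sup>+x. ennreal (normal_density (\<sigma>\<^sup>2 * c) \<sigma> x) \<partial>lborel)"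
    by (simp add: nn_integral_cmult)
  also have "(\<integral>\<^sup>+x. ennreal (normal_density (\<sigma>\<^sup>2 * c) \<sigma> x) \<partial>lborel) = 1"
    using N.emeasure_space_1 by (simp add: emeasure_density)
  finally show ?thesis by simp
qed

lemma nn_integral_centered_normal_exp_square:
  assumes \<sigma>: "\<sigma> > 0" and c: "2 * c * \<sigma>\<^sup>2 < 1"
  shows "(\<integral>\<^sup>+x. ennreal (exp (c * x\<^sup>2)) \<partial>centered_normal \<sigma>) = ennreal (1 / sqrt (1 - 2 * c * \<sigma>\<^sup>2))"
proof -
  define q where "q = sqrt (1 - 2 * c * \<sigma>\<^sup>2)"
  have q: "q > 0" "q\<^sup>2 = 1 - 2 * c * \<sigma>\<^sup>2" using c by (simp_all add: q_def)
  \<comment> \<open>The factor exp (c x^2) turns the Gaussian weight into one of variance \<tau>^2 =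
    \<sigma>^2 / (1 - 2 c \<sigma>^2), and the two normalizations differ by 1 / q. The sign of
    \<open>c\<close> is free, so the formula serves upper and lower tails.\<close>
  define \<tau> where "\<tau> = \<sigma> / q"
  have \<tau>: "\<tau> > 0" using \<sigma> q by (simp add: \<tau>_def)
  interpret N: prob_space "density lborel (\<lambda>x. ennreal (normal_density 0 \<tau> x))"
    using \<tau> by (rule prob_space_normal_density)
  have "(\<integral>\<^sup>+x. ennreal (exp (c * x\<^sup>2)) \<partial>centered_normal \<sigma>)
      = (\<integral>\<^sup>+x. ennreal (normal_density 0 \<sigma> x) * ennreal (exp (c * x\<^sup>2)) \<partial>lborel)"
    using \<sigma> by (simp add: centered_normal_def nn_integral_density)
  also have "\<dots> = (\<integral>\<^sup>+x. ennreal (1 / q) * ennreal (normal_density 0 \<tau> x) \<partial>lborel)"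
  proof (intro nn_integral_cong)
    fix x
    have "- x\<^sup>2 / (2 * \<sigma>\<^sup>2) + c * x\<^sup>2 = - x\<^sup>2 * q\<^sup>2 / (2 * \<sigma>\<^sup>2)"
      unfolding q(2) using \<sigma> by (simp add: field_simps)
    also have "\<dots> = - x\<^sup>2 / (2 * \<tau>\<^sup>2)"
      by (simp add: \<tau>_def power_divide)
    finally have e: "exp (- x\<^sup>2 / (2 * \<sigma>\<^sup>2)) * exp (c * x\<^sup>2) = exp (- x\<^sup>2 / (2 * \<tau>\<^sup>2))"
      by (simp only: flip: exp_add)
    have "sqrt (2 * pi * \<sigma>\<^sup>2) = q * sqrt (2 * pi * \<tau>\<^sup>2)"
      using q \<sigma> by (simp add: \<tau>_def real_sqrt_mult real_sqrt_divide)
    with e show "ennreal (normal_density 0 \<sigma> x) * ennreal (exp (c * x\<^sup>2))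
      = ennreal (1 / q) * ennreal (normal_density 0 \<tau> x)"
      using q by (simp add: normal_density_def flip: ennreal_mult)
  qed
  also have "\<dots> = ennreal (1 / q) * (\<integral>\<^sup>+x. ennreal (normal_density 0 \<tau> x) \<partial>lborel)"
    by (simp add: nn_integral_cmult)
  also have "(\<integral>\<^sup>+x. ennreal (normal_density 0 \<tau> x) \<partial>lborel) = 1"
    using N.emeasure_space_1 by (simp add: emeasure_density)
  finally show ?thesis by (simp add: q_def)
qed

lemma nn_integral_PiM_centered_normal_exp:
  assumes "\<sigma> \<ge> 0" "finite J"
  shows "(\<integral>\<^sup>+g. ennreal (exp (\<Sum>j\<in>J. c j * g j)) \<partial>PiM J (\<lambda>_. centered_normal \<sigma>))
    = ennreal (exp (\<sigma>\<^sup>2 * (\<Sum>j\<in>J. (c j)\<^sup>2) / 2))"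
proof -
  interpret product_prob_space "\<lambda>_. centered_normal \<sigma>" J
    by (rule product_prob_space_centered_normal) fact
  have "(\<integral>\<^sup>+g. ennreal (exp (\<Sum>j\<in>J. c j * g j)) \<partial>PiM J (\<lambda>_. centered_normal \<sigma>))
    = (\<integral>\<^sup>+g. (\<Prod>j\<in>J. ennreal (exp (c j * g j))) \<partial>PiM J (\<lambda>_. centered_normal \<sigma>))"
    by (simp add: exp_sum assms prod_ennreal)
  also have "\<dots> = (\<Prod>j\<in>J. \<integral>\<^sup>+x. ennreal (exp (c j * x)) \<partial>centered_normal \<sigma>)"
    by (intro product_nn_integral_prod assms) measurable
  also have "\<dots> = ennreal (exp (\<sigma>\<^sup>2 * (\<Sum>j\<in>J. (c j)\<^sup>2) / 2))"
    by (simp add: nn_integral_centered_normal_exp assms prod_ennreal exp_sum[symmetric]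
        sum_distrib_left sum_divide_distrib)
  finally show ?thesis .
qed

text \<open>Nonnegative integrals spare every integrability question. The bound \<open>b\<close> is
  what remains of the exponential moment after division by exp (t a).\<close>

lemma (in prob_space) chernoff_bound:
  assumes "X \<in> borel_measurable M" "t > 0" and that: "(\<integral>\<^sup>+\<omega>. ennreal (exp (t * X \<omega>)) \<partial>M) \<le> ennreal (b * exp (t * a))" "b \<ge> 0"
  shows "prob {\<omega> \<in> space M. a < X \<omega>} \<le> b"
proof -
  have [measurable]: "X \<in> borel_measurable M" by fact
  have "emeasure M {\<omega> \<in> space M. a < X \<omega>} = (\<integral>\<^sup>+\<omega>. indicator {\<omega> \<in> space M. a < X \<omega>} \<omega> \<partial>M)"
    by (subst nn_integral_indicator) auto
  also have "\<dots> \<le> (\<integral>\<^sup>+\<omega>. ennreal (exp (- t * a)) * ennreal (exp (t * X \<omega>)) \<partial>M)"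
  proof (intro nn_integral_mono)
    fix \<omega>
    have "1 \<le> exp (- t * a) * exp (t * X \<omega>)" if "a < X \<omega>"
      using that \<open>t > 0\<close> by (simp flip: exp_add)
    then show "indicator {\<omega> \<in> space M. a < X \<omega>} \<omega> \<le> ennreal (exp (- t * a)) * ennreal (exp (t * X \<omega>))"
      by (auto simp: indicator_def simp flip: ennreal_mult ennreal_1 intro!: ennreal_leI)
  qed
  also have "\<dots> = ennreal (exp (- t * a)) * (\<integral>\<^sup>+\<omega>. ennreal (exp (t * X \<omega>)) \<partial>M)"
    by (intro nn_integral_cmult) measurable
  also have "\<dots> \<le> ennreal (exp (- t * a)) * ennreal (b * exp (t * a))"
    by (intro mult_left_mono that) auto
  also have "\<dots> = ennreal b"
    using that by (simp add: exp_minus flip: ennreal_mult)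
  finally show ?thesis using that by (simp add: emeasure_eq_measure)
qed

text \<open>Independence makes the joint law a product, so Fubini amounts to conditioning on
  \<open>u\<close>. For a fixed value \<open>s\<close> the form is a centered Gaussian of variance
  \<sigma>^2 times the sum of the (c j s)^2, and the bound \<open>B\<close> does not depend on
  \<open>s\<close>. Coefficients that depend on the inputs thus cost no more than constant
  ones.\<close>

lemma (in prob_space) nn_integral_exp_indep_linear_le:
  assumes ind: "indep_var S u (PiM J (\<lambda>_. borel)) \<xi>"
    and law: "distr M (PiM J (\<lambda>_. borel)) \<xi> = PiM J (\<lambda>_. centered_normal \<sigma>)"
    and \<sigma>: "\<sigma> \<ge> 0" and J: "finite J"
    and c: "\<And>j. j \<in> J \<Longrightarrow> c j \<in> borel_measurable S"
    and B: "\<And>s. s \<in> space S \<Longrightarrow> (\<Sum>j\<in>J. (c j s)\<^sup>2) \<le> B"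
  shows "(\<integral>\<^sup>+\<omega>. ennreal (exp (t * (\<Sum>j\<in>J. c j (u \<omega>) * \<xi> \<omega> j))) \<partial>M) \<le> ennreal (exp (\<sigma>\<^sup>2 * t\<^sup>2 * B / 2))"
proof -
  let ?P = "PiM J (\<lambda>_. borel :: real measure)" and ?Q = "PiM J (\<lambda>_. centered_normal \<sigma>)"
  let ?D = "distr M S u"
  define h where "h x = ennreal (exp (\<Sum>j\<in>J. (t * c j (fst x)) * snd x j))" for x
  have u: "u \<in> measurable M S" and \<xi>: "\<xi> \<in> measurable M ?P"
    using ind indep_var_rv1 indep_var_rv2 by blast+
  interpret Q: product_prob_space "\<lambda>_. centered_normal \<sigma>" J
    by (rule product_prob_space_centered_normal) fact
  interpret Q: prob_space ?Q by (rule Q.prob_space_axioms)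
  interpret D: prob_space ?D by (rule prob_space_distr[OF u])
  have cm: "(\<lambda>x. c j (fst x)) \<in> borel_measurable (S \<Otimes>\<^sub>M ?P)" if "j \<in> J" for j
    using measurable_compose[OF measurable_fst c[OF that]] .
  have gm: "(\<lambda>x. snd x j) \<in> borel_measurable (S \<Otimes>\<^sub>M ?P)" if "j \<in> J" for j
    using measurable_compose[OF measurable_snd measurable_component_singleton[OF that]] .
  have h: "h \<in> borel_measurable (S \<Otimes>\<^sub>M ?P)"
    unfolding h_def
    by (intro measurable_compose[OF _ measurable_ennreal] measurable_compose[OF _ borel_measurable_exp] borel_measurable_sum
        borel_measurable_times borel_measurable_const cm gm)
  have sQ: "sets ?Q = sets ?P" by (intro sets_PiM_cong) simp_all
  have h': "h \<in> borel_measurable (?D \<Otimes>\<^sub>M ?Q)"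
    using h by (simp cong: measurable_cong_sets sets_pair_measure_cong add: sQ)
  have "(\<integral>\<^sup>+\<omega>. ennreal (exp (t * (\<Sum>j\<in>J. c j (u \<omega>) * \<xi> \<omega> j))) \<partial>M) = (\<integral>\<^sup>+\<omega>. h (u \<omega>, \<xi> \<omega>) \<partial>M)"
    by (simp add: h_def sum_distrib_left mult.assoc)
  also have "\<dots> = (\<integral>\<^sup>+x. h x \<partial>distr M (S \<Otimes>\<^sub>M ?P) (\<lambda>\<omega>. (u \<omega>, \<xi> \<omega>)))"
    by (rule nn_integral_distr[symmetric, OF measurable_Pair[OF u \<xi>]]) (simp add: h)
  also have "distr M (S \<Otimes>\<^sub>M ?P) (\<lambda>\<omega>. (u \<omega>, \<xi> \<omega>)) = ?D \<Otimes>\<^sub>M ?Q"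
    using ind[unfolded indep_var_distribution_eq] by (simp add: law)
  also have "(\<integral>\<^sup>+x. h x \<partial>(?D \<Otimes>\<^sub>M ?Q)) = (\<integral>\<^sup>+s. \<integral>\<^sup>+g. h (s, g) \<partial>?Q \<partial>?D)"
    by (rule Q.nn_integral_fst[symmetric, OF h'])
  also have "\<dots> = (\<integral>\<^sup>+s. ennreal (exp (\<sigma>\<^sup>2 * (\<Sum>j\<in>J. (t * c j s)\<^sup>2) / 2)) \<partial>?D)"
    unfolding h_def fst_conv snd_conv by (simp only: nn_integral_PiM_centered_normal_exp[OF \<sigma> J])
  also have "\<dots> \<le> (\<integral>\<^sup>+s. ennreal (exp (\<sigma>\<^sup>2 * t\<^sup>2 * B / 2)) \<partial>?D)"
  proof (intro nn_integral_mono ennreal_leI)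
    fix s assume "s \<in> space ?D"
    then have "\<sigma>\<^sup>2 * t\<^sup>2 * (\<Sum>j\<in>J. (c j s)\<^sup>2) \<le> \<sigma>\<^sup>2 * t\<^sup>2 * B" using B by (intro mult_left_mono) auto
    then show "exp (\<sigma>\<^sup>2 * (\<Sum>j\<in>J. (t * c j s)\<^sup>2) / 2) \<le> exp (\<sigma>\<^sup>2 * t\<^sup>2 * B / 2)"
      by (simp add: power_mult_distrib mult.assoc flip: sum_distrib_left)
  qed
  also have "\<dots> = ennreal (exp (\<sigma>\<^sup>2 * t\<^sup>2 * B / 2))" using D.emeasure_space_1 by (simp only: nn_integral_const mult_1_right)
  finally show ?thesis .
qed

text \<open>For \<sigma> > 0 this is the sub-Gaussian tail. The noise level 0 is included: the
  threshold is then 0, and the claim says in particular that the form is almost surely not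
  positive.\<close>

lemma (in prob_space) prob_indep_linear_tail:
  assumes ind: "indep_var S u (PiM J (\<lambda>_. borel)) \<xi>"
    and law: "distr M (PiM J (\<lambda>_. borel)) \<xi> = PiM J (\<lambda>_. centered_normal \<sigma>)"
    and \<sigma>: "\<sigma> \<ge> 0" and J: "finite J"
    and c: "\<And>j. j \<in> J \<Longrightarrow> c j \<in> borel_measurable S"
    and B: "\<And>s. s \<in> space S \<Longrightarrow> (\<Sum>j\<in>J. (c j s)\<^sup>2) \<le> B" and B0: "B > 0" and \<tau>: "\<tau> \<ge> 0"
  shows "(\<lambda>\<omega>. \<Sum>j\<in>J. c j (u \<omega>) * \<xi> \<omega> j) \<in> borel_measurable M" (is "?X \<in> _")
    and "prob {\<omega> \<in> space M. \<tau> * \<sigma> < (\<Sum>j\<in>J. c j (u \<omega>) * \<xi> \<omega> j)} \<le> exp (- \<tau>\<^sup>2 / (2 * B))"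
proof -
  have u: "u \<in> measurable M S" and \<xi>: "\<xi> \<in> measurable M (PiM J (\<lambda>_. borel))"
    using ind indep_var_rv1 indep_var_rv2 by blast+
  show X: "?X \<in> borel_measurable M"
    by (intro borel_measurable_sum borel_measurable_times measurable_compose[OF u c]
        measurable_compose[OF \<xi> measurable_component_singleton])
  note exp_bound = nn_integral_exp_indep_linear_le[OF ind law \<sigma> J c B]
  show "prob {\<omega> \<in> space M. \<tau> * \<sigma> < ?X \<omega>} \<le> exp (- \<tau>\<^sup>2 / (2 * B))"
  proof (cases "\<tau> = 0 \<or> \<sigma> = 0")
    case False
    \<comment> \<open>The minimizer of \<sigma>^2 t^2 B / 2 - t \<tau> \<sigma>.\<close>
    define t where "t = \<tau> / (\<sigma> * B)"
    have t: "t > 0" using False B0 \<sigma> \<tau> by (auto simp: t_def)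
    have "\<sigma>\<^sup>2 * t\<^sup>2 * B / 2 = - \<tau>\<^sup>2 / (2 * B) + t * (\<tau> * \<sigma>)"
      using False B0 by (simp add: t_def field_simps power2_eq_square)
    then have "exp (\<sigma>\<^sup>2 * t\<^sup>2 * B / 2) = exp (- \<tau>\<^sup>2 / (2 * B)) * exp (t * (\<tau> * \<sigma>))"
      by (simp only: exp_add)
    with exp_bound[of t] show ?thesis by (intro chernoff_bound[OF X t]) auto
  next
    case True
    show ?thesis
    proof (cases "\<tau> = 0")
      case True then show ?thesis by simp
    next
      case False
      with True have 0: "\<sigma> = 0" by simp
      have z: "prob {\<omega> \<in> space M. a < ?X \<omega>} = 0" if a: "a > 0" for a
      proof (rule ccontr)
        let ?p = "prob {\<omega> \<in> space M. a < ?X \<omega>}"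
        assume "?p \<noteq> 0"
        then have p: "?p > 0" by (simp add: order_less_le)
        \<comment> \<open>For \<sigma> = 0 all exponential moments are at most 1, so
          \<open>t\<close> may be arbitrarily large. This value makes the Chernoff bound read p
          \<le> p / e, which contradicts p > 0.\<close>
        define t where "t = (1 - ln ?p) / a"
        have "ln ?p \<le> 0" using p by simp
        then have t: "t > 0" "t * a = 1 - ln ?p" using a by (simp_all add: t_def)
        have "?p \<le> exp (- (t * a))"
          using exp_bound[of t] 0 by (intro chernoff_bound[OF X t(1)]) (auto simp: exp_minus)
        also have "\<dots> = exp (- 1) * ?p" 
        proof -
          have "- (t * a) = - 1 + ln ?p" using t by simp
          then show ?thesis using p by (simp only: exp_add exp_ln)
        qed
        also have "\<dots> < 1 * ?p" using p by (intro mult_strict_right_mono) auto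
        finally show False by simp
      qed
      have "{\<omega> \<in> space M. 1 / real (Suc n) < ?X \<omega>} \<in> null_sets M" for n
        using X z[of "1 / real (Suc n)"] by (auto simp: null_sets_def emeasure_eq_measure)
      then have "(\<Union>n. {\<omega> \<in> space M. 1 / real (Suc n) < ?X \<omega>}) \<in> null_sets M" by (rule null_sets_UN)
      moreover have "{\<omega> \<in> space M. 0 < ?X \<omega>} = (\<Union>n. {\<omega> \<in> space M. 1 / real (Suc n) < ?X \<omega>})"
      proof (intro equalityI subsetI)
        fix \<omega> assume "\<omega> \<in> {\<omega> \<in> space M. 0 < ?X \<omega>}"
        then show "\<omega> \<in> (\<Union>n. {\<omega> \<in> space M. 1 / real (Suc n) < ?X \<omega>})"
          using reals_Archimedean[of "?X \<omega>"] by (auto simp: inverse_eq_divide)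
      next
        fix \<omega> assume "\<omega> \<in> (\<Union>n. {\<omega> \<in> space M. 1 / real (Suc n) < ?X \<omega>})"
        then obtain n where "\<omega> \<in> space M" "1 / real (Suc n) < ?X \<omega>" by blast
        moreover have "0 < 1 / real (Suc n)" by simp
        ultimately have "0 < ?X \<omega>" by (rule_tac less_trans)
        with \<open>\<omega> \<in> space M\<close> show "\<omega> \<in> {\<omega> \<in> space M. 0 < ?X \<omega>}" by blast
      qed
      ultimately have "measure M {\<omega> \<in> space M. 0 < ?X \<omega>} = 0" by (simp only: measure_eq_0_null_sets)
      then show ?thesis by (simp add: 0)
    qed
  qed
qed

section \<open>Noise restricted to the row space of the inputs\<close>

lemma gram_schmidt_vec_measurable:
  assumes "finite I" "\<And>b i. b < d \<Longrightarrow> i \<in> I \<Longrightarrow> f b i \<in> borel_measurable S"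
  shows "a < d \<Longrightarrow> i \<in> I \<Longrightarrow> (\<lambda>s. gram_schmidt_vec I (\<lambda>b i. f b i s) a i) \<in> borel_measurable S"
proof (induction a arbitrary: i rule: less_induct)
  case (less a)
  have IH: "(\<lambda>s. gram_schmidt_vec I (\<lambda>b i. f b i s) b i) \<in> borel_measurable S" if "b < a" "i \<in> I" for b i
    using less that by auto
  have fa: "f a i \<in> borel_measurable S" if "i \<in> I" for i using assms less that by auto
  have r: "(\<lambda>s. f a i s - (\<Sum>b<a. (\<Sum>j\<in>I. f a j s * gram_schmidt_vec I (\<lambda>b i. f b i s) b j) *
      gram_schmidt_vec I (\<lambda>b i. f b i s) b i)) \<in> borel_measurable S" if "i \<in> I" for i
    using that by (intro borel_measurable_diff borel_measurable_sum borel_measurable_times fa IH) auto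
  show ?case
    unfolding gram_schmidt_vec.simps[of _ _ a] Let_def L2_set_def
    by (intro borel_measurable_divide measurable_compose[OF _ borel_measurable_sqrt] borel_measurable_sum
        borel_measurable_power r less.prems)
qed

text \<open>The random row space is replaced by the fixed coefficient space of its Gram-Schmidt
  family, so the union bound runs over two deterministic nets, of dimensions \<open>r\<close> and
  \<open>d\<close>, and the exponent r + d is independent of the number of columns. The injection
  \<open>\<rho>\<close> will be a time shift: noise \<open>j\<close> in \<open>K\<close> is paired
  with column \<open>\<rho> j\<close>, and injectivity keeps the squared coefficients below the full
  sum over \<open>I\<close>.\<close>

lemma (in prob_space) noise_uniform_bound:
  fixes f :: "nat \<Rightarrow> 'i \<Rightarrow> ('j \<times> nat \<Rightarrow> real) \<Rightarrow> real" and \<rho> :: "'j \<Rightarrow> 'i"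
    and u \<xi> :: "'a \<Rightarrow> 'j \<times> nat \<Rightarrow> real"
  assumes I: "finite I" and J: "finite J" and r: "r \<ge> 1" and d: "d \<ge> 1"
    and f: "\<And>b i. b < d \<Longrightarrow> i \<in> I \<Longrightarrow> f b i \<in> borel_measurable S"
    and ind: "indep_var S u (PiM (J \<times> {..<r}) (\<lambda>_. borel)) \<xi>"
    and law: "distr M (PiM (J \<times> {..<r}) (\<lambda>_. borel)) \<xi> = PiM (J \<times> {..<r}) (\<lambda>_. centered_normal \<sigma>)"
    and \<sigma>: "\<sigma> \<ge> 0" and s: "s \<ge> 0"
    and \<rho>: "inj_on \<rho> K" "K \<subseteq> J" "\<rho> ` K \<subseteq> I"
  shows "\<exists>E\<in>events. prob E \<le> (9 * (5/4) ^ 5) ^ (r + d) * exp (- (128/625) * s\<^sup>2) \<and>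
    (\<forall>\<omega>\<in>space M - E. \<forall>x y.
      (\<Sum>k<r. x k * (\<Sum>j\<in>K. (\<Sum>b<d. y b * f b (\<rho> j) (u \<omega>)) * \<xi> \<omega> (j, k)))
        \<le> L2_set x {..<r} * L2_set (\<lambda>i. \<Sum>b<d. y b * f b i (u \<omega>)) I * (\<sigma> * s))"
proof -
  define e where "e s = gram_schmidt_vec I (\<lambda>b i. f b i s)" for s
  have e: "(\<lambda>s. e s a i) \<in> borel_measurable S" if "a < d" "i \<in> I" for a i
    unfolding e_def by (rule gram_schmidt_vec_measurable[OF I f]) (use that in auto)
  \<comment> \<open>The coefficients are set to 0 outside \<open>K\<close>, so that the form runs
    over all of J \<times> {..<r}, where the law and the independence of \<open>\<xi>\<close> are
    given.\<close>
  define c where "c k k' p s = (if fst p \<in> K then of_int (k (snd p)) * (\<Sum>a<d. of_int (k' a) * e s a (\<rho> (fst p))) else 0)"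
    for k k' :: "nat \<Rightarrow> int" and p :: "'j \<times> nat" and s
  define \<tau> where "\<tau> = 16 * sqrt (real r) * sqrt (real d) * s"
  have \<tau>: "\<tau> \<ge> 0" using s by (simp add: \<tau>_def)
  \<comment> \<open>The product of the squared radii 25 r and 25 d of the two nets. With \<tau>
    carrying the inverse mesh widths 16 sqrt r sqrt d, the exponent is 256 / (2 * 625) = 128/625,
    free of the dimensions.\<close>
  define B where "B = 625 * real r * real d"
  have B0: "B > 0" using r d by (simp add: B_def)
  have cm: "c k k' p \<in> borel_measurable S" if "p \<in> J \<times> {..<r}" for k k' p
  proof (cases "fst p \<in> K")
    case True
    then have "\<rho> (fst p) \<in> I" using \<rho> by auto
    then have "(\<lambda>t. of_int (k (snd p)) * (\<Sum>a<d. of_int (k' a) * e t a (\<rho> (fst p)))) \<in> borel_measurable S"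
      by (intro borel_measurable_times borel_measurable_sum borel_measurable_const e) auto
    moreover have "c k k' p = (\<lambda>t. of_int (k (snd p)) * (\<Sum>a<d. of_int (k' a) * e t a (\<rho> (fst p))))"
      using True by (simp add: c_def fun_eq_iff)
    ultimately show ?thesis by simp
  next
    case False
    then have "c k k' p = (\<lambda>t. 0)" by (simp add: c_def fun_eq_iff)
    then show ?thesis by simp
  qed
  have sum_K: "(\<Sum>p\<in>J \<times> {..<r}. if fst p \<in> K then g p else 0) = (\<Sum>j\<in>K. \<Sum>k<r. g (j, k))" for g :: "'j \<times> nat \<Rightarrow> real"
  proof -
    have "(\<Sum>p\<in>J \<times> {..<r}. if fst p \<in> K then g p else 0) = (\<Sum>p\<in>K \<times> {..<r}. g p)"
      using \<rho>(2) J by (intro sum.mono_neutral_cong_right) auto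
    then show ?thesis by (simp add: sum.cartesian_product)
  qed
  have cB: "(\<Sum>p\<in>J \<times> {..<r}. (c k k' p t)\<^sup>2) \<le> B" if k: "k \<in> lattice_net r" "k' \<in> lattice_net d" for k k' t
  proof -
    have "(\<Sum>p\<in>J \<times> {..<r}. (c k k' p t)\<^sup>2) =
      (\<Sum>p\<in>J \<times> {..<r}. if fst p \<in> K then (of_int (k (snd p)))\<^sup>2 * (\<Sum>a<d. of_int (k' a) * e t a (\<rho> (fst p)))\<^sup>2 else 0)"
      unfolding c_def by (intro sum.cong refl) (simp add: power_mult_distrib)
    also have "\<dots> = (\<Sum>j\<in>K. \<Sum>l<r. (of_int (k l))\<^sup>2 * (\<Sum>a<d. of_int (k' a) * e t a (\<rho> j))\<^sup>2)"
      unfolding sum_K by simp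
    also have "\<dots> = (\<Sum>l<r. (of_int (k l))\<^sup>2) * (\<Sum>j\<in>K. (\<Sum>a<d. of_int (k' a) * e t a (\<rho> j))\<^sup>2)"
      unfolding sum_distrib_left sum_distrib_right by (simp add: sum.swap[of _ _ K])
    also have "(\<Sum>j\<in>K. (\<Sum>a<d. of_int (k' a) * e t a (\<rho> j))\<^sup>2) = (\<Sum>i\<in>\<rho> ` K. (\<Sum>a<d. of_int (k' a) * e t a i)\<^sup>2)"
      by (simp add: sum.reindex[OF \<rho>(1)])
    also have "\<dots> \<le> (\<Sum>i\<in>I. (\<Sum>a<d. of_int (k' a) * e t a i)\<^sup>2)"
      by (intro sum_mono2 I \<rho>(3)) simp
    also have "\<dots> \<le> (\<Sum>a<d. (of_int (k' a))\<^sup>2)" unfolding e_def by (rule gram_schmidt_vec_norm_le[OF I])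
    also have "(\<Sum>a<d. (real_of_int (k' a))\<^sup>2) = of_int (\<Sum>a<d. (k' a)\<^sup>2)" by simp
    also have "\<dots> \<le> of_int (25 * int d)" using k(2) unfolding of_int_le_iff by (simp add: lattice_net_def)
    also have "(\<Sum>l<r. (real_of_int (k l))\<^sup>2) = of_int (\<Sum>l<r. (k l)\<^sup>2)" by simp
    also have "of_int (\<Sum>l<r. (k l)\<^sup>2) * of_int (25 * int d) \<le> of_int (25 * int r) * (of_int (25 * int d) :: real)"
      using k(1) by (intro mult_right_mono of_int_le_iff[THEN iffD2]) (auto simp: lattice_net_def)
    also have "\<dots> = B" by (simp add: B_def)
    finally show ?thesis by (simp add: mult_left_mono sum_nonneg)
  qed
  define X where "X k k' \<omega> = (\<Sum>p\<in>J \<times> {..<r}. c k k' p (u \<omega>) * \<xi> \<omega> p)" for k k' \<omega>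
  have fJ: "finite (J \<times> {..<r})" using J by simp
  note tail = prob_indep_linear_tail[OF ind law \<sigma> fJ cm cB B0 \<tau>]
  have Xm: "X k k' \<in> borel_measurable M" if "k \<in> lattice_net r" "k' \<in> lattice_net d" for k k'
    unfolding X_def by (rule tail(1)) (use that in auto)
  have Xp: "prob {\<omega> \<in> space M. \<tau> * \<sigma> < X k k' \<omega>} \<le> exp (- (128/625) * s\<^sup>2)"
    if "k \<in> lattice_net r" "k' \<in> lattice_net d" for k k'
  proof -
    have "prob {\<omega> \<in> space M. \<tau> * \<sigma> < X k k' \<omega>} \<le> exp (- \<tau>\<^sup>2 / (2 * B))"
      unfolding X_def by (rule tail(2)) (use that in auto)
    also have "- \<tau>\<^sup>2 / (2 * B) = - (128/625) * s\<^sup>2"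
      using r d by (simp add: \<tau>_def B_def power_mult_distrib field_simps)
    finally show ?thesis .
  qed
  define bad where "bad q = {\<omega> \<in> space M. \<tau> * \<sigma> < X (fst q) (snd q) \<omega>}" for q
  let ?N = "lattice_net r \<times> lattice_net d"
  define E where "E = (\<Union>q\<in>?N. bad q)"
  have bad: "bad q \<in> events" if "q \<in> ?N" for q
    using Xm[of "fst q" "snd q"] that unfolding bad_def by auto
  show ?thesis
  proof (rule bexI[of _ E], rule conjI)
    show "E \<in> events" unfolding E_def using bad by (intro sets.finite_UN) auto
    have "prob E \<le> (\<Sum>q\<in>?N. prob (bad q))"
      unfolding E_def using bad by (intro finite_measure_subadditive_finite) auto
    also have "\<dots> \<le> (\<Sum>q\<in>?N. exp (- (128/625) * s\<^sup>2))"
      unfolding bad_def by (intro sum_mono Xp) auto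
    also have "\<dots> = real (card (lattice_net r)) * real (card (lattice_net d)) * exp (- (128/625) * s\<^sup>2)"
      by simp
    also have "\<dots> \<le> (9 * (5/4) ^ 5) ^ r * (9 * (5/4) ^ 5) ^ d * exp (- (128/625) * s\<^sup>2)"
      by (intro mult_right_mono mult_mono card_lattice_net) auto
    finally show "prob E \<le> (9 * (5/4) ^ 5) ^ (r + d) * exp (- (128/625) * s\<^sup>2)"
      by (simp only: power_add)
  next
    show "\<forall>\<omega>\<in>space M - E. \<forall>x y.
      (\<Sum>k<r. x k * (\<Sum>j\<in>K. (\<Sum>b<d. y b * f b (\<rho> j) (u \<omega>)) * \<xi> \<omega> (j, k)))
        \<le> L2_set x {..<r} * L2_set (\<lambda>i. \<Sum>b<d. y b * f b i (u \<omega>)) I * (\<sigma> * s)"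
    proof (intro ballI allI)
      fix \<omega> x y assume \<omega>: "\<omega> \<in> space M - E"
      define b where "b k a = (\<Sum>j\<in>K. e (u \<omega>) a (\<rho> j) * \<xi> \<omega> (j, k))" for k a
      have bx: "(\<Sum>k<r. \<Sum>a<d. x k * y a * b k a) = (\<Sum>k<r. x k * (\<Sum>j\<in>K. (\<Sum>a<d. y a * e (u \<omega>) a (\<rho> j)) * \<xi> \<omega> (j, k)))"
        for x y :: "nat \<Rightarrow> real"
        unfolding b_def sum_distrib_left sum_distrib_right
        by (intro sum.cong refl) (subst sum.swap, simp add: mult_ac)
      have net: "(\<Sum>i<r. \<Sum>j<d. of_int (k i) * of_int (k' j) * b i j) \<le> 16 * sqrt (real r) * sqrt (real d) * (\<sigma> * s)"
        if kk: "k \<in> lattice_net r" "k' \<in> lattice_net d" for k k'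
      proof -
        define S where "S j = (\<Sum>a<d. of_int (k' a) * e (u \<omega>) a (\<rho> j))" for j
        have "(\<Sum>i<r. \<Sum>j<d. of_int (k i) * of_int (k' j) * b i j) =
            (\<Sum>i<r. of_int (k i) * (\<Sum>j\<in>K. S j * \<xi> \<omega> (j, i)))"
          unfolding bx S_def ..
        also have "\<dots> = (\<Sum>i<r. \<Sum>j\<in>K. of_int (k i) * S j * \<xi> \<omega> (j, i))"
          by (simp add: sum_distrib_left mult.assoc)
        also have "\<dots> = (\<Sum>j\<in>K. \<Sum>i<r. of_int (k i) * S j * \<xi> \<omega> (j, i))" by (rule sum.swap)
        also have "\<dots> = (\<Sum>p\<in>J \<times> {..<r}. if fst p \<in> K then of_int (k (snd p)) * S (fst p) * \<xi> \<omega> p else 0)"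
          unfolding sum_K by simp
        also have "\<dots> = X k k' \<omega>"
          unfolding X_def c_def S_def by (intro sum.cong refl) simp
        also have "\<dots> \<le> \<tau> * \<sigma>"
        proof (rule ccontr)
          assume "\<not> ?thesis"
          then have "\<omega> \<in> bad (k, k')" using \<omega> by (simp add: bad_def)
          with kk \<omega> show False by (auto simp: E_def)
        qed
        finally show ?thesis by (simp add: \<tau>_def mult_ac)
      qed
      \<comment> \<open>An arbitrary combination of the rows is passed to Gram-Schmidt coordinates
        of equal norm, for which the net estimate holds.\<close>
      obtain cc where cc: "\<And>i. i \<in> I \<Longrightarrow> (\<Sum>b<d. y b * f b i (u \<omega>)) = (\<Sum>a<d. cc a * e (u \<omega>) a i)"
        "L2_set cc {..<d} = L2_set (\<lambda>i. \<Sum>b<d. y b * f b i (u \<omega>)) I"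
        using gram_schmidt_vec_coords[OF I, where d = d and y = y and f = "\<lambda>b i. f b i (u \<omega>)"] unfolding e_def by blast
      have "(\<Sum>k<r. x k * (\<Sum>j\<in>K. (\<Sum>b<d. y b * f b (\<rho> j) (u \<omega>)) * \<xi> \<omega> (j, k))) =
          (\<Sum>k<r. x k * (\<Sum>j\<in>K. (\<Sum>a<d. cc a * e (u \<omega>) a (\<rho> j)) * \<xi> \<omega> (j, k)))"
        using \<rho>(3) by (intro sum.cong refl arg_cong2[of _ _ _ _ "(*)"] cc(1)) auto
      also have "\<dots> = (\<Sum>k<r. \<Sum>a<d. x k * cc a * b k a)" by (rule bx[symmetric])
      also have "\<dots> \<le> L2_set x {..<r} * L2_set cc {..<d} * (\<sigma> * s)"
        by (rule bilinear_form_le_from_net[OF r d net])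
      finally show "(\<Sum>k<r. x k * (\<Sum>j\<in>K. (\<Sum>b<d. y b * f b (\<rho> j) (u \<omega>)) * \<xi> \<omega> (j, k)))
        \<le> L2_set x {..<r} * L2_set (\<lambda>i. \<Sum>b<d. y b * f b i (u \<omega>)) I * (\<sigma> * s)"
        by (simp only: cc(2))
    qed
  qed
qed

section \<open>Chi-square tails and the smallest singular value of a Gaussian matrix\<close>

lemma (in prob_space) indep_normal_linear_combination:
  assumes B: "finite B" and ind: "indep_vars (\<lambda>_. borel) Z B"
    and law: "\<And>b. b \<in> B \<Longrightarrow> distr M borel (Z b) = centered_normal \<sigma>"
    and \<sigma>: "\<sigma> > 0" and k: "(\<Sum>b\<in>B. (k b)\<^sup>2) > 0"
  shows "distr M borel (\<lambda>\<omega>. \<Sum>b\<in>B. k b * Z b \<omega>) = centered_normal (\<sigma> * sqrt (\<Sum>b\<in>B. (k b)\<^sup>2))"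
proof -
  \<comment> \<open>Terms with coefficient 0 are point masses, not normal densities, and are
    dropped. The positive sum of squares keeps the remaining index set nonempty.\<close>
  define B' where "B' = {b \<in> B. k b \<noteq> 0}"
  have B': "finite B'" "B' \<subseteq> B" using B by (auto simp: B'_def)
  have ne: "B' \<noteq> {}"
  proof
    assume "B' = {}"
    then have "(\<Sum>b\<in>B. (k b)\<^sup>2) = 0" by (intro sum.neutral) (auto simp: B'_def)
    with k show False by simp
  qed
  have rv: "Z b \<in> borel_measurable M" if "b \<in> B" for b
    using ind that by (auto simp: indep_vars_def)
  have normal: "distributed M lborel (\<lambda>\<omega>. k b * Z b \<omega>) (normal_density 0 (\<bar>k b\<bar> * \<sigma>))" if b: "b \<in> B'" for b
  proof -
    have "distr M lborel (Z b) = distr M borel (Z b)" by (intro distr_cong) auto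
    also have "\<dots> = density lborel (\<lambda>x. ennreal (normal_density 0 \<sigma> x))"
      using law b B' \<sigma> by (auto simp: centered_normal_def)
    finally have "distributed M lborel (Z b) (normal_density 0 \<sigma>)"
      using rv b B' by (auto simp: distributed_def)
    from normal_density_affine[OF this \<sigma>, of "k b" 0] b show ?thesis by (simp add: B'_def)
  qed
  have ind': "indep_vars (\<lambda>_. borel) (\<lambda>b \<omega>. k b * Z b \<omega>) B'"
    using indep_vars_compose2[OF indep_vars_subset[OF ind B'(2)], of "\<lambda>b x. k b * x" "\<lambda>_. borel"] by simp
  have sumk: "(\<Sum>b\<in>B'. (\<bar>k b\<bar> * \<sigma>)\<^sup>2) = \<sigma>\<^sup>2 * (\<Sum>b\<in>B. (k b)\<^sup>2)"
    unfolding sum_distrib_left using B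
    by (intro sum.mono_neutral_cong_left) (auto simp: B'_def power_mult_distrib)
  have "distributed M lborel (\<lambda>\<omega>. \<Sum>b\<in>B'. k b * Z b \<omega>) (normal_density (\<Sum>b\<in>B'. 0) (sqrt (\<Sum>b\<in>B'. (\<bar>k b\<bar> * \<sigma>)\<^sup>2)))"
    by (rule sum_indep_normal[OF B'(1) ne ind' _ normal]) (auto simp: B'_def \<sigma>)
  then have "distr M lborel (\<lambda>\<omega>. \<Sum>b\<in>B'. k b * Z b \<omega>)
      = density lborel (\<lambda>x. ennreal (normal_density 0 (\<sigma> * sqrt (\<Sum>b\<in>B. (k b)\<^sup>2)) x))"
    using \<sigma> by (simp add: distributed_def sumk real_sqrt_mult)
  moreover have "(\<lambda>\<omega>. \<Sum>b\<in>B'. k b * Z b \<omega>) = (\<lambda>\<omega>. \<Sum>b\<in>B. k b * Z b \<omega>)"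
    using B by (intro ext sum.mono_neutral_left) (auto simp: B'_def)
  moreover have "distr M borel (\<lambda>\<omega>. \<Sum>b\<in>B. k b * Z b \<omega>) = distr M lborel (\<lambda>\<omega>. \<Sum>b\<in>B. k b * Z b \<omega>)"
    by (intro distr_cong) auto
  moreover have "\<sigma> * sqrt (\<Sum>b\<in>B. (k b)\<^sup>2) \<noteq> 0" using \<sigma> k by simp
  ultimately show ?thesis by (simp add: centered_normal_def)
qed

lemma (in prob_space) nn_integral_exp_sum_squares:
  assumes I: "finite I" and ind: "indep_vars (\<lambda>_. borel) S I"
    and law: "\<And>i. i \<in> I \<Longrightarrow> distr M borel (S i) = centered_normal \<tau>"
    and \<tau>: "\<tau> > 0" and c: "2 * c * \<tau>\<^sup>2 < 1"
  shows "(\<integral>\<^sup>+\<omega>. ennreal (exp (c * (\<Sum>i\<in>I. (S i \<omega>)\<^sup>2))) \<partial>M) = ennreal ((1 / sqrt (1 - 2 * c * \<tau>\<^sup>2)) ^ card I)"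
proof -
  have rv: "S i \<in> borel_measurable M" if "i \<in> I" for i
    using ind that by (auto simp: indep_vars_def)
  have m: "(\<lambda>x::real. ennreal (exp (c * x\<^sup>2))) \<in> borel_measurable borel" by measurable
  have "(\<integral>\<^sup>+\<omega>. ennreal (exp (c * (\<Sum>i\<in>I. (S i \<omega>)\<^sup>2))) \<partial>M) = (\<integral>\<^sup>+\<omega>. (\<Prod>i\<in>I. ennreal (exp (c * (S i \<omega>)\<^sup>2))) \<partial>M)"
    by (simp add: sum_distrib_left exp_sum I prod_ennreal)
  also have "\<dots> = (\<Prod>i\<in>I. \<integral>\<^sup>+\<omega>. ennreal (exp (c * (S i \<omega>)\<^sup>2)) \<partial>M)"
    by (intro indep_vars_nn_integral I indep_vars_compose2[OF ind] m) auto
  also have "\<dots> = (\<Prod>i\<in>I. ennreal (1 / sqrt (1 - 2 * c * \<tau>\<^sup>2)))"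
  proof (intro prod.cong refl)
    fix i assume i: "i \<in> I"
    have "(\<integral>\<^sup>+\<omega>. ennreal (exp (c * (S i \<omega>)\<^sup>2)) \<partial>M) = (\<integral>\<^sup>+x. ennreal (exp (c * x\<^sup>2)) \<partial>distr M borel (S i))"
      using m by (intro nn_integral_distr[symmetric] rv i) simp
    then show "(\<integral>\<^sup>+\<omega>. ennreal (exp (c * (S i \<omega>)\<^sup>2)) \<partial>M) = ennreal (1 / sqrt (1 - 2 * c * \<tau>\<^sup>2))"
      using nn_integral_centered_normal_exp_square[OF \<tau> c] law[OF i] by simp
  qed
  also have "\<dots> = ennreal ((1 / sqrt (1 - 2 * c * \<tau>\<^sup>2)) ^ card I)"
    using c by (simp add: ennreal_power)
  finally show ?thesis .
qed

text \<open>Chernoff for the negated sum. At one sixth of the mean the optimal parameter satisfies 1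
  + 2 t \<tau>^2 = 6, that is t \<tau>^2 = 5/2, and each square contributes exp (5/12) / sqrt
  6.\<close>

lemma (in prob_space) chi_square_lower_tail:
  assumes I: "finite I" and ind: "indep_vars (\<lambda>_. borel) S I"
    and law: "\<And>i. i \<in> I \<Longrightarrow> distr M borel (S i) = centered_normal \<tau>" and \<tau>: "\<tau> > 0"
  shows "prob {\<omega> \<in> space M. (\<Sum>i\<in>I. (S i \<omega>)\<^sup>2) < real (card I) / 6 * \<tau>\<^sup>2} \<le> (exp (5/12) / sqrt 6) ^ card I"
proof -
  have rv: "S i \<in> borel_measurable M" if "i \<in> I" for i
    using ind that by (auto simp: indep_vars_def)
  let ?n = "real (card I)" and ?X = "\<lambda>\<omega>. - (\<Sum>i\<in>I. (S i \<omega>)\<^sup>2)"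
  define t where "t = 5 / (2 * \<tau>\<^sup>2)"
  have t: "t > 0" "t * \<tau>\<^sup>2 = 5 / 2" using \<tau> by (simp_all add: t_def)
  have "prob {\<omega> \<in> space M. - (?n / 6 * \<tau>\<^sup>2) < ?X \<omega>} \<le> (exp (5/12) / sqrt 6) ^ card I"
  proof (rule chernoff_bound)
    show "?X \<in> borel_measurable M" by (intro borel_measurable_uminus borel_measurable_sum borel_measurable_power rv)
    show "t > 0" by fact
    have "(\<integral>\<^sup>+\<omega>. ennreal (exp (t * ?X \<omega>)) \<partial>M) = ennreal ((1 / sqrt (1 - 2 * (- t) * \<tau>\<^sup>2)) ^ card I)"
      using nn_integral_exp_sum_squares[OF I ind law \<tau>, of "- t"] t by simp
    also have "1 - 2 * (- t) * \<tau>\<^sup>2 = 6" using t by simp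
    also have "(1 / sqrt 6) ^ card I = (exp (5/12) / sqrt 6) ^ card I * exp (t * (- (?n / 6 * \<tau>\<^sup>2)))"
    proof -
      have "t * (- (?n / 6 * \<tau>\<^sup>2)) = - (?n * (5/12))" using t(2) by (simp add: algebra_simps)
      then have "exp (t * (- (?n / 6 * \<tau>\<^sup>2))) = inverse (exp (5/12) ^ card I)"
        by (simp only: exp_minus exp_of_nat_mult)
      then show ?thesis by (simp add: power_divide)
    qed
    finally show "(\<integral>\<^sup>+\<omega>. ennreal (exp (t * ?X \<omega>)) \<partial>M)
        \<le> ennreal ((exp (5/12) / sqrt 6) ^ card I * exp (t * (- (?n / 6 * \<tau>\<^sup>2))))" by simp
  qed simp
  then show ?thesis by (simp only: neg_less_iff_less)
qed

text \<open>At twice the mean the optimal parameter satisfies 1 - 2 t \<tau>^2 = 1/2, that is t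
  \<tau>^2 = 1/4.\<close>

lemma (in prob_space) chi_square_upper_tail:
  assumes I: "finite I" and ind: "indep_vars (\<lambda>_. borel) S I"
    and law: "\<And>i. i \<in> I \<Longrightarrow> distr M borel (S i) = centered_normal \<tau>" and \<tau>: "\<tau> > 0"
  shows "prob {\<omega> \<in> space M. 2 * real (card I) * \<tau>\<^sup>2 < (\<Sum>i\<in>I. (S i \<omega>)\<^sup>2)} \<le> (sqrt 2 / exp (1/2)) ^ card I"
proof -
  have rv: "S i \<in> borel_measurable M" if "i \<in> I" for i
    using ind that by (auto simp: indep_vars_def)
  let ?n = "real (card I)" and ?X = "\<lambda>\<omega>. (\<Sum>i\<in>I. (S i \<omega>)\<^sup>2)"
  define t where "t = 1 / (4 * \<tau>\<^sup>2)"
  have t: "t > 0" "t * \<tau>\<^sup>2 = 1 / 4" using \<tau> by (simp_all add: t_def)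
  show ?thesis
  proof (rule chernoff_bound)
    show "?X \<in> borel_measurable M" by (intro borel_measurable_sum borel_measurable_power rv)
    show "t > 0" by fact
    have "(\<integral>\<^sup>+\<omega>. ennreal (exp (t * ?X \<omega>)) \<partial>M) = ennreal ((1 / sqrt (1 - 2 * t * \<tau>\<^sup>2)) ^ card I)"
      using nn_integral_exp_sum_squares[OF I ind law \<tau>, of t] t by simp
    also have "1 - 2 * t * \<tau>\<^sup>2 = 1 / 2" using t by simp
    also have "(1 / sqrt (1 / 2)) ^ card I = (sqrt 2 / exp (1/2)) ^ card I * exp (t * (2 * ?n * \<tau>\<^sup>2))"
    proof -
      have "t * (2 * ?n * \<tau>\<^sup>2) = ?n * (1/2)" using t(2) by (simp add: algebra_simps)
      then have "exp (t * (2 * ?n * \<tau>\<^sup>2)) = exp (1/2) ^ card I"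
        by (simp only: exp_of_nat_mult)
      then show ?thesis by (simp add: power_divide real_sqrt_divide)
    qed
    finally show "(\<integral>\<^sup>+\<omega>. ennreal (exp (t * ?X \<omega>)) \<partial>M)
        \<le> ennreal ((sqrt 2 / exp (1/2)) ^ card I * exp (t * (2 * ?n * \<tau>\<^sup>2)))" by simp
  qed simp
qed

lemma (in prob_space) indep_vars_reindex:
  assumes ind: "indep_vars M' X (f ` I)" and inj: "inj_on f I"
  shows "indep_vars (\<lambda>i. M' (f i)) (\<lambda>i. X (f i)) I"
proof -
  have "indep_vars (\<lambda>i. PiM {f i} M') (\<lambda>i \<omega>. restrict (\<lambda>p. X p \<omega>) {f i}) I"
    using inj by (intro indep_vars_restrict[OF ind]) (auto simp: disjoint_family_on_def inj_on_def)
  then have "indep_vars (\<lambda>i. M' (f i)) (\<lambda>i \<omega>. (restrict (\<lambda>p. X p \<omega>) {f i}) (f i)) I"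
    by (rule indep_vars_compose2) (intro measurable_component_singleton singletonI)
  then show ?thesis by simp
qed

lemma (in prob_space) indep_vars_row_combination:
  assumes ind: "indep_vars (\<lambda>_. borel) Z (I \<times> {..<d})"
  shows "indep_vars (\<lambda>_. borel) (\<lambda>i \<omega>. \<Sum>b<d. k b * Z (i, b) \<omega> :: real) I"
proof -
  define K where "K i = {i} \<times> {..<d}" for i :: 'b
  have 1: "indep_vars (\<lambda>i. PiM (K i) (\<lambda>_. borel)) (\<lambda>i \<omega>. restrict (\<lambda>p. Z p \<omega>) (K i)) I"
    by (rule indep_vars_restrict[OF ind]) (auto simp: K_def disjoint_family_on_def)
  have "indep_vars (\<lambda>_. borel) (\<lambda>i \<omega>. (\<Sum>b<d. k b * (restrict (\<lambda>p. Z p \<omega>) (K i)) (i, b))) I"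
  proof (rule indep_vars_compose2[OF 1])
    fix i
    show "(\<lambda>f. \<Sum>b<d. k b * f (i, b)) \<in> borel_measurable (PiM (K i) (\<lambda>_. borel))"
      by (intro borel_measurable_sum borel_measurable_times borel_measurable_const measurable_component_singleton)
         (auto simp: K_def)
  qed
  then show ?thesis by (simp add: K_def)
qed

text \<open>Each of the N squares contributes exp (- \<alpha>), and exp (8 \<alpha>) = 6^4 / exp
  (10/3) \<ge> 32.4 exceeds the 27.5 points per dimension, so the part 8 d of N pays for the net.
  The part 28 L gives 28 \<alpha> L \<ge> 3.5 L, more than the required 2 L.\<close>

lemma net_exponent_bound:
  assumes L: "L \<ge> 0" and N: "real N \<ge> 8 * real d + 28 * L"
  shows "(9 * (5/4) ^ 5) ^ d * (exp (5/12) / sqrt 6) ^ N \<le> exp (- 2 * L)"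
proof -
  define \<alpha> :: real where "\<alpha> = ln 6 / 2 - 5/12"
  have q: "exp (5/12) / sqrt 6 = exp (- \<alpha>)"
    by (simp add: \<alpha>_def exp_diff exp_minus ln_sqrt flip: powr_half_sqrt) (simp add: powr_def exp_diff exp_minus)
  \<comment> \<open>Compare cubes: e^10 \<le> 3^10 = 59049 < 64000 = 40^3.\<close>
  have "exp (10/3 :: real) \<le> 40"
  proof (rule power_le_imp_le_base[of _ 2])
    have "exp (10/3 :: real) ^ Suc 2 = exp (real 10 * 1)" by (simp flip: exp_of_nat_mult)
    also have "\<dots> = exp 1 ^ 10" by (rule exp_of_nat_mult)
    also have "\<dots> \<le> 3 ^ 10" by (intro power_mono exp_le) simp
    also have "\<dots> \<le> (40::real) ^ Suc 2" by simp
    finally show "exp (10/3 :: real) ^ Suc 2 \<le> 40 ^ Suc 2" .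
  qed simp
  moreover have "exp (8 * \<alpha>) = 1296 / exp (10/3)"
  proof -
    have "8 * \<alpha> = real 4 * ln 6 - 10/3" by (simp add: \<alpha>_def)
    then have "exp (8 * \<alpha>) = exp (ln 6) ^ 4 / exp (10/3)" by (simp only: exp_diff exp_of_nat_mult)
    then show ?thesis by simp
  qed
  ultimately have e8: "1296 / 40 \<le> exp (8 * \<alpha>)" by (simp only:) (intro divide_left_mono, simp_all)
  then have C: "9 * (5/4) ^ 5 \<le> exp (8 * \<alpha>)" by (rule order_trans[rotated]) (simp add: power_divide)
  have "exp (1::real) \<le> exp (8 * \<alpha>)" using exp_le e8 by linarith
  then have \<alpha>: "\<alpha> \<ge> 1/8" by simp
  have "(9 * (5/4) ^ 5) ^ d * (exp (5/12) / sqrt 6) ^ N \<le> exp (8 * \<alpha>) ^ d * exp (- \<alpha>) ^ N"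
    unfolding q by (intro mult_right_mono power_mono C) auto
  also have "\<dots> = exp (real d * (8 * \<alpha>) + real N * (- \<alpha>))" by (simp only: exp_add exp_of_nat_mult)
  also have "\<dots> \<le> exp (- 2 * L)"
  proof -
    have "\<alpha> * (8 * real d + 28 * L) \<le> \<alpha> * real N" using N \<alpha> by (intro mult_left_mono) auto
    moreover have "1/8 * L \<le> \<alpha> * L" using \<alpha> L by (intro mult_right_mono)
    ultimately show ?thesis using L by (simp add: algebra_simps)
  qed
  finally show ?thesis .
qed

text \<open>From ln 2 \<le> 25/36 the rate is at least 11/72, and 28 * 11/72 > 2.\<close>

lemma frobenius_exponent_bound:
  assumes L: "L \<ge> 0" and n: "real n \<ge> 28 * L"
  shows "(sqrt 2 / exp (1/2)) ^ n \<le> exp (- 2 * L)"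
proof -
  have q: "sqrt 2 / exp (1/2) = exp ((ln 2 - 1) / 2 :: real)"
    by (simp add: diff_divide_distrib exp_diff flip: powr_half_sqrt) (simp add: powr_def)
  have "(sqrt 2 / exp (1/2)) ^ n = exp (real n * ((ln 2 - 1) / 2))"
    unfolding q by (rule exp_of_nat_mult[symmetric])
  also have "\<dots> \<le> exp (- 2 * L)"
  proof -
    have "real n * ((ln 2 - 1) / 2) \<le> real n * (- 11/72)"
      using ln2_le_25_over_36 by (intro mult_left_mono) auto
    then show ?thesis using n L by simp
  qed
  finally show ?thesis .
qed

text \<open>In units of \<sigma>^2: at a rounded unit vector the form is at least N/6 * 9/16 = 3 N /
  32. The squared Frobenius norm is at most 2 N d, so rounding costs at most h^2 / 4 * 2 N d = N /
  32. The difference is N / 16. The Frobenius event \<open>E1\<close> and the net event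
  \<open>E2\<close> each have probability at most exp (- 2 L).\<close>

lemma (in prob_space) gaussian_smallest_singular_value:
  fixes Z :: "'i \<times> nat \<Rightarrow> 'a \<Rightarrow> real"
  assumes I: "finite I" "card I = N" and d: "d \<ge> 1" and \<sigma>: "\<sigma> > 0"
    and ind: "indep_vars (\<lambda>_. borel) Z (I \<times> {..<d})"
    and law: "\<And>p. p \<in> I \<times> {..<d} \<Longrightarrow> distr M borel (Z p) = centered_normal \<sigma>"
    and L: "L \<ge> 0" and N: "real N \<ge> 8 * real d + 28 * L"
  shows "\<exists>E\<in>events. prob E \<le> 2 * exp (- 2 * L) \<and> (\<forall>\<omega>\<in>space M - E. \<forall>v.
    real N / 16 * \<sigma>\<^sup>2 * (\<Sum>b<d. (v b)\<^sup>2) \<le> (\<Sum>i\<in>I. (\<Sum>b<d. v b * Z (i, b) \<omega>)\<^sup>2))"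
proof -
  have rv: "Z p \<in> borel_measurable M" if "p \<in> I \<times> {..<d}" for p
    using ind that by (auto simp: indep_vars_def)
  have N0: "real N > 0" using N L d by linarith
  define Q where "Q k \<omega> = (\<Sum>i\<in>I. (\<Sum>b<d. of_int (k b) * Z (i, b) \<omega>)\<^sup>2)" for k :: "nat \<Rightarrow> int" and \<omega>
  define nk where "nk k = (\<Sum>b<d. (real_of_int (k b))\<^sup>2)" for k :: "nat \<Rightarrow> int"
  \<comment> \<open>The rounded point depends on the outcome \<open>\<omega>\<close>, but always
    lies in this fixed finite set, so a union bound applies.\<close>
  define K where "K = {k \<in> lattice_net d. 9 * real d \<le> nk k}"
  have K: "finite K" "K \<subseteq> lattice_net d" by (auto simp: K_def)
  define bad where "bad k = {\<omega> \<in> space M. Q k \<omega> < real N / 6 * (\<sigma> * sqrt (nk k))\<^sup>2}" for k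
  define E1 where "E1 = {\<omega> \<in> space M. 2 * real (card (I \<times> {..<d})) * \<sigma>\<^sup>2 < (\<Sum>p\<in>I \<times> {..<d}. (Z p \<omega>)\<^sup>2)}"
  define E2 where "E2 = (\<Union>k\<in>K. bad k)"
  have Qm: "Q k \<in> borel_measurable M" for k
    unfolding Q_def by (intro borel_measurable_sum borel_measurable_power borel_measurable_times borel_measurable_const rv) auto
  have bad: "bad k \<in> events" for k unfolding bad_def using Qm by measurable
  have bad_prob: "prob (bad k) \<le> (exp (5/12) / sqrt 6) ^ N" if k: "k \<in> K" for k
  proof -
    have nk: "nk k > 0" using k d by (simp add: K_def)
    have "distr M borel (\<lambda>\<omega>. \<Sum>b<d. of_int (k b) * Z (i, b) \<omega>) = centered_normal (\<sigma> * sqrt (nk k))" if i: "i \<in> I" for i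
      unfolding nk_def
    proof (rule indep_normal_linear_combination)
      have inj: "inj_on (Pair i) {..<d}" by (auto simp: inj_on_def)
      have "indep_vars (\<lambda>_. borel) Z (Pair i ` {..<d})"
        using i by (intro indep_vars_subset[OF ind]) auto
      then show "indep_vars (\<lambda>_. borel) (\<lambda>b. Z (i, b)) {..<d}"
        using indep_vars_reindex[OF _ inj] by simp
      show "0 < (\<Sum>b<d. (real_of_int (k b))\<^sup>2)" using nk by (simp add: nk_def)
    qed (use i law \<sigma> in auto)
    from chi_square_lower_tail[OF I(1) indep_vars_row_combination[OF ind] this] \<sigma> nk
    show ?thesis by (simp add: bad_def Q_def I(2))
  qed
  have E1: "E1 \<in> events"
  proof -
    have [measurable]: "(\<lambda>\<omega>. \<Sum>p\<in>I \<times> {..<d}. (Z p \<omega>)\<^sup>2) \<in> borel_measurable M"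
      by (intro borel_measurable_sum borel_measurable_power rv)
    show ?thesis unfolding E1_def by measurable
  qed
  have E2: "E2 \<in> events" unfolding E2_def using bad K by (intro sets.finite_UN) auto
  have "real d \<ge> 1" using d by simp
  then have "real N * 1 \<le> real N * real d" by (intro mult_left_mono) auto
  then have Nd: "real (card (I \<times> {..<d})) \<ge> 28 * L" using N I(2) d by (simp add: card_cartesian_product)
  have pE1: "prob E1 \<le> exp (- 2 * L)"
    unfolding E1_def using I(1) law \<sigma>
    by (intro order_trans[OF chi_square_upper_tail[OF _ ind] frobenius_exponent_bound[OF L Nd]]) auto
  have "prob E2 \<le> (\<Sum>k\<in>K. prob (bad k))"
    unfolding E2_def using bad K by (intro finite_measure_subadditive_finite) auto
  also have "\<dots> \<le> (\<Sum>k\<in>K. (exp (5/12) / sqrt 6) ^ N)" by (intro sum_mono bad_prob)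
  also have "\<dots> = real (card K) * (exp (5/12) / sqrt 6) ^ N" by simp
  also have "\<dots> \<le> (9 * (5/4) ^ 5) ^ d * (exp (5/12) / sqrt 6) ^ N"
    using card_mono[OF finite_lattice_net K(2)]
    by (intro mult_right_mono order_trans[OF _ card_lattice_net]) auto
  also have "\<dots> \<le> exp (- 2 * L)" by (rule net_exponent_bound[OF L N])
  finally have pE2: "prob E2 \<le> exp (- 2 * L)" .
  show ?thesis
  proof (rule bexI[of _ "E1 \<union> E2"], rule conjI)
    show "E1 \<union> E2 \<in> events" using E1 E2 by auto
    show "prob (E1 \<union> E2) \<le> 2 * exp (- 2 * L)"
      using measure_subadditive[OF E1 E2] pE1 pE2 by simp
    show "\<forall>\<omega>\<in>space M - (E1 \<union> E2). \<forall>v.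
      real N / 16 * \<sigma>\<^sup>2 * (\<Sum>b<d. (v b)\<^sup>2) \<le> (\<Sum>i\<in>I. (\<Sum>b<d. v b * Z (i, b) \<omega>)\<^sup>2)"
    proof (intro ballI allI)
      fix \<omega> v assume \<omega>: "\<omega> \<in> space M - (E1 \<union> E2)"
      show "real N / 16 * \<sigma>\<^sup>2 * (\<Sum>b<d. (v b)\<^sup>2) \<le> (\<Sum>i\<in>I. (\<Sum>b<d. v b * Z (i, b) \<omega>)\<^sup>2)"
      proof (cases "L2_set v {..<d} = 0")
        case True
        then have "(\<Sum>b<d. (v b)\<^sup>2) = 0" by (simp add: L2_set_def)
        then show ?thesis by (simp add: sum_nonneg)
      next
        case False
        define n where "n = L2_set v {..<d}"
        have n: "n > 0" using False by (simp add: n_def order_less_le)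
        define z where "z b = v b / n" for b
        have z1: "L2_set z {..<d} = 1"
          unfolding z_def using n L2_set_right_distrib[of "1 / n" v "{..<d}"] by (simp add: n_def[symmetric])
        define h where h: "h = 1 / (4 * sqrt (real d))"
        have h0: "h > 0" and h2: "h\<^sup>2 = 1 / (16 * real d)"
          using d by (simp_all add: h power_divide power_mult_distrib)
        obtain k where k: "\<And>j. \<bar>h * of_int (k j) - z j\<bar> \<le> h"
          "(\<Sum>i\<in>I. (0 + (\<Sum>b<d. Z (i, b) \<omega> * (h * of_int (k b))))\<^sup>2)
            \<le> (\<Sum>i\<in>I. (0 + (\<Sum>b<d. Z (i, b) \<omega> * z b))\<^sup>2) + h\<^sup>2 / 4 * (\<Sum>i\<in>I. \<Sum>b<d. (Z (i, b) \<omega>)\<^sup>2)"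
          using quadratic_rounding[OF h0, where v = z and I = I and d = d and c = "\<lambda>_. 0" and X = "\<lambda>i b. Z (i, b) \<omega>"]
          by blast
        let ?k = "restrict k {..<d}"
        have nk: "nk ?k = (\<Sum>b<d. (real_of_int (k b))\<^sup>2)" by (simp add: nk_def)
        have kK: "?k \<in> K" and nk9: "9 * real d \<le> nk ?k"
          using rounded_in_net[OF d h k(1) z1] by (auto simp: K_def nk)
        have "\<omega> \<notin> bad ?k" using \<omega> kK by (auto simp: E2_def)
        then have "real N / 6 * (\<sigma> * sqrt (nk ?k))\<^sup>2 \<le> Q ?k \<omega>" using \<omega> by (simp add: bad_def not_less)
        moreover have "real N / 6 * \<sigma>\<^sup>2 * (9 * real d) \<le> real N / 6 * (\<sigma> * sqrt (nk ?k))\<^sup>2"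
        proof -
          have "(\<sigma> * sqrt (nk ?k))\<^sup>2 = \<sigma>\<^sup>2 * nk ?k" using nk9 by (simp add: power_mult_distrib)
          moreover have "real N / 6 * \<sigma>\<^sup>2 * (9 * real d) \<le> real N / 6 * \<sigma>\<^sup>2 * nk ?k"
            by (intro mult_left_mono nk9) simp
          ultimately show ?thesis by (simp only: mult.assoc)
        qed
        ultimately have Q: "real N / 6 * \<sigma>\<^sup>2 * (9 * real d) \<le> Q ?k \<omega>" by linarith
        have "h\<^sup>2 * Q ?k \<omega> = (\<Sum>i\<in>I. (0 + (\<Sum>b<d. Z (i, b) \<omega> * (h * of_int (k b))))\<^sup>2)"
          unfolding Q_def by (simp add: sum_distrib_left power_mult_distrib[symmetric] mult_ac)
        also note k(2)
        also have "h\<^sup>2 / 4 * (\<Sum>i\<in>I. \<Sum>b<d. (Z (i, b) \<omega>)\<^sup>2) \<le> h\<^sup>2 / 4 * (2 * (real N * real d) * \<sigma>\<^sup>2)"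
        proof (intro mult_left_mono)
          have "\<omega> \<notin> E1" "\<omega> \<in> space M" using \<omega> by auto
          then have "(\<Sum>p\<in>I \<times> {..<d}. (Z p \<omega>)\<^sup>2) \<le> 2 * real (card (I \<times> {..<d})) * \<sigma>\<^sup>2"
            by (simp add: E1_def not_less)
          then show "(\<Sum>i\<in>I. \<Sum>b<d. (Z (i, b) \<omega>)\<^sup>2) \<le> 2 * (real N * real d) * \<sigma>\<^sup>2"
            by (simp add: sum.cartesian_product card_cartesian_product I(2))
        qed simp
        finally have "h\<^sup>2 * Q ?k \<omega> \<le> (\<Sum>i\<in>I. (\<Sum>b<d. Z (i, b) \<omega> * z b)\<^sup>2) + h\<^sup>2 / 4 * (2 * (real N * real d) * \<sigma>\<^sup>2)"
          by simp
        also have "h\<^sup>2 / 4 * (2 * (real N * real d) * \<sigma>\<^sup>2) = 1/32 * (real N * \<sigma>\<^sup>2)"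
          unfolding h2 using d by simp
        finally have up: "h\<^sup>2 * Q ?k \<omega> \<le> (\<Sum>i\<in>I. (\<Sum>b<d. Z (i, b) \<omega> * z b)\<^sup>2) + 1/32 * (real N * \<sigma>\<^sup>2)" .
        have "3/32 * (real N * \<sigma>\<^sup>2) = h\<^sup>2 * (real N / 6 * \<sigma>\<^sup>2 * (9 * real d))"
          unfolding h2 using d by simp
        also have "\<dots> \<le> h\<^sup>2 * Q ?k \<omega>" by (intro mult_left_mono Q) simp
        finally have "1/16 * (real N * \<sigma>\<^sup>2) \<le> (\<Sum>i\<in>I. (\<Sum>b<d. Z (i, b) \<omega> * z b)\<^sup>2)"
          using up by linarith
        then have "n\<^sup>2 * (1/16 * (real N * \<sigma>\<^sup>2)) \<le> n\<^sup>2 * (\<Sum>i\<in>I. (\<Sum>b<d. Z (i, b) \<omega> * z b)\<^sup>2)"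
          by (intro mult_left_mono) auto
        also have "\<dots> = (\<Sum>i\<in>I. (\<Sum>b<d. v b * Z (i, b) \<omega>)\<^sup>2)"
        proof -
          have "n * (\<Sum>b<d. Z (i, b) \<omega> * z b) = (\<Sum>b<d. v b * Z (i, b) \<omega>)" for i
            using n by (simp add: z_def sum_distrib_left mult_ac)
          then show ?thesis by (simp add: sum_distrib_left flip: power_mult_distrib)
        qed
        also have "n\<^sup>2 = (\<Sum>b<d. (v b)\<^sup>2)" by (simp add: n_def L2_set_power2)
        finally show ?thesis by (simp add: mult_ac)
      qed
    qed
  qed
qed

section \<open>Spectral norm and pseudo-inverse\<close>


definition vnorm :: "real vec \<Rightarrow> real" where
  "vnorm v = sqrt (v \<bullet> v)"

lemma vnorm_L2_set: "v \<in> carrier_vec n \<Longrightarrow> vnorm v = L2_set (\<lambda>i. v $ i) {..<n}"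
  by (auto simp: vnorm_def L2_set_def scalar_prod_def power2_eq_square atLeast0LessThan)

lemma scalar_prod_self_nonneg [simp]: "0 \<le> v \<bullet> (v :: real vec)"
  by (simp add: scalar_prod_def sum_nonneg)

lemma vnorm_nonneg [simp]: "0 \<le> vnorm v"
  by (simp add: vnorm_def)

lemma vnorm_power2: "(vnorm v)\<^sup>2 = v \<bullet> v"
  by (simp add: vnorm_def)

lemma scalar_prod_self_eq_0:
  assumes "v \<in> carrier_vec n" "v \<bullet> v = (0::real)"
  shows "v = 0\<^sub>v n"
proof -
  have "L2_set (\<lambda>i. v $ i) {..<n} = 0"
    using vnorm_L2_set[OF assms(1)] assms(2) by (simp add: vnorm_def)
  then show ?thesis using assms(1) by (intro eq_vecI) (auto simp: L2_set_eq_0_iff)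
qed

lemma vnorm_zero [simp]: "vnorm (0\<^sub>v n) = 0"
  by (simp add: vnorm_def)

lemma scalar_prod_le_vnorm:
  assumes "v \<in> carrier_vec n" "w \<in> carrier_vec n"
  shows "\<bar>v \<bullet> w\<bar> \<le> vnorm v * vnorm w"
proof -
  have "\<bar>v \<bullet> w\<bar> \<le> (\<Sum>i<n. \<bar>v $ i\<bar> * \<bar>w $ i\<bar>)"
    using assms by (auto simp: scalar_prod_def atLeast0LessThan abs_mult intro!: order_trans[OF sum_abs])
  also have "\<dots> \<le> L2_set (\<lambda>i. v $ i) {..<n} * L2_set (\<lambda>i. w $ i) {..<n}"
    by (rule L2_set_mult_ineq)
  finally show ?thesis using assms by (simp add: vnorm_L2_set)
qed

lemma vnorm_smult: "vnorm (a \<cdot>\<^sub>v v) = \<bar>a\<bar> * vnorm v"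
proof -
  have "(a \<cdot>\<^sub>v v) \<bullet> (a \<cdot>\<^sub>v v) = a\<^sup>2 * (v \<bullet> v)"
    by (simp add: scalar_prod_def sum_distrib_left power2_eq_square mult_ac)
  then show ?thesis by (simp add: vnorm_def real_sqrt_mult)
qed

lemma vnorm_triangle:
  assumes "v \<in> carrier_vec n" "w \<in> carrier_vec n"
  shows "vnorm (v + w) \<le> vnorm v + vnorm w"
proof -
  have "L2_set (\<lambda>i. (v + w) $ i) {..<n} = L2_set (\<lambda>i. v $ i + w $ i) {..<n}"
    using assms by (intro L2_set_cong) auto
  then show ?thesis
    using assms L2_set_triangle_ineq[of "\<lambda>i. v $ i" "\<lambda>i. w $ i" "{..<n}"]
    by (simp add: vnorm_L2_set[where n = n])
qed

text \<open>A crude bound by the Frobenius norm, from Cauchy-Schwarz in each row. It makes the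
  Rayleigh quotient and the adjugate bounded before the spectral norm is known to be an operator
  norm.\<close>

lemma mat_vec_bounded:
  assumes A: "A \<in> carrier_mat nr nc"
  shows "\<exists>F\<ge>0. \<forall>v\<in>carrier_vec nc. vnorm (A *\<^sub>v v) \<le> F * vnorm v"
proof (intro exI conjI ballI)
  show "L2_set (\<lambda>i. vnorm (row A i)) {..<nr} \<ge> 0" by simp
  fix v :: "real vec" assume v: "v \<in> carrier_vec nc"
  have Av: "A *\<^sub>v v \<in> carrier_vec nr" using A v by simp
  have "\<bar>(A *\<^sub>v v) $ i\<bar> \<le> vnorm (row A i) * vnorm v" if "i < nr" for i
    using that A v scalar_prod_le_vnorm[of "row A i" nc v] by auto
  then have "(\<Sum>i<nr. ((A *\<^sub>v v) $ i)\<^sup>2) \<le> (\<Sum>i<nr. (vnorm (row A i) * vnorm v)\<^sup>2)"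
    by (intro sum_mono) (simp add: abs_le_square_iff[symmetric] abs_mult)
  then have "L2_set (\<lambda>i. (A *\<^sub>v v) $ i) {..<nr} \<le> L2_set (\<lambda>i. vnorm (row A i) * vnorm v) {..<nr}"
    unfolding L2_set_def by (rule real_sqrt_le_mono)
  then show "vnorm (A *\<^sub>v v) \<le> L2_set (\<lambda>i. vnorm (row A i)) {..<nr} * vnorm v"
    by (simp add: vnorm_L2_set[OF Av] L2_set_left_distrib)
qed

lemma scalar_prod_gram:
  assumes A: "(A :: real mat) \<in> carrier_mat nr nc" and v: "v \<in> carrier_vec nc" and w: "w \<in> carrier_vec nc"
  shows "((transpose_mat A * A) *\<^sub>v v) \<bullet> w = (A *\<^sub>v v) \<bullet> (A *\<^sub>v w)"
proof -
  have "(transpose_mat A * A) *\<^sub>v v = transpose_mat A *\<^sub>v (A *\<^sub>v v)"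
    using A v by (intro assoc_mult_mat_vec) auto
  then show ?thesis using transpose_vec_mult_scalar[OF A w, of "A *\<^sub>v v"] A v by simp
qed

text \<open>If the supremum \<open>l\<close> of the Rayleigh quotient were not an eigenvalue, \<open>S - l I\<close> would be invertible, and a step
  from any unit vector \<open>v\<close> in the direction \<open>(S - l I) v\<close> would keep the quotient of \<open>v\<close> away from \<open>l\<close>.\<close>
lemma gram_top_eigenvalue:
  fixes A :: "real mat"
  assumes A: "A \<in> carrier_mat nr nc" and nc: "nc > 0"
  shows "\<exists>l\<ge>0. eigenvalue (transpose_mat A * A) l \<and>
    (\<forall>v\<in>carrier_vec nc. (A *\<^sub>v v) \<bullet> (A *\<^sub>v v) \<le> l * (v \<bullet> v))"
proof -
  let ?S = "transpose_mat A * A"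
  have S: "?S \<in> carrier_mat nc nc" using A by auto
  have Ac: "A *\<^sub>v v \<in> carrier_vec nr" if "v \<in> carrier_vec nc" for v using A that by simp
  define R where "R = {(A *\<^sub>v v) \<bullet> (A *\<^sub>v v) | v. v \<in> carrier_vec nc \<and> v \<bullet> v = 1}"
  have ne: "(A *\<^sub>v unit_vec nc 0) \<bullet> (A *\<^sub>v unit_vec nc 0) \<in> R"
    using nc unfolding R_def by (auto intro!: exI[of _ "unit_vec nc 0"])
  obtain F where F: "F \<ge> 0" "\<And>v. v \<in> carrier_vec nc \<Longrightarrow> vnorm (A *\<^sub>v v) \<le> F * vnorm v"
    using mat_vec_bounded[OF A] by blast
  have bdd: "bdd_above R"
  proof (rule bdd_aboveI)
    fix x assume "x \<in> R"
    then obtain v where v: "v \<in> carrier_vec nc" "v \<bullet> v = 1" "x = (A *\<^sub>v v) \<bullet> (A *\<^sub>v v)" by (auto simp: R_def)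
    have "vnorm (A *\<^sub>v v) \<le> F" using F(2)[OF v(1)] v(2) by (simp add: vnorm_def)
    then have "(vnorm (A *\<^sub>v v))\<^sup>2 \<le> F\<^sup>2" by (intro power_mono) auto
    then show "x \<le> F\<^sup>2" by (simp add: vnorm_power2 v(3))
  qed
  define l where "l = Sup R"
  have l0: "l \<ge> 0"
    unfolding l_def by (rule order_trans[OF scalar_prod_self_nonneg cSup_upper[OF ne bdd]])
  have le: "(A *\<^sub>v v) \<bullet> (A *\<^sub>v v) \<le> l * (v \<bullet> v)" if v: "v \<in> carrier_vec nc" for v
  proof (cases "v \<bullet> v = 0")
    case True
    then have "v = 0\<^sub>v nc" using v by (rule_tac scalar_prod_self_eq_0)
    moreover have "A *\<^sub>v 0\<^sub>v nc = 0\<^sub>v nr" using A by (intro eq_vecI) auto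
    ultimately show ?thesis by simp
  next
    case False
    then have pos: "v \<bullet> v > 0" using scalar_prod_self_nonneg[of v] by linarith
    define w where "w = (1 / vnorm v) \<cdot>\<^sub>v v"
    have w: "w \<in> carrier_vec nc" using v by (simp add: w_def)
    have "vnorm w = 1" using pos by (simp add: w_def vnorm_smult) (simp add: vnorm_def)
    then have w1: "w \<bullet> w = 1" by (simp add: vnorm_def)
    have "(A *\<^sub>v w) \<bullet> (A *\<^sub>v w) \<le> l"
      unfolding l_def using w w1 by (intro cSup_upper bdd) (auto simp: R_def)
    also have "A *\<^sub>v w = (1 / vnorm v) \<cdot>\<^sub>v (A *\<^sub>v v)"
      unfolding w_def by (rule mult_mat_vec[OF A v])
    finally have "(vnorm ((1 / vnorm v) \<cdot>\<^sub>v (A *\<^sub>v v)))\<^sup>2 \<le> l" by (simp only: vnorm_power2)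
    then have "(1 / vnorm v)\<^sup>2 * ((A *\<^sub>v v) \<bullet> (A *\<^sub>v v)) \<le> l"
      by (simp only: vnorm_smult power_mult_distrib vnorm_power2 power2_abs)
    then show ?thesis using pos by (simp add: power_divide vnorm_power2 field_simps)
  qed
  have "eigenvalue ?S l"
  proof (rule ccontr)
    assume "\<not> eigenvalue ?S l"
    define Q where "Q = char_matrix ?S l"
    have Q: "Q \<in> carrier_mat nc nc" using S by (simp add: Q_def)
    have det: "det Q \<noteq> 0" using \<open>\<not> eigenvalue ?S l\<close> eigenvalue_det[OF S] by (simp add: Q_def)
    have Qv: "Q *\<^sub>v v = ?S *\<^sub>v v + (- l) \<cdot>\<^sub>v v" if v: "v \<in> carrier_vec nc" for v
    proof -
      have "Q *\<^sub>v v = ?S *\<^sub>v v + ((- l) \<cdot>\<^sub>m 1\<^sub>m nc) *\<^sub>v v"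
        unfolding Q_def char_matrix_def using S v A by (subst add_mult_distrib_mat_vec[of _ nc nc]) auto
      also have "((- l) \<cdot>\<^sub>m 1\<^sub>m nc) *\<^sub>v v = (- l) \<cdot>\<^sub>v v"
        using v by (intro eq_vecI) auto
      finally show ?thesis .
    qed
    obtain F' where F': "F' \<ge> 0" "\<And>v. v \<in> carrier_vec nc \<Longrightarrow> vnorm (adj_mat Q *\<^sub>v v) \<le> F' * vnorm v"
      using mat_vec_bounded[OF adj_mat(1)[OF Q]] by blast
    define c where "c = \<bar>det Q\<bar> / (F' + 1)"
    have c: "c > 0" using det F'(1) by (simp add: c_def)
    have low: "c * vnorm v \<le> vnorm (Q *\<^sub>v v)" if v: "v \<in> carrier_vec nc" for v
    proof -
      have "adj_mat Q *\<^sub>v (Q *\<^sub>v v) = (adj_mat Q * Q) *\<^sub>v v"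
        using assoc_mult_mat_vec[OF adj_mat(1)[OF Q] Q v] by simp
      also have "\<dots> = det Q \<cdot>\<^sub>v v" unfolding adj_mat(3)[OF Q] using v by (intro eq_vecI) auto
      finally have "\<bar>det Q\<bar> * vnorm v = vnorm (adj_mat Q *\<^sub>v (Q *\<^sub>v v))" by (simp add: vnorm_smult)
      also have "\<dots> \<le> F' * vnorm (Q *\<^sub>v v)" using Q v by (intro F') auto
      also have "\<dots> \<le> (F' + 1) * vnorm (Q *\<^sub>v v)" by (intro mult_right_mono) auto
      finally show ?thesis using F'(1) by (simp add: c_def field_simps)
    qed
    \<comment> \<open>The step v + t w raises the form minus \<open>l\<close> times the squared norm
      by at least 2 t |w|^2 - t^2 l |w|^2. The choice t^2 l \<le> t sacrifices at most half of the
      first-order gain.\<close>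
    define t where "t = 1 / (l + 1)"
    have t: "t > 0" "t\<^sup>2 * l \<le> t"
    proof -
      show "t > 0" using l0 by (simp add: t_def)
      moreover have "t * l \<le> 1" using l0 by (simp add: t_def)
      ultimately show "t\<^sup>2 * l \<le> t" by (simp add: power2_eq_square mult.assoc mult_left_le)
    qed
    have gap: "(A *\<^sub>v v) \<bullet> (A *\<^sub>v v) \<le> l - t * c\<^sup>2" if v: "v \<in> carrier_vec nc" and v1: "v \<bullet> v = 1" for v
    proof -
      define w where "w = Q *\<^sub>v v"
      have w: "w \<in> carrier_vec nc" using Q v by (simp add: w_def)
      have ww: "w \<bullet> w = (A *\<^sub>v v) \<bullet> (A *\<^sub>v w) - l * (v \<bullet> w)"
      proof -
        have "w \<bullet> w = (?S *\<^sub>v v + (- l) \<cdot>\<^sub>v v) \<bullet> w" unfolding w_def[symmetric] Qv[OF v, symmetric] by (simp add: w_def)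
        also have "\<dots> = (?S *\<^sub>v v) \<bullet> w + ((- l) \<cdot>\<^sub>v v) \<bullet> w"
          using S v w by (intro add_scalar_prod_distrib[of _ nc]) auto
        finally show ?thesis using v w by (simp add: scalar_prod_gram[OF A v w])
      qed
      define x where "x = v + t \<cdot>\<^sub>v w"
      have x: "x \<in> carrier_vec nc" using v w by (simp add: x_def)
      have expand: "(p + t \<cdot>\<^sub>v r) \<bullet> (p + t \<cdot>\<^sub>v r) = p \<bullet> p + 2 * t * (p \<bullet> r) + t\<^sup>2 * (r \<bullet> r)"
        if p: "p \<in> carrier_vec k" and r: "r \<in> carrier_vec k" for p r :: "real vec" and k
      proof -
        have "(p + t \<cdot>\<^sub>v r) \<bullet> (p + t \<cdot>\<^sub>v r) = (\<Sum>i\<in>{0..<k}. (p $ i + t * r $ i) * (p $ i + t * r $ i))"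
          using p r by (simp add: scalar_prod_def)
        also have "\<dots> = (\<Sum>i\<in>{0..<k}. p $ i * p $ i + 2 * t * (p $ i * r $ i) + t\<^sup>2 * (r $ i * r $ i))"
          by (intro sum.cong refl) (simp add: algebra_simps power2_eq_square)
        also have "\<dots> = p \<bullet> p + 2 * t * (p \<bullet> r) + t\<^sup>2 * (r \<bullet> r)"
          using p r by (simp add: scalar_prod_def sum.distrib sum_distrib_left)
        finally show ?thesis .
      qed
      have Ax: "A *\<^sub>v x = A *\<^sub>v v + t \<cdot>\<^sub>v (A *\<^sub>v w)"
        unfolding x_def using v w A by (simp add: mult_add_distrib_mat_vec[OF A] mult_mat_vec[OF A])
      have e1: "(A *\<^sub>v x) \<bullet> (A *\<^sub>v x) = (A *\<^sub>v v) \<bullet> (A *\<^sub>v v) + 2 * t * ((A *\<^sub>v v) \<bullet> (A *\<^sub>v w)) + t\<^sup>2 * ((A *\<^sub>v w) \<bullet> (A *\<^sub>v w))"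
        unfolding Ax by (rule expand[OF Ac[OF v] Ac[OF w]])
      have e2: "x \<bullet> x = 1 + 2 * t * (v \<bullet> w) + t\<^sup>2 * (w \<bullet> w)"
        unfolding x_def using expand[OF v w] v1 by simp
      have "(A *\<^sub>v x) \<bullet> (A *\<^sub>v x) \<le> l * (x \<bullet> x)" by (rule le[OF x])
      then have "(A *\<^sub>v v) \<bullet> (A *\<^sub>v v) + 2 * t * (w \<bullet> w) + t\<^sup>2 * ((A *\<^sub>v w) \<bullet> (A *\<^sub>v w)) \<le> l + (t\<^sup>2 * l) * (w \<bullet> w)"
        unfolding e1 e2 ww by (simp add: algebra_simps)
      moreover have "(t\<^sup>2 * l) * (w \<bullet> w) \<le> t * (w \<bullet> w)" by (intro mult_right_mono t) simp
      moreover have "0 \<le> t\<^sup>2 * ((A *\<^sub>v w) \<bullet> (A *\<^sub>v w))" by simp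
      moreover have "t * c\<^sup>2 \<le> t * (w \<bullet> w)"
      proof -
        have "c \<le> vnorm w" using low[OF v] v1 by (simp add: w_def vnorm_def)
        then have "c\<^sup>2 \<le> (vnorm w)\<^sup>2" using c by (intro power_mono) auto
        then show ?thesis using t by (simp add: vnorm_power2)
      qed
      ultimately show ?thesis by linarith
    qed
    have "Sup R \<le> l - t * c\<^sup>2"
      using ne gap by (intro cSup_least) (auto simp: R_def)
    moreover have "t * c\<^sup>2 > 0" using t c by simp
    ultimately show False by (simp add: l_def)
  qed
  then show ?thesis using l0 le by blast
qed

text \<open>The maximum defining \<open>spectral_norm\<close> is over a finite nonempty set: squares
  of singular values are roots of a nonzero characteristic polynomial, and the top Gram eigenvalue
  provides an element. Hence it is the operator norm, attained at an eigenvector.\<close>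

lemma spectral_norm_cases:
  assumes A: "A \<in> carrier_mat nr nc" and nc: "nc > 0"
  shows "\<exists>v\<in>carrier_vec nc. v \<noteq> 0\<^sub>v nc \<and> vnorm (A *\<^sub>v v) = spectral_norm A * vnorm v"
    and "spectral_norm A \<ge> 0"
    and "\<And>u. u \<in> carrier_vec nc \<Longrightarrow> vnorm (A *\<^sub>v u) \<le> spectral_norm A * vnorm u"
proof -
  let ?S = "transpose_mat A * A"
  have S: "?S \<in> carrier_mat nc nc" using A by auto
  obtain l where l: "l \<ge> 0" "eigenvalue ?S l"
    "\<And>v. v \<in> carrier_vec nc \<Longrightarrow> (A *\<^sub>v v) \<bullet> (A *\<^sub>v v) \<le> l * (v \<bullet> v)"
    using gram_top_eigenvalue[OF A nc] by blast
  have ev: "\<exists>v\<in>carrier_vec nc. v \<noteq> 0\<^sub>v nc \<and> (A *\<^sub>v v) \<bullet> (A *\<^sub>v v) = e * (v \<bullet> v)" if "eigenvalue ?S e" for e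
  proof -
    from that obtain v where v: "v \<in> carrier_vec nc" "v \<noteq> 0\<^sub>v nc" "?S *\<^sub>v v = e \<cdot>\<^sub>v v"
      using S by (auto simp: eigenvalue_def eigenvector_def)
    have "(A *\<^sub>v v) \<bullet> (A *\<^sub>v v) = e * (v \<bullet> v)"
      using scalar_prod_gram[OF A v(1) v(1)] v by simp
    with v show ?thesis by blast
  qed
  have "singular_values A \<subseteq> sqrt ` {e. poly (char_poly ?S) e = 0}"
  proof
    fix s assume "s \<in> singular_values A"
    then have "0 \<le> s" "poly (char_poly ?S) (s\<^sup>2) = 0"
      using eigenvalue_root_char_poly[OF S] by (auto simp: singular_values_def)
    then show "s \<in> sqrt ` {e. poly (char_poly ?S) e = 0}" by (intro image_eqI[of _ _ "s\<^sup>2"]) auto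
  qed
  moreover have "char_poly ?S \<noteq> 0" using degree_monic_char_poly[OF S] by auto
  ultimately have fin: "finite (singular_values A)" by (rule_tac finite_subset) (auto intro: poly_roots_finite)
  have max: "spectral_norm A = sqrt l"
    unfolding spectral_norm_def
  proof (rule Max_eqI[OF fin])
    show "sqrt l \<in> singular_values A" using l by (simp add: singular_values_def)
    fix s assume "s \<in> singular_values A"
    then have s: "s \<ge> 0" "eigenvalue ?S (s\<^sup>2)" by (auto simp: singular_values_def)
    obtain v where v: "v \<in> carrier_vec nc" "v \<noteq> 0\<^sub>v nc" "(A *\<^sub>v v) \<bullet> (A *\<^sub>v v) = s\<^sup>2 * (v \<bullet> v)"
      using ev[OF s(2)] by blast
    have "v \<bullet> v \<noteq> 0" using v scalar_prod_self_eq_0 by blast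
    then have "v \<bullet> v > 0" using scalar_prod_self_nonneg[of v] by linarith
    then have "s\<^sup>2 \<le> l" using l(3)[OF v(1)] v(3) by simp
    then show "s \<le> sqrt l" by (rule real_le_rsqrt)
  qed
  show "spectral_norm A \<ge> 0" using l by (simp add: max)
  obtain v where v: "v \<in> carrier_vec nc" "v \<noteq> 0\<^sub>v nc" "(A *\<^sub>v v) \<bullet> (A *\<^sub>v v) = l * (v \<bullet> v)"
    using ev[OF l(2)] by blast
  then have "vnorm (A *\<^sub>v v) = spectral_norm A * vnorm v"
    by (simp add: vnorm_def max real_sqrt_mult)
  with v show "\<exists>v\<in>carrier_vec nc. v \<noteq> 0\<^sub>v nc \<and> vnorm (A *\<^sub>v v) = spectral_norm A * vnorm v" by blast
  show "vnorm (A *\<^sub>v u) \<le> spectral_norm A * vnorm u" if "u \<in> carrier_vec nc" for u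
    using l(3)[OF that] by (simp add: vnorm_def max flip: real_sqrt_mult)
qed

text \<open>This form is free of eigenvalues. It serves twice, for the error estimate and for
  measurability.\<close>

lemma spectral_norm_le_iff:
  assumes A: "A \<in> carrier_mat nr nc" and nc: "nc > 0"
  shows "spectral_norm A \<le> c \<longleftrightarrow> 0 \<le> c \<and> (\<forall>v\<in>carrier_vec nc. vnorm (A *\<^sub>v v) \<le> c * vnorm v)"
proof
  assume c: "spectral_norm A \<le> c"
  have "vnorm (A *\<^sub>v v) \<le> c * vnorm v" if "v \<in> carrier_vec nc" for v
    using spectral_norm_cases(3)[OF A nc that] mult_right_mono[OF c vnorm_nonneg[of v]] by linarith
  then show "0 \<le> c \<and> (\<forall>v\<in>carrier_vec nc. vnorm (A *\<^sub>v v) \<le> c * vnorm v)"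
    using c spectral_norm_cases(2)[OF A nc] by auto
next
  assume *: "0 \<le> c \<and> (\<forall>v\<in>carrier_vec nc. vnorm (A *\<^sub>v v) \<le> c * vnorm v)"
  obtain v where v: "v \<in> carrier_vec nc" "v \<noteq> 0\<^sub>v nc" "vnorm (A *\<^sub>v v) = spectral_norm A * vnorm v"
    using spectral_norm_cases(1)[OF A nc] by blast
  have "v \<bullet> v \<noteq> 0" using v scalar_prod_self_eq_0 by blast
  then have "vnorm v > 0" using scalar_prod_self_nonneg[of v] by (simp add: vnorm_def order_less_le)
  moreover have "spectral_norm A * vnorm v \<le> c * vnorm v" using * v by metis
  ultimately show "spectral_norm A \<le> c" by simp
qed

section \<open>Measurability of the spectral norm\<close>

lemma floor_approx_tendsto: "(\<lambda>n. of_int \<lfloor>real (Suc n) * x\<rfloor> / real (Suc n)) \<longlonglongrightarrow> (x::real)"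
proof (rule LIMSEQ_I)
  fix r :: real assume "r > 0"
  then obtain n0 where n0: "1 / real (Suc n0) < r" using reals_Archimedean[of r] by (auto simp: inverse_eq_divide)
  show "\<exists>no. \<forall>n\<ge>no. norm (of_int \<lfloor>real (Suc n) * x\<rfloor> / real (Suc n) - x) < r"
  proof (intro exI allI impI)
    fix n assume "n \<ge> n0"
    then have "1 / real (Suc n) \<le> 1 / real (Suc n0)" by (intro divide_left_mono) auto
    moreover have "real_of_int \<lfloor>real (Suc n) * x\<rfloor> / real (Suc n) - x = (of_int \<lfloor>real (Suc n) * x\<rfloor> - real (Suc n) * x) / real (Suc n)"
      by (simp add: diff_divide_distrib del: of_nat_Suc)
    moreover have "\<bar>real_of_int \<lfloor>real (Suc n) * x\<rfloor> - real (Suc n) * x\<bar> \<le> 1" by linarith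
    ultimately have "norm (real_of_int \<lfloor>real (Suc n) * x\<rfloor> / real (Suc n) - x) \<le> 1 / real (Suc n)"
      by (simp add: abs_divide divide_right_mono del: of_nat_Suc)
    then show "norm (real_of_int \<lfloor>real (Suc n) * x\<rfloor> / real (Suc n) - x) < r"
      using n0 \<open>1 / real (Suc n) \<le> 1 / real (Suc n0)\<close> by linarith
  qed
qed

text \<open>Both sides are homogeneous of degree 2, so integer vectors give all vectors with a
  common denominator; these are dense and both sides are continuous.\<close>

lemma quadratic_inequality_from_integers:
  fixes a :: "nat \<Rightarrow> nat \<Rightarrow> real"
  assumes int: "\<And>z :: nat \<Rightarrow> int. z \<in> {..<n} \<rightarrow>\<^sub>E UNIV \<Longrightarrow>
    (\<Sum>i<m. (\<Sum>j<n. a i j * of_int (z j))\<^sup>2) \<le> c * (\<Sum>j<n. (of_int (z j))\<^sup>2)"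
  shows "(\<Sum>i<m. (\<Sum>j<n. a i j * x j)\<^sup>2) \<le> c * (\<Sum>j<n. (x j)\<^sup>2)"
proof (rule LIMSEQ_le)
  let ?x = "\<lambda>k j. of_int \<lfloor>real (Suc k) * x j\<rfloor> / real (Suc k)"
  show "(\<lambda>k. \<Sum>i<m. (\<Sum>j<n. a i j * ?x k j)\<^sup>2) \<longlonglongrightarrow> (\<Sum>i<m. (\<Sum>j<n. a i j * x j)\<^sup>2)"
    by (intro tendsto_intros floor_approx_tendsto)
  show "(\<lambda>k. c * (\<Sum>j<n. (?x k j)\<^sup>2)) \<longlonglongrightarrow> c * (\<Sum>j<n. (x j)\<^sup>2)"
    by (intro tendsto_intros floor_approx_tendsto)
  have "(\<Sum>i<m. (\<Sum>j<n. a i j * ?x k j)\<^sup>2) \<le> c * (\<Sum>j<n. (?x k j)\<^sup>2)" for k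
  proof -
    let ?z = "restrict (\<lambda>j. \<lfloor>real (Suc k) * x j\<rfloor>) {..<n}"
    have "(\<Sum>i<m. (\<Sum>j<n. a i j * ?x k j)\<^sup>2) = (\<Sum>i<m. (\<Sum>j<n. a i j * of_int (?z j))\<^sup>2) / (real (Suc k))\<^sup>2"
      by (simp add: power_divide flip: sum_divide_distrib del: of_nat_Suc)
    also have "\<dots> \<le> c * (\<Sum>j<n. (of_int (?z j))\<^sup>2) / (real (Suc k))\<^sup>2"
      by (intro divide_right_mono int) (auto simp only: restrict_PiE_iff UNIV_I zero_le_power2)
    also have "\<dots> = c * (\<Sum>j<n. (?x k j)\<^sup>2)"
      by (simp add: power_divide del: of_nat_Suc flip: sum_divide_distrib)
    finally show ?thesis .
  qed
  then show "\<exists>N. \<forall>k\<ge>N. (\<Sum>i<m. (\<Sum>j<n. a i j * ?x k j)\<^sup>2) \<le> c * (\<Sum>j<n. (?x k j)\<^sup>2)" by blast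
qed

text \<open>Measurability is entrywise with the dimensions fixed on the space, in place of a
  sigma-algebra on matrices of varying size.\<close>

definition measurable_mat :: "'a measure \<Rightarrow> nat \<Rightarrow> nat \<Rightarrow> ('a \<Rightarrow> real mat) \<Rightarrow> bool" where
  "measurable_mat M nr nc A \<longleftrightarrow> (\<forall>\<omega>\<in>space M. A \<omega> \<in> carrier_mat nr nc) \<and>
     (\<forall>i<nr. \<forall>j<nc. (\<lambda>\<omega>. A \<omega> $$ (i, j)) \<in> borel_measurable M)"

lemma measurable_matI:
  assumes "\<And>\<omega>. \<omega> \<in> space M \<Longrightarrow> A \<omega> \<in> carrier_mat nr nc"
    and "\<And>i j. i < nr \<Longrightarrow> j < nc \<Longrightarrow> f i j \<in> borel_measurable M"
    and "\<And>i j \<omega>. i < nr \<Longrightarrow> j < nc \<Longrightarrow> \<omega> \<in> space M \<Longrightarrow> A \<omega> $$ (i, j) = f i j \<omega>"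
  shows "measurable_mat M nr nc A"
  unfolding measurable_mat_def using assms(1)
proof (intro conjI ballI allI impI)
  fix i j assume "i < nr" "j < nc"
  then show "(\<lambda>\<omega>. A \<omega> $$ (i, j)) \<in> borel_measurable M"
    using assms(2)[of i j] by (subst measurable_cong[OF assms(3)]) auto
qed auto

lemma measurable_mat_mult:
  assumes "measurable_mat M nr n A" "measurable_mat M n nc B"
  shows "measurable_mat M nr nc (\<lambda>\<omega>. A \<omega> * B \<omega>)"
proof (rule measurable_matI[where f = "\<lambda>i j \<omega>. \<Sum>k<n. A \<omega> $$ (i, k) * B \<omega> $$ (k, j)"])
  fix i j assume "i < nr" "j < nc"
  then show "(\<lambda>\<omega>. \<Sum>k<n. A \<omega> $$ (i, k) * B \<omega> $$ (k, j)) \<in> borel_measurable M"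
    using assms by (intro borel_measurable_sum borel_measurable_times) (auto simp: measurable_mat_def)
next
  fix \<omega> assume w: "\<omega> \<in> space M"
  then have AB: "A \<omega> \<in> carrier_mat nr n" "B \<omega> \<in> carrier_mat n nc" using assms by (auto simp: measurable_mat_def)
  then show "A \<omega> * B \<omega> \<in> carrier_mat nr nc" by auto
  show "(A \<omega> * B \<omega>) $$ (i, j) = (\<Sum>k<n. A \<omega> $$ (i, k) * B \<omega> $$ (k, j))" if "i < nr" "j < nc" for i j
    using AB that by (auto simp: scalar_prod_def atLeast0LessThan)
qed

lemma measurable_mat_transpose:
  assumes "measurable_mat M nr nc A"
  shows "measurable_mat M nc nr (\<lambda>\<omega>. transpose_mat (A \<omega>))"
  using assms
  by (intro measurable_matI[where f = "\<lambda>i j \<omega>. A \<omega> $$ (j, i)"]) (auto simp: measurable_mat_def)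

lemma measurable_mat_diff_const:
  assumes "measurable_mat M nr nc A" "B \<in> carrier_mat nr nc"
  shows "measurable_mat M nr nc (\<lambda>\<omega>. A \<omega> - B)"
  using assms
  by (intro measurable_matI[where f = "\<lambda>i j \<omega>. A \<omega> $$ (i, j) - B $$ (i, j)"])
     (auto simp: measurable_mat_def intro!: borel_measurable_diff)

lemma spectral_norm_le_sets:
  assumes "measurable_mat M nr nc A" and nc: "nc > 0"
  shows "{\<omega> \<in> space M. spectral_norm (A \<omega>) \<le> c} \<in> sets M"
proof (cases "c \<ge> 0")
  case True
  let ?Z = "{..<nc} \<rightarrow>\<^sub>E (UNIV :: int set)"
  let ?P = "\<lambda>z \<omega>. (\<Sum>i<nr. (\<Sum>j<nc. A \<omega> $$ (i, j) * of_int (z j))\<^sup>2) \<le> c\<^sup>2 * (\<Sum>j<nc. (of_int (z j))\<^sup>2)"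
  have A: "A \<omega> \<in> carrier_mat nr nc" if "\<omega> \<in> space M" for \<omega> using assms that by (simp add: measurable_mat_def)
  have eq: "spectral_norm (A \<omega>) \<le> c \<longleftrightarrow> (\<forall>z\<in>?Z. ?P z \<omega>)" if w: "\<omega> \<in> space M" for \<omega>
  proof -
    have nrm: "vnorm (A \<omega> *\<^sub>v vec nc x) \<le> c * vnorm (vec nc x) \<longleftrightarrow>
      (\<Sum>i<nr. (\<Sum>j<nc. A \<omega> $$ (i, j) * x j)\<^sup>2) \<le> c\<^sup>2 * (\<Sum>j<nc. (x j)\<^sup>2)" for x
    proof -
      have 1: "vnorm (A \<omega> *\<^sub>v vec nc x) = sqrt (\<Sum>i<nr. (\<Sum>j<nc. A \<omega> $$ (i, j) * x j)\<^sup>2)"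
      proof -
        have "A \<omega> *\<^sub>v vec nc x \<in> carrier_vec nr" using A[OF w] by simp
        moreover have "(A \<omega> *\<^sub>v vec nc x) $ i = (\<Sum>j<nc. A \<omega> $$ (i, j) * x j)" if "i < nr" for i
          using that A[OF w] by (auto simp: scalar_prod_def atLeast0LessThan)
        ultimately show ?thesis by (simp add: vnorm_L2_set L2_set_def)
      qed
      have 2: "c * vnorm (vec nc x) = sqrt (c\<^sup>2 * (\<Sum>j<nc. (x j)\<^sup>2))"
        using True by (simp add: vnorm_L2_set[of _ nc] L2_set_def real_sqrt_mult)
      show ?thesis unfolding 1 2 by simp
    qed
    have "(\<forall>v\<in>carrier_vec nc. vnorm (A \<omega> *\<^sub>v v) \<le> c * vnorm v) \<longleftrightarrow> (\<forall>x. vnorm (A \<omega> *\<^sub>v vec nc x) \<le> c * vnorm (vec nc x))"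
    proof (intro iffI ballI allI)
      fix v :: "real vec" assume *: "\<forall>x. vnorm (A \<omega> *\<^sub>v vec nc x) \<le> c * vnorm (vec nc x)" and v: "v \<in> carrier_vec nc"
      have "vec nc (\<lambda>i. v $ i) = v" using v by (intro eq_vecI) auto
      then show "vnorm (A \<omega> *\<^sub>v v) \<le> c * vnorm v" using *[rule_format, of "\<lambda>i. v $ i"] by simp
    qed auto
    then have "spectral_norm (A \<omega>) \<le> c \<longleftrightarrow>
       (\<forall>x. (\<Sum>i<nr. (\<Sum>j<nc. A \<omega> $$ (i, j) * x j)\<^sup>2) \<le> c\<^sup>2 * (\<Sum>j<nc. (x j)\<^sup>2))"
      unfolding spectral_norm_le_iff[OF A[OF w] nc] nrm using True by simp
    also have "\<dots> \<longleftrightarrow> (\<forall>z\<in>?Z. ?P z \<omega>)"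
    proof (intro iffI allI ballI)
      fix x assume *: "\<forall>z\<in>?Z. ?P z \<omega>"
      show "(\<Sum>i<nr. (\<Sum>j<nc. A \<omega> $$ (i, j) * x j)\<^sup>2) \<le> c\<^sup>2 * (\<Sum>j<nc. (x j)\<^sup>2)"
        by (rule quadratic_inequality_from_integers) (rule *[rule_format])
    next
      fix z :: "nat \<Rightarrow> int"
      assume "\<forall>x. (\<Sum>i<nr. (\<Sum>j<nc. A \<omega> $$ (i, j) * x j)\<^sup>2) \<le> c\<^sup>2 * (\<Sum>j<nc. (x j)\<^sup>2)"
      then show "?P z \<omega>" by (rule spec[where x = "\<lambda>j. of_int (z j)"])
    qed
    finally show ?thesis .
  qed
  have cnt: "countable ?Z" by (intro countable_PiE) auto
  have "{\<omega> \<in> space M. ?P z \<omega>} \<in> sets M" for z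
  proof -
    have [measurable]: "(\<lambda>\<omega>. \<Sum>i<nr. (\<Sum>j<nc. A \<omega> $$ (i, j) * of_int (z j))\<^sup>2) \<in> borel_measurable M"
      using assms(1) unfolding measurable_mat_def
      by (intro borel_measurable_sum borel_measurable_power borel_measurable_times borel_measurable_const) auto
    show ?thesis by measurable
  qed
  then have "{\<omega> \<in> space M. \<forall>z\<in>?Z. ?P z \<omega>} \<in> sets M"
    by (intro sets.sets_Collect_countable_All' cnt) auto
  moreover have "{\<omega> \<in> space M. spectral_norm (A \<omega>) \<le> c} = {\<omega> \<in> space M. \<forall>z\<in>?Z. ?P z \<omega>}"
    using eq by blast
  ultimately show ?thesis by simp
next
  case False
  have "{\<omega> \<in> space M. spectral_norm (A \<omega>) \<le> c} = {}"
  proof -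
    have "\<not> spectral_norm (A \<omega>) \<le> c" if "\<omega> \<in> space M" for \<omega>
      using spectral_norm_cases(2)[OF _ nc, of "A \<omega>" nr] assms(1) that False by (auto simp: measurable_mat_def)
    then show ?thesis by blast
  qed
  then show ?thesis by (simp only: sets.empty_sets)
qed

section \<open>A closed form of the pseudo-inverse\<close>

lemma moore_penrose_unique:
  assumes "moore_penrose A X" "moore_penrose A Y"
  shows "X = Y"
proof -
  define nr nc where "nr = dim_row A" and "nc = dim_col A"
  have A: "A \<in> carrier_mat nr nc" by (simp add: nr_def nc_def)
  have X: "X \<in> carrier_mat nc nr" and Y: "Y \<in> carrier_mat nc nr"
    using assms by (simp_all add: moore_penrose_def nr_def nc_def)
  note mp = assms[unfolded moore_penrose_def]
  have eqs: "A * X * A = A" "A * Y * A = A" "X * A * X = X" "Y * A * Y = Y"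
    and sym: "transpose_mat (A * X) = A * X" "transpose_mat (A * Y) = A * Y"
      "transpose_mat (X * A) = X * A" "transpose_mat (Y * A) = Y * A"
    using mp by auto
  have AX: "A * X \<in> carrier_mat nr nr" and AY: "A * Y \<in> carrier_mat nr nr"
    and XA: "X * A \<in> carrier_mat nc nc" and YA: "Y * A \<in> carrier_mat nc nc"
    using A X Y by auto
  \<comment> \<open>Both A X and A Y are the orthogonal projection onto the column space, both X A
    and Y A the one onto the row space. Then X = X A X = X A Y = Y A Y = Y.\<close>
  have "A * X = (A * Y) * (A * X)"
    using assoc_mult_mat[OF AY A X] by (simp only: eqs)
  then have "transpose_mat (A * X) = transpose_mat ((A * Y) * (A * X))" by simp
  also have "\<dots> = (A * X) * (A * Y)" by (simp only: transpose_mult[OF AY AX] sym)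
  also have "\<dots> = A * Y" using assoc_mult_mat[OF AX A Y] by (simp only: eqs)
  finally have 1: "A * X = A * Y" by (simp only: sym)
  have "X * A = (X * A) * (Y * A)"
    using assoc_mult_mat[OF X A YA] assoc_mult_mat[OF A Y A] by (simp only: eqs)
  then have "transpose_mat (X * A) = transpose_mat ((X * A) * (Y * A))" by simp
  also have "\<dots> = (Y * A) * (X * A)" by (simp only: transpose_mult[OF XA YA] sym)
  also have "\<dots> = Y * A" using assoc_mult_mat[OF Y A XA] assoc_mult_mat[OF A X A] by (simp only: eqs)
  finally have 2: "X * A = Y * A" by (simp only: sym)
  have "X = X * (A * X)" using assoc_mult_mat[OF X A X] eqs by simp
  also have "\<dots> = (X * A) * Y" unfolding 1 using assoc_mult_mat[OF X A Y] by simp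
  also have "\<dots> = Y" unfolding 2 by (rule eqs)
  finally show ?thesis .
qed

lemma pseudo_inverse_eqI: "moore_penrose A X \<Longrightarrow> pseudo_inverse A = X"
  unfolding pseudo_inverse_def by (rule the_equality) (auto intro: moore_penrose_unique)

lemma gram_eq_0:
  fixes X :: "real mat"
  assumes X: "X \<in> carrier_mat nr nc" and 0: "transpose_mat X * X = 0\<^sub>m nc nc"
  shows "X = 0\<^sub>m nr nc"
proof (rule eq_matI)
  fix i j assume ij: "i < dim_row (0\<^sub>m nr nc :: real mat)" "j < dim_col (0\<^sub>m nr nc :: real mat)"
  have "col X j \<bullet> col X j = (transpose_mat X * X) $$ (j, j)" using X ij by simp
  also have "\<dots> = 0" using ij by (simp add: 0)
  finally have "col X j = 0\<^sub>v nr" using X by (intro scalar_prod_self_eq_0) auto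
  then have "col X j $ i = 0" using ij by simp
  then show "X $$ (i, j) = 0\<^sub>m nr nc $$ (i, j)" using X ij by simp
qed (use X in auto)

text \<open>By symmetry (S B)^T (S B) = B^T S (S B), so S and S^2 have the same kernel.\<close>

lemma symmetric_kernel_square:
  fixes S :: "real mat"
  assumes S: "S \<in> carrier_mat n n" "transpose_mat S = S" and B: "B \<in> carrier_mat n k"
    and 0: "S * (S * B) = 0\<^sub>m n k"
  shows "S * B = 0\<^sub>m n k"
proof (rule gram_eq_0)
  show SB: "S * B \<in> carrier_mat n k" using S B by auto
  have "transpose_mat (S * B) * (S * B) = (transpose_mat B * S) * (S * B)"
    using transpose_mult[OF S(1) B] S(2) by simp
  also have "\<dots> = transpose_mat B * (S * (S * B))"
    using S B SB by (intro assoc_mult_mat) auto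
  finally show "transpose_mat (S * B) * (S * B) = 0\<^sub>m k k" using B by (simp add: 0)
qed

text \<open>The matrix coefficient of t^i in adj (t I - S); up to numbering, these are the matrices
  of the Faddeev-LeVerrier recursion.\<close>

definition adj_coeff :: "real mat \<Rightarrow> nat \<Rightarrow> real mat" where
  "adj_coeff S i = mat (dim_row S) (dim_row S) (\<lambda>(r, c). coeff (adj_mat (char_poly_matrix S) $$ (r, c)) i)"

text \<open>Comparing coefficients in \<open>(t I - S) adj (t I - S) = det (t I - S) I\<close>.\<close>
lemma mult_adj_coeff:
  assumes S: "S \<in> carrier_mat n n" and rc: "r < n" "c < n"
  shows "(S * adj_coeff S i) $$ (r, c) =
    (case i of 0 \<Rightarrow> 0 | Suc j \<Rightarrow> adj_coeff S j $$ (r, c)) - (if r = c then coeff (char_poly S) i else 0)"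
proof -
  let ?P = "char_poly_matrix S"
  let ?a = "\<lambda>k. adj_mat ?P $$ (k, c)"
  have P: "?P \<in> carrier_mat n n" using S by simp
  note adj = adj_mat[OF P]
  have Pe: "?P $$ (r, k) = (if r = k then [:0, 1:] else 0) + [:- (S $$ (r, k)):]" if "k < n" for k
    using S rc that by (simp add: char_poly_matrix_def)
  have "(if r = c then char_poly S else 0) = (?P * adj_mat ?P) $$ (r, c)"
    unfolding adj(2) char_poly_def using rc by simp
  also have "\<dots> = (\<Sum>k<n. ?P $$ (r, k) * ?a k)"
    using P adj(1) rc by (auto simp: scalar_prod_def atLeast0LessThan)
  also have "\<dots> = (\<Sum>k<n. (if r = k then pCons 0 (?a k) else 0) - Polynomial.smult (S $$ (r, k)) (?a k))"
    by (intro sum.cong refl) (simp add: Pe distrib_right)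
  also have "\<dots> = pCons 0 (?a r) - (\<Sum>k<n. Polynomial.smult (S $$ (r, k)) (?a k))"
    using rc by (simp add: sum_subtractf)
  finally have "coeff (if r = c then char_poly S else 0) i = coeff (pCons 0 (?a r) - (\<Sum>k<n. Polynomial.smult (S $$ (r, k)) (?a k))) i"
    by (rule arg_cong)
  then have "(if r = c then coeff (char_poly S) i else 0) =
      (case i of 0 \<Rightarrow> 0 | Suc j \<Rightarrow> coeff (?a r) j) - (\<Sum>k<n. S $$ (r, k) * coeff (?a k) i)"
    by (cases i) (auto simp: coeff_sum split: if_splits)
  moreover have "(S * adj_coeff S i) $$ (r, c) = (\<Sum>k<n. S $$ (r, k) * coeff (?a k) i)"
    using S rc by (auto simp: adj_coeff_def scalar_prod_def atLeast0LessThan)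
  ultimately show ?thesis using S rc by (auto simp: adj_coeff_def split: nat.split)
qed

text \<open>For the least \<open>k\<close> with \<open>coeff (char_poly S) k\<close> nonzero, the coefficient identities and the symmetry of \<open>S\<close> give
  \<open>S * S * B = - c * S\<close> with \<open>B = adj_coeff S k\<close>. The resulting generalized inverse is a measurable function of \<open>S\<close>, also where
  \<open>S\<close> is singular.\<close>
definition sym_inverse :: "real mat \<Rightarrow> real mat" where
  "sym_inverse S = (let k = (LEAST k. coeff (char_poly S) k \<noteq> 0)
     in (- 1 / coeff (char_poly S) k) \<cdot>\<^sub>m adj_coeff S k)"

text \<open>Write B_i for \<open>adj_coeff S i\<close> and c_i for the coefficients. Below the least
  \<open>k\<close> with c_k \<noteq> 0 the recursion reads S B_i = B_(i-1), so induction with the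
  kernel lemma gives S B_i = 0. At \<open>k\<close> it reads S B_k = B_(k-1) - c_k I, and one more
  factor S removes B_(k-1). Such a \<open>k\<close> exists because the characteristic polynomial is
  monic.\<close>

lemma sym_inverse:
  assumes S: "S \<in> carrier_mat n n" and sym: "transpose_mat S = S"
  shows "sym_inverse S \<in> carrier_mat n n" and "S * (S * sym_inverse S) = S"
proof -
  let ?c = "coeff (char_poly S)"
  define k where "k = (LEAST k. ?c k \<noteq> 0)"
  have "?c n \<noteq> 0" using degree_monic_char_poly[OF S] by simp
  then have ck: "?c k \<noteq> 0" unfolding k_def by (rule LeastI)
  have less: "?c i = 0" if "i < k" for i using not_less_Least[of i "\<lambda>k. ?c k \<noteq> 0"] that by (auto simp: k_def)
  have B: "adj_coeff S i \<in> carrier_mat n n" for i using S by (simp add: adj_coeff_def)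
  have H: "sym_inverse S = (- 1 / ?c k) \<cdot>\<^sub>m adj_coeff S k" by (simp add: sym_inverse_def Let_def k_def)
  show Hc: "sym_inverse S \<in> carrier_mat n n" using B by (simp add: H)
  have SB: "S * adj_coeff S i = 0\<^sub>m n n" if "i < k" for i
    using that
  proof (induction i)
    case 0
    show ?case by (rule eq_matI) (use S B mult_adj_coeff[OF S, of _ _ 0] less[OF 0] in auto)
  next
    case (Suc i)
    have "S * adj_coeff S (Suc i) = adj_coeff S i"
      by (rule eq_matI) (use S B[of i] B[of "Suc i"] mult_adj_coeff[OF S, of _ _ "Suc i"] less[OF Suc.prems] in auto)
    then have "S * (S * adj_coeff S (Suc i)) = 0\<^sub>m n n" using Suc by simp
    then show ?case by (rule symmetric_kernel_square[OF S sym B])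
  qed
  have SBk: "S * (S * adj_coeff S k) = (- ?c k) \<cdot>\<^sub>m S"
  proof (cases k)
    case 0
    have "S * adj_coeff S k = (- ?c k) \<cdot>\<^sub>m 1\<^sub>m n"
      by (rule eq_matI) (use S B[of k] mult_adj_coeff[OF S, of _ _ k] 0 in auto)
    then show ?thesis using S by (simp add: mult_smult_distrib[OF S, of "1\<^sub>m n" n])
  next
    case (Suc j)
    have eq: "S * adj_coeff S k = adj_coeff S j + (- ?c k) \<cdot>\<^sub>m 1\<^sub>m n"
      by (rule eq_matI) (use S B[of k] B[of j] mult_adj_coeff[OF S, of _ _ k] Suc in auto)
    show ?thesis unfolding eq using S B[of j] SB[of j] Suc
      by (simp add: mult_add_distrib_mat[OF S, of _ n] mult_smult_distrib[OF S, of "1\<^sub>m n" n])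
  qed
  have "S * (S * sym_inverse S) = (- 1 / ?c k) \<cdot>\<^sub>m (S * (S * adj_coeff S k))"
    unfolding H using S B[of k] by (simp add: mult_smult_distrib[of _ n n _ n])
  also have "\<dots> = S" unfolding SBk using ck by (intro eq_matI) auto
  finally show "S * (S * sym_inverse S) = S" .
qed

text \<open>The usual A^T (A A^T)^(-1) with H S H in place of the inverse of S = A A^T.
  \<open>H\<close> satisfies S S H = S only; the extra factor S H, a projection, ensures X A X = X.
  If S is invertible, H S H is its inverse.\<close>

definition gram_pinv :: "real mat \<Rightarrow> real mat" where
  "gram_pinv A = (let S = A * transpose_mat A; H = sym_inverse S in transpose_mat A * (H * (S * H)))"

text \<open>Everything rests on G = S H being the orthogonal projection onto the column space of A:
  it is symmetric, idempotent and fixes A. Then A X = G and X A = A^T H A.\<close>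

lemma moore_penrose_gram_pinv: "moore_penrose A (gram_pinv A)"
proof -
  define nr nc where "nr = dim_row A" and "nc = dim_col A"
  define At where "At = transpose_mat A"
  define S where "S = A * At"
  define H where "H = sym_inverse S"
  define Ht where "Ht = transpose_mat H"
  define G where "G = S * H"
  have A: "A \<in> carrier_mat nr nc" by (simp add: nr_def nc_def)
  have At: "At \<in> carrier_mat nc nr" using A by (simp add: At_def)
  have S: "S \<in> carrier_mat nr nr" using A At by (simp add: S_def)
  have symS: "transpose_mat S = S"
    using transpose_mult[OF A At] by (simp add: S_def At_def)
  have H: "H \<in> carrier_mat nr nr" and SSH: "S * G = S"
    unfolding G_def H_def using sym_inverse[OF S symS] by auto
  have Ht: "Ht \<in> carrier_mat nr nr" using H by (simp add: Ht_def)
  have G: "G \<in> carrier_mat nr nr" using S H by (simp add: G_def)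
  have Gt: "transpose_mat G = Ht * S" using transpose_mult[OF S H] by (simp add: G_def Ht_def symS)
  have HtSS: "(Ht * S) * S = S"
    using transpose_mult[OF S G] by (simp add: SSH symS Gt)
  \<comment> \<open>Evaluate Ht S S H in two ways, by S G = S and by its transpose Ht S S =
    S.\<close>
  have symG: "Ht * S = G"
  proof -
    have "G = ((Ht * S) * S) * H" unfolding HtSS by (simp add: G_def)
    also have "\<dots> = (Ht * S) * G" unfolding G_def using Ht S H by (intro assoc_mult_mat) auto
    also have "\<dots> = Ht * (S * G)" using Ht S G by (intro assoc_mult_mat) auto
    finally show ?thesis by (simp add: SSH)
  qed
  have GS: "G * S = S" using HtSS by (simp only: symG)
  have GG: "G * G = G"
    using assoc_mult_mat[OF G S H] GS by (simp add: G_def)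
  \<comment> \<open>For Z = G A - A one has Z A^T = G S - S = 0, and Z^T = A^T G - A^T, so Z Z^T = 0
    and Z vanishes.\<close>
  have GA: "G * A = A"
  proof -
    define Z where "Z = G * A - A"
    have Z: "Z \<in> carrier_mat nr nc" unfolding Z_def by (rule minus_carrier_mat[OF A])
    have "Z * At = (G * A) * At - A * At"
      unfolding Z_def using G A At by (intro minus_mult_distrib_mat) auto
    also have "(G * A) * At = G * S" unfolding S_def using G A At by (intro assoc_mult_mat) auto
    also have "G * S - A * At = 0\<^sub>m nr nr" unfolding GS using S by (simp add: S_def[symmetric])
    finally have ZAt: "Z * At = 0\<^sub>m nr nr" .
    have "transpose_mat Z = At * transpose_mat G - At"
      unfolding Z_def At_def using G A by (simp add: transpose_minus[of _ nr nc] transpose_mult[OF G A])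
    also have "transpose_mat G = G" by (simp add: Gt symG)
    finally have Zt: "transpose_mat Z = At * G - At" .
    have "Z * transpose_mat Z = Z * (At * G) - Z * At"
      unfolding Zt using Z At G by (intro mult_minus_distrib_mat) auto
    also have "Z * (At * G) = (Z * At) * G" using Z At G by (intro assoc_mult_mat[symmetric]) auto
    finally have ZZ: "transpose_mat (transpose_mat Z) * transpose_mat Z = 0\<^sub>m nr nr" using G by (simp add: ZAt)
    have "transpose_mat Z = 0\<^sub>m nc nr" by (rule gram_eq_0[OF _ ZZ]) (use Z in simp)
    from arg_cong[OF this, of transpose_mat] have Z0: "Z = 0\<^sub>m nr nc" by simp
    show ?thesis
    proof (rule eq_matI)
      fix i j assume ij: "i < dim_row A" "j < dim_col A"
      have "Z $$ (i, j) = 0" using Z0 ij by (simp add: nr_def nc_def)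
      then show "(G * A) $$ (i, j) = A $$ (i, j)" using ij G by (simp add: Z_def nr_def)
    qed (use G A in auto)
  qed
  define X where "X = At * (H * G)"
  have HG: "H * G \<in> carrier_mat nr nr" using H G by simp
  have X: "X \<in> carrier_mat nc nr" using At HG by (simp add: X_def)
  have AX: "A * X = G"
  proof -
    have "A * X = S * (H * G)" unfolding X_def S_def using A At HG by (intro assoc_mult_mat[symmetric]) auto
    also have "\<dots> = G * G" unfolding G_def using S H by (intro assoc_mult_mat[symmetric]) auto
    finally show ?thesis by (simp add: GG)
  qed
  have HA: "H * A \<in> carrier_mat nr nc" using H A by simp
  have XA: "X * A = At * (H * A)"
  proof -
    have "X * A = At * ((H * G) * A)" unfolding X_def using At HG A by (intro assoc_mult_mat) auto
    also have "(H * G) * A = H * (G * A)" using H G A by (intro assoc_mult_mat) auto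
    finally show ?thesis by (simp add: GA)
  qed
  have XAX: "X * A * X = X"
  proof -
    have "X * A * X = X * (A * X)" using X A by (intro assoc_mult_mat) auto
    also have "\<dots> = At * ((H * G) * G)" unfolding AX unfolding X_def using At HG G by (intro assoc_mult_mat) auto
    also have "(H * G) * G = H * (G * G)" using H G by (intro assoc_mult_mat) auto
    finally show ?thesis by (simp add: GG X_def)
  qed
  \<comment> \<open>Symmetry of X A is proved without symmetry of \<open>H\<close>: inserting A^T =
    A^T Ht S and then S H A = A exchanges \<open>H\<close> for its transpose between A^T and
    A.\<close>
  have "At * (Ht * A) = X * A"
  proof -
    have "At = At * G"
      using arg_cong[OF GA, of transpose_mat] transpose_mult[OF G A] by (simp add: Gt symG At_def)
    also have "\<dots> = At * (Ht * S)" by (simp only: symG)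
    finally have e: "At = At * (Ht * S)" .
    have HtS: "Ht * S \<in> carrier_mat nr nr" using Ht S by simp
    have "X * A = (At * (Ht * S)) * (H * A)" unfolding XA by (simp only: e[symmetric])
    also have "\<dots> = At * ((Ht * S) * (H * A))" using At HtS HA by (intro assoc_mult_mat) auto
    also have "(Ht * S) * (H * A) = Ht * (S * (H * A))" using Ht S HA by (intro assoc_mult_mat) auto
    also have "S * (H * A) = G * A" unfolding G_def using S H A by (intro assoc_mult_mat[symmetric]) auto
    finally show ?thesis by (simp add: GA)
  qed
  moreover have "transpose_mat (X * A) = At * (Ht * A)"
  proof -
    have "transpose_mat (X * A) = transpose_mat (H * A) * A"
      unfolding XA using transpose_mult[OF At HA] by (simp add: At_def)
    also have "\<dots> = (At * Ht) * A" using transpose_mult[OF H A] by (simp add: At_def Ht_def)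
    also have "\<dots> = At * (Ht * A)" using At Ht A by (intro assoc_mult_mat) auto
    finally show ?thesis .
  qed
  moreover have "gram_pinv A = X"
    by (simp add: gram_pinv_def Let_def X_def G_def H_def S_def At_def)
  ultimately show ?thesis
    using A X by (simp add: moore_penrose_def AX GA XAX Gt symG nr_def nc_def)
qed

lemma pseudo_inverse_eq_gram_pinv: "pseudo_inverse A = gram_pinv A"
  by (rule pseudo_inverse_eqI) (rule moore_penrose_gram_pinv)

section \<open>Measurable dependence of the pseudo-inverse\<close>

definition measurable_poly :: "'a measure \<Rightarrow> ('a \<Rightarrow> real poly) \<Rightarrow> bool" where
  "measurable_poly M p \<longleftrightarrow> (\<forall>n. (\<lambda>\<omega>. coeff (p \<omega>) n) \<in> borel_measurable M)"

lemma measurable_poly_const: "measurable_poly M (\<lambda>_. c)"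
  by (simp add: measurable_poly_def)

lemma measurable_poly_cong:
  "(\<And>\<omega>. \<omega> \<in> space M \<Longrightarrow> p \<omega> = q \<omega>) \<Longrightarrow> measurable_poly M p \<longleftrightarrow> measurable_poly M q"
  unfolding measurable_poly_def by (intro all_cong1 measurable_cong) auto

lemma measurable_poly_add: "measurable_poly M p \<Longrightarrow> measurable_poly M q \<Longrightarrow> measurable_poly M (\<lambda>\<omega>. p \<omega> + q \<omega>)"
  by (auto simp: measurable_poly_def intro!: borel_measurable_add)

lemma measurable_poly_mult: "measurable_poly M p \<Longrightarrow> measurable_poly M q \<Longrightarrow> measurable_poly M (\<lambda>\<omega>. p \<omega> * q \<omega>)"
  by (auto simp: measurable_poly_def coeff_mult intro!: borel_measurable_sum borel_measurable_times)

lemma measurable_poly_sum: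
  "(\<And>i. i \<in> I \<Longrightarrow> measurable_poly M (p i)) \<Longrightarrow> measurable_poly M (\<lambda>\<omega>. \<Sum>i\<in>I. p i \<omega>)"
  by (auto simp: measurable_poly_def coeff_sum intro!: borel_measurable_sum)

lemma measurable_poly_prod:
  "(\<And>i. i \<in> I \<Longrightarrow> measurable_poly M (p i)) \<Longrightarrow> measurable_poly M (\<lambda>\<omega>. \<Prod>i\<in>I. p i \<omega>)"
  by (induction I rule: infinite_finite_induct) (auto intro: measurable_poly_const measurable_poly_mult)

lemma measurable_poly_det:
  assumes "\<And>\<omega>. \<omega> \<in> space M \<Longrightarrow> A \<omega> \<in> carrier_mat n n"
    and "\<And>i j. i < n \<Longrightarrow> j < n \<Longrightarrow> measurable_poly M (\<lambda>\<omega>. A \<omega> $$ (i, j))"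
  shows "measurable_poly M (\<lambda>\<omega>. det (A \<omega>))"
proof (subst measurable_poly_cong)
  show "det (A \<omega>) = (\<Sum>p\<in>{p. p permutes {0..<n}}. signof p * (\<Prod>i = 0..<n. A \<omega> $$ (i, p i)))"
    if "\<omega> \<in> space M" for \<omega> by (rule det_def'[OF assms(1)[OF that]])
  show "measurable_poly M (\<lambda>\<omega>. \<Sum>p\<in>{p. p permutes {0..<n}}. signof p * (\<Prod>i = 0..<n. A \<omega> $$ (i, p i)))"
    by (intro measurable_poly_sum measurable_poly_mult measurable_poly_const measurable_poly_prod assms(2))
       (auto dest: permutes_in_image)
qed

lemma measurable_poly_adj_mat:
  assumes A: "\<And>\<omega>. \<omega> \<in> space M \<Longrightarrow> A \<omega> \<in> carrier_mat n n"
    and m: "\<And>i j. i < n \<Longrightarrow> j < n \<Longrightarrow> measurable_poly M (\<lambda>\<omega>. A \<omega> $$ (i, j))"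
    and ij: "i < n" "j < n"
  shows "measurable_poly M (\<lambda>\<omega>. adj_mat (A \<omega>) $$ (i, j))"
proof (subst measurable_poly_cong)
  show "adj_mat (A \<omega>) $$ (i, j) = (- 1) ^ (j + i) * det (mat_delete (A \<omega>) j i)" if "\<omega> \<in> space M" for \<omega>
    using A[OF that] ij by (simp add: adj_mat_def cofactor_def)
  have "measurable_poly M (\<lambda>\<omega>. det (mat_delete (A \<omega>) j i))"
  proof (rule measurable_poly_det)
    show "mat_delete (A \<omega>) j i \<in> carrier_mat (n - 1) (n - 1)" if "\<omega> \<in> space M" for \<omega>
      using A[OF that] by (rule mat_delete_carrier)
    fix r c assume rc: "r < n - 1" "c < n - 1"
    let ?r = "if r < j then r else Suc r" and ?c = "if c < i then c else Suc c"
    have "measurable_poly M (\<lambda>\<omega>. A \<omega> $$ (?r, ?c))" using rc by (intro m) auto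
    moreover have "mat_delete (A \<omega>) j i $$ (r, c) = A \<omega> $$ (?r, ?c)" if "\<omega> \<in> space M" for \<omega>
      using A[OF that] rc by (simp add: mat_delete_def)
    ultimately show "measurable_poly M (\<lambda>\<omega>. mat_delete (A \<omega>) j i $$ (r, c))"
      by (subst measurable_poly_cong) auto
  qed
  then show "measurable_poly M (\<lambda>\<omega>. (- 1) ^ (j + i) * det (mat_delete (A \<omega>) j i))"
    by (intro measurable_poly_mult measurable_poly_const)
qed

text \<open>The least index with nonzero coefficient varies with the outcome, but is at most
  \<open>n\<close>. The entry is written as a finite sum over candidate indices \<open>j\<close>,
  each term switched on by the measurable event that \<open>j\<close> is the least one.\<close>

lemma measurable_mat_sym_inverse:
  assumes S: "measurable_mat M n n S"
  shows "measurable_mat M n n (\<lambda>\<omega>. sym_inverse (S \<omega>))"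
proof -
  let ?P = "\<lambda>\<omega>. char_poly_matrix (S \<omega>)"
  have Sc: "S \<omega> \<in> carrier_mat n n" if "\<omega> \<in> space M" for \<omega> using S that by (simp add: measurable_mat_def)
  have P: "?P \<omega> \<in> carrier_mat n n" if "\<omega> \<in> space M" for \<omega> using Sc[OF that] by simp
  have Pm: "measurable_poly M (\<lambda>\<omega>. ?P \<omega> $$ (i, j))" if ij: "i < n" "j < n" for i j
  proof (subst measurable_poly_cong)
    show "?P \<omega> $$ (i, j) = (if i = j then [:0, 1:] else 0) + [:- (S \<omega> $$ (i, j)):]" if "\<omega> \<in> space M" for \<omega>
      using Sc[OF that] ij by (simp add: char_poly_matrix_def)
    have "(\<lambda>\<omega>. S \<omega> $$ (i, j)) \<in> borel_measurable M" using S ij by (simp add: measurable_mat_def)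
    then have "(\<lambda>\<omega>. coeff [:- (S \<omega> $$ (i, j)):] k) \<in> borel_measurable M" for k
      by (cases k) auto
    then have "measurable_poly M (\<lambda>\<omega>. [:- (S \<omega> $$ (i, j)):])" by (simp add: measurable_poly_def)
    then show "measurable_poly M (\<lambda>\<omega>. (if i = j then [:0, 1:] else 0) + [:- (S \<omega> $$ (i, j)):])"
      by (intro measurable_poly_add measurable_poly_const)
  qed
  define c where "c j \<omega> = coeff (char_poly (S \<omega>)) j" for j \<omega>
  have c: "c j \<in> borel_measurable M" for j
    using measurable_poly_det[OF P Pm] by (simp add: measurable_poly_def c_def[abs_def] char_poly_def)
  let ?a = "\<lambda>r s j \<omega>. coeff (adj_mat (?P \<omega>) $$ (r, s)) j"
  have a: "?a r s j \<in> borel_measurable M" if "r < n" "s < n" for r s j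
    using measurable_poly_adj_mat[OF P Pm that] by (simp add: measurable_poly_def)
  show ?thesis
  proof (rule measurable_matI[where f = "\<lambda>r s \<omega>. \<Sum>j\<le>n. if c j \<omega> \<noteq> 0 \<and> (\<forall>i\<in>{..<j}. c i \<omega> = 0) then - ?a r s j \<omega> / c j \<omega> else 0"])
    fix \<omega> assume w: "\<omega> \<in> space M"
    note B = Sc[OF w]
    show "sym_inverse (S \<omega>) \<in> carrier_mat n n"
      using B by (simp add: sym_inverse_def Let_def adj_coeff_def)
    define k where "k = (LEAST k. c k \<omega> \<noteq> 0)"
    have cn: "c n \<omega> \<noteq> 0" using degree_monic_char_poly[OF B] by (simp add: c_def)
    then have ck: "c k \<omega> \<noteq> 0" unfolding k_def by (rule LeastI)
    have kn: "k \<le> n" unfolding k_def using cn by (rule Least_le)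
    have less: "c i \<omega> = 0" if "i < k" for i using not_less_Least[of i "\<lambda>k. c k \<omega> \<noteq> 0"] that by (auto simp: k_def)
    have iff: "c j \<omega> \<noteq> 0 \<and> (\<forall>i\<in>{..<j}. c i \<omega> = 0) \<longleftrightarrow> j = k" for j
      using ck less by (metis lessThan_iff linorder_neqE_nat)
    fix r s assume rs: "r < n" "s < n"
    have "sym_inverse (S \<omega>) $$ (r, s) = - ?a r s k \<omega> / c k \<omega>"
      using B rs by (simp add: sym_inverse_def Let_def adj_coeff_def c_def[symmetric] k_def[symmetric])
    then show "sym_inverse (S \<omega>) $$ (r, s) =
        (\<Sum>j\<le>n. if c j \<omega> \<noteq> 0 \<and> (\<forall>i\<in>{..<j}. c i \<omega> = 0) then - ?a r s j \<omega> / c j \<omega> else 0)"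
      unfolding iff using kn by simp
  next
    fix r s assume rs: "r < n" "s < n"
    have z: "{\<omega> \<in> space M. c j \<omega> = 0} \<in> sets M" for j
      using c[of j] by measurable
    then have "{\<omega> \<in> space M. c j \<omega> \<noteq> 0 \<and> (\<forall>i\<in>{..<j}. c i \<omega> = 0)} \<in> sets M" for j
      by (intro sets.sets_Collect_conj sets.sets_Collect_neg sets.sets_Collect_finite_All) auto
    then show "(\<lambda>\<omega>. \<Sum>j\<le>n. if c j \<omega> \<noteq> 0 \<and> (\<forall>i\<in>{..<j}. c i \<omega> = 0) then - ?a r s j \<omega> / c j \<omega> else 0) \<in> borel_measurable M"
      by (intro borel_measurable_sum measurable_If borel_measurable_divide borel_measurable_uminus a c rs borel_measurable_const)
  qed
qed

lemma measurable_mat_pseudo_inverse: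
  assumes A: "measurable_mat M nr nc A"
  shows "measurable_mat M nc nr (\<lambda>\<omega>. pseudo_inverse (A \<omega>))"
proof -
  note At = measurable_mat_transpose[OF A]
  note S = measurable_mat_mult[OF A At]
  note H = measurable_mat_sym_inverse[OF S]
  show ?thesis unfolding pseudo_inverse_eq_gram_pinv gram_pinv_def Let_def
    by (rule measurable_mat_mult[OF At measurable_mat_mult[OF H measurable_mat_mult[OF S H]]])
qed

section \<open>Least squares for the rollouts\<close>

lemma sum_div_mod:
  fixes q T :: nat
  assumes "q > 0"
  shows "(\<Sum>c<q * T. f (c div q) (c mod q)) = (\<Sum>a<T. \<Sum>k<q. f a k)"
proof -
  let ?g = "\<lambda>c. f (c div q) (c mod q)"
  have "(\<Sum>c<q * T. ?g c) = (\<Sum>a<T. sum ?g {a * q..<a * q + q})"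
    by (simp add: sum.nat_group mult.commute)
  also have "\<dots> = (\<Sum>a<T. \<Sum>k<q. f a k)"
  proof (rule sum.cong[OF refl])
    fix a
    have "sum ?g {a * q..<a * q + q} = sum ?g {0 + a * q..<q + a * q}" by (simp add: add.commute)
    also have "\<dots> = (\<Sum>k\<in>{0..<q}. ?g (k + a * q))" by (rule sum.shift_bounds_nat_ivl)
    also have "\<dots> = (\<Sum>k<q. f a k)"
      using assms by (intro sum.cong) (auto simp: atLeast0LessThan)
    finally show "sum ?g {a * q..<a * q + q} = (\<Sum>k<q. f a k)" .
  qed
  finally show ?thesis .
qed

text \<open>Rollouts are counted from 1 and times from 0: column \<open>c\<close> of a concatenation
  belongs to rollout \<open>c div T + 1\<close> at time \<open>c mod T\<close>.\<close>

lemma sum_hconcat_columns: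
  fixes N T :: nat
  assumes "T > 0"
  shows "(\<Sum>c<N * T. f (c div T + 1, c mod T)) = (\<Sum>j\<in>{1..N} \<times> {..<T}. f j)"
proof -
  have "(\<Sum>c<N * T. f (c div T + 1, c mod T)) = (\<Sum>a<N. \<Sum>t<T. f (a + 1, t))"
    using sum_div_mod[OF assms, of "\<lambda>a t. f (a + 1, t)" N] by (simp add: mult.commute)
  also have "\<dots> = (\<Sum>i\<in>{1..N}. \<Sum>t<T. f (i, t))"
    by (rule sum.reindex_bij_witness[of _ "\<lambda>i. i - 1" "\<lambda>a. a + 1"]) auto
  finally show ?thesis by (simp add: sum.cartesian_product)
qed

lemma hconcat_column_index:
  fixes c :: nat
  assumes "c < N * T" "T > 0"
  shows "c div T + 1 \<in> {1..N}" "c mod T < T"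
  using assms by (auto simp: less_mult_imp_div_less Suc_le_eq)

text \<open>The product is a convolution: block \<open>a\<close> of the row meets the input of time
  t - a, and blocks with a > t meet zeros. Block 0 is the direct term \<open>D\<close>; the others
  are renumbered by a = k + 1.\<close>

lemma markov_row_toeplitz_input:
  assumes A: "A \<in> carrier_mat n n" and B: "B \<in> carrier_mat n m" and C: "C \<in> carrier_mat p n"
    and D: "D \<in> carrier_mat p m" and m: "m > 0" and r: "r < p" and t: "t < T"
    and u: "\<And>s. s \<le> t \<Longrightarrow> u s \<in> carrier_vec m"
  shows "(\<Sum>c<m * T. markov_row T A B C D $$ (r, c) * toeplitz_input m T u $$ (c, t)) =
    (D *\<^sub>v u t) $ r + (\<Sum>k<t. ((C * A ^\<^sub>m k * B) *\<^sub>v u (t - Suc k)) $ r)"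
proof -
  define K where "K a = (if a = 0 then D else C * A ^\<^sub>m (a - 1) * B)" for a
  have K: "K a \<in> carrier_mat p m" for a
    using A B C D pow_carrier_mat[OF A, of "a - 1"] by (auto simp: K_def)
  have "(\<Sum>c<m * T. markov_row T A B C D $$ (r, c) * toeplitz_input m T u $$ (c, t)) =
      (\<Sum>c<m * T. K (c div m) $$ (r, c mod m) * (if c div m \<le> t then u (t - c div m) $ (c mod m) else 0))"
    using B C r t by (intro sum.cong refl) (auto simp: markov_row_def toeplitz_input_def Let_def K_def)
  also have "\<dots> = (\<Sum>a<T. \<Sum>s<m. K a $$ (r, s) * (if a \<le> t then u (t - a) $ s else 0))"
    by (rule sum_div_mod[OF m])
  also have "\<dots> = (\<Sum>a<T. if a \<le> t then (K a *\<^sub>v u (t - a)) $ r else 0)"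
  proof (intro sum.cong refl)
    fix a
    show "(\<Sum>s<m. K a $$ (r, s) * (if a \<le> t then u (t - a) $ s else 0)) = (if a \<le> t then (K a *\<^sub>v u (t - a)) $ r else 0)"
    proof (cases "a \<le> t")
      case True
      have "u (t - a) \<in> carrier_vec m" by (rule u) simp
      then show ?thesis using K[of a] r True by (auto simp: scalar_prod_def atLeast0LessThan)
    qed simp
  qed
  also have "\<dots> = (\<Sum>a<Suc t. (K a *\<^sub>v u (t - a)) $ r)"
    using t by (intro sum.mono_neutral_cong_right) auto
  also have "\<dots> = (K 0 *\<^sub>v u t) $ r + (\<Sum>k<t. (K (Suc k) *\<^sub>v u (t - Suc k)) $ r)"
    by (subst sum.lessThan_Suc_shift) simp
  finally show ?thesis by (simp add: K_def)
qed

lemma pow_mat_Suc_left: "A \<in> carrier_mat n n \<Longrightarrow> A * A ^\<^sub>m k = A ^\<^sub>m k * A"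
proof (induction k)
  case (Suc k)
  note Ak = pow_carrier_mat[OF Suc.prems, of k]
  have "A * (A ^\<^sub>m k * A) = (A * A ^\<^sub>m k) * A"
    using Suc.prems Ak by (intro assoc_mult_mat[symmetric]) auto
  then show ?case using Suc by simp
qed simp

text \<open>The left factor \<open>R\<close> is arbitrary so that the induction closes: unfolding
  one step replaces \<open>R\<close> by R A, and the hypothesis is used for this product. The
  outputs need R = C.\<close>

lemma state_formula:
  assumes A: "(A :: real mat) \<in> carrier_mat n n" and B: "B \<in> carrier_mat n m" and Bw: "Bw \<in> carrier_mat n q"
    and x0: "x 0 = 0\<^sub>v n"
    and xs: "\<And>t. t < T \<Longrightarrow> x (Suc t) = A *\<^sub>v x t + B *\<^sub>v u t + Bw *\<^sub>v w t"
    and u: "\<And>t. t < T \<Longrightarrow> u t \<in> carrier_vec m" and w: "\<And>t. t < T \<Longrightarrow> w t \<in> carrier_vec q"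
  shows "t \<le> T \<Longrightarrow> x t \<in> carrier_vec n \<and> (\<forall>R\<in>carrier_mat p n. \<forall>r<p. (R *\<^sub>v x t) $ r =
    (\<Sum>k<t. ((R * A ^\<^sub>m k * B) *\<^sub>v u (t - Suc k)) $ r) + (\<Sum>k<t. ((R * A ^\<^sub>m k * Bw) *\<^sub>v w (t - Suc k)) $ r))"
proof (induction t)
  case 0
  show ?case using x0 by auto
next
  case (Suc t)
  then have t: "t < T" and xt: "x t \<in> carrier_vec n" by auto
  note Ak = pow_carrier_mat[OF A]
  have c1: "A *\<^sub>v x t \<in> carrier_vec n" "B *\<^sub>v u t \<in> carrier_vec n" "Bw *\<^sub>v w t \<in> carrier_vec n"
    using A B Bw xt u[OF t] w[OF t] by auto
  show ?case
  proof (intro conjI ballI allI impI)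
    show "x (Suc t) \<in> carrier_vec n" unfolding xs[OF t] using c1 by auto
    fix R :: "real mat" and r assume R: "R \<in> carrier_mat p n" and r: "r < p"
    have RA: "R * A \<in> carrier_mat p n" using R A by auto
    have RAk: "R * A ^\<^sub>m Suc k = R * A * A ^\<^sub>m k" for k
      using assoc_mult_mat[OF R A Ak[of k]] pow_mat_Suc_left[OF A, of k] by simp
    have "R *\<^sub>v x (Suc t) = R *\<^sub>v (A *\<^sub>v x t) + R *\<^sub>v (B *\<^sub>v u t) + R *\<^sub>v (Bw *\<^sub>v w t)"
      unfolding xs[OF t] using c1
      by (subst mult_add_distrib_mat_vec[OF R], auto, subst mult_add_distrib_mat_vec[OF R], auto)
    then have "(R *\<^sub>v x (Suc t)) $ r = ((R * A) *\<^sub>v x t) $ r + ((R * B) *\<^sub>v u t) $ r + ((R * Bw) *\<^sub>v w t) $ r"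
      using R A B Bw xt u[OF t] w[OF t] r c1
      by (simp add: assoc_mult_mat_vec[of _ p n _ n] assoc_mult_mat_vec[of _ p n _ m] assoc_mult_mat_vec[of _ p n _ q])
    also have "((R * A) *\<^sub>v x t) $ r = (\<Sum>k<t. ((R * A * A ^\<^sub>m k * B) *\<^sub>v u (t - Suc k)) $ r) +
        (\<Sum>k<t. ((R * A * A ^\<^sub>m k * Bw) *\<^sub>v w (t - Suc k)) $ r)"
      by (rule Suc.IH[OF less_imp_le[OF t], THEN conjunct2, rule_format, OF RA r])
    finally have Rx: "(R *\<^sub>v x (Suc t)) $ r = \<dots> + ((R * B) *\<^sub>v u t) $ r + ((R * Bw) *\<^sub>v w t) $ r" .
    have shift: "(\<Sum>k<Suc t. ((R * A ^\<^sub>m k * X) *\<^sub>v z (Suc t - Suc k)) $ r) =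
        ((R * X) *\<^sub>v z t) $ r + (\<Sum>k<t. ((R * A * A ^\<^sub>m k * X) *\<^sub>v z (t - Suc k)) $ r)" for X z
      unfolding sum.lessThan_Suc_shift RAk using R A by simp
    show "(R *\<^sub>v x (Suc t)) $ r = (\<Sum>k<Suc t. ((R * A ^\<^sub>m k * B) *\<^sub>v u (Suc t - Suc k)) $ r) +
        (\<Sum>k<Suc t. ((R * A ^\<^sub>m k * Bw) *\<^sub>v w (Suc t - Suc k)) $ r)"
      unfolding shift Rx by simp
  qed
qed

text \<open>Process noise enters an output only through later states, so its Markov row has the zero
  matrix in place of the direct term.\<close>

lemma output_formula:
  assumes A: "A \<in> carrier_mat n n" and B: "B \<in> carrier_mat n m" and Bw: "Bw \<in> carrier_mat n q"
    and C: "C \<in> carrier_mat p n" and D: "D \<in> carrier_mat p m" and Dv: "Dv \<in> carrier_mat p l"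
    and x0: "x 0 = 0\<^sub>v n"
    and xs: "\<And>t. t < T \<Longrightarrow> x (Suc t) = A *\<^sub>v x t + B *\<^sub>v u t + Bw *\<^sub>v w t"
    and ys: "\<And>t. t < T \<Longrightarrow> y t = C *\<^sub>v x t + D *\<^sub>v u t + Dv *\<^sub>v v t"
    and u: "\<And>t. t < T \<Longrightarrow> u t \<in> carrier_vec m" and w: "\<And>t. t < T \<Longrightarrow> w t \<in> carrier_vec q"
    and m: "m > 0" and q: "q > 0" and r: "r < p" and t: "t < T"
  shows "y t $ r = (\<Sum>c<m * T. markov_row T A B C D $$ (r, c) * toeplitz_input m T u $$ (c, t)) +
    (\<Sum>c<q * T. markov_row T A Bw C (0\<^sub>m p q) $$ (r, c) * toeplitz_input q T w $$ (c, t)) + (Dv *\<^sub>v v t) $ r"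
proof -
  have Cx: "(C *\<^sub>v x t) $ r = (\<Sum>k<t. ((C * A ^\<^sub>m k * B) *\<^sub>v u (t - Suc k)) $ r) +
      (\<Sum>k<t. ((C * A ^\<^sub>m k * Bw) *\<^sub>v w (t - Suc k)) $ r)"
    using state_formula[where x = x and u = u and w = w and T = T and t = t and p = p,
        OF A B Bw x0 xs u w] t C r by auto
  have "(\<Sum>c<m * T. markov_row T A B C D $$ (r, c) * toeplitz_input m T u $$ (c, t)) =
      (D *\<^sub>v u t) $ r + (\<Sum>k<t. ((C * A ^\<^sub>m k * B) *\<^sub>v u (t - Suc k)) $ r)"
    using t by (intro markov_row_toeplitz_input[OF A B C D m r t] u) auto
  moreover have "(\<Sum>c<q * T. markov_row T A Bw C (0\<^sub>m p q) $$ (r, c) * toeplitz_input q T w $$ (c, t)) =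
      (0\<^sub>m p q *\<^sub>v w t) $ r + (\<Sum>k<t. ((C * A ^\<^sub>m k * Bw) *\<^sub>v w (t - Suc k)) $ r)"
    using t by (intro markov_row_toeplitz_input[OF A Bw C _ q r t] w) auto
  moreover have "(0\<^sub>m p q *\<^sub>v w t) $ r = 0" using r w[OF t] by (simp add: scalar_prod_def)
  moreover have "y t $ r = (C *\<^sub>v x t) $ r + (D *\<^sub>v u t) $ r + (Dv *\<^sub>v v t) $ r"
    unfolding ys[OF t] using C D Dv r by simp
  ultimately show ?thesis using Cx by simp
qed

text \<open>The deterministic part. The noise bounds are assumed on the range of U^T only, and
  \<open>\<kappa>\<close> bounds U^T from below, which yields both the right inverse property of the
  pseudo-inverse and its norm bound 1 / \<kappa>.\<close>

lemma ols_error_bound: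
  assumes U: "U \<in> carrier_mat d k" and G: "G \<in> carrier_mat p d"
    and F: "F \<in> carrier_mat p e" and W: "W \<in> carrier_mat e k"
    and Dv: "Dv \<in> carrier_mat p l" and V: "V \<in> carrier_mat l k"
    and Y: "Y = G * U + F * W + Dv * V"
    and pos: "d > 0" "e > 0" "l > 0" and \<kappa>: "\<kappa> > 0"
    and low: "\<And>y. y \<in> carrier_vec d \<Longrightarrow> \<kappa> * vnorm y \<le> vnorm (transpose_mat U *\<^sub>v y)"
    and bw: "\<And>y. y \<in> carrier_vec d \<Longrightarrow> vnorm (W *\<^sub>v (transpose_mat U *\<^sub>v y)) \<le> \<alpha> * vnorm (transpose_mat U *\<^sub>v y)"
    and bv: "\<And>y. y \<in> carrier_vec d \<Longrightarrow> vnorm (V *\<^sub>v (transpose_mat U *\<^sub>v y)) \<le> \<beta> * vnorm (transpose_mat U *\<^sub>v y)"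
    and nn: "\<alpha> \<ge> 0" "\<beta> \<ge> 0"
  shows "spectral_norm (ols_estimator Y U - G) \<le> (spectral_norm F * \<alpha> + spectral_norm Dv * \<beta>) / \<kappa>"
proof -
  define P where "P = pseudo_inverse U"
  have mp: "moore_penrose U P" unfolding P_def pseudo_inverse_eq_gram_pinv by (rule moore_penrose_gram_pinv)
  have P: "P \<in> carrier_mat k d" and UPU: "U * P * U = U" and PUP: "P * U * P = P"
    and s1: "transpose_mat (U * P) = U * P" and s2: "transpose_mat (P * U) = P * U"
    using mp U by (auto simp: moore_penrose_def)
  have UP: "U * P \<in> carrier_mat d d" and PU: "P * U \<in> carrier_mat k k" using U P by auto
  have Ut: "transpose_mat U \<in> carrier_mat k d" using U by simp
  have FW: "F * W \<in> carrier_mat p k" and DV: "Dv * V \<in> carrier_mat p k" and GU: "G * U \<in> carrier_mat p k"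
    using F W Dv V G U by auto
  have Yc: "Y \<in> carrier_mat p k" unfolding Y using FW DV GU by auto
  have nF: "spectral_norm F \<ge> 0" and nD: "spectral_norm Dv \<ge> 0"
    using spectral_norm_cases(2)[OF F pos(2)] spectral_norm_cases(2)[OF Dv pos(3)] by auto
  have E: "ols_estimator Y U - G \<in> carrier_mat p d" by (rule minus_carrier_mat[OF G])
  show ?thesis
    unfolding spectral_norm_le_iff[OF E pos(1)]
  proof (intro conjI ballI)
    show "0 \<le> (spectral_norm F * \<alpha> + spectral_norm Dv * \<beta>) / \<kappa>" using nF nD nn \<kappa> by simp
    fix z :: "real vec" assume z: "z \<in> carrier_vec d"
    define g where "g = P *\<^sub>v z"
    have g: "g \<in> carrier_vec k" using P z by (simp add: g_def)
    define y where "y = transpose_mat P *\<^sub>v g"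
    have y: "y \<in> carrier_vec d" using P g by (simp add: y_def)
    have Ug: "U *\<^sub>v g = z"
    proof -
      define z' where "z' = U *\<^sub>v g"
      have z': "z' \<in> carrier_vec d" using U g by (simp add: z'_def)
      have z'_eq: "z' = (U * P) *\<^sub>v z" unfolding z'_def g_def using U P z by (intro assoc_mult_mat_vec[symmetric]) auto
      \<comment> \<open>This is the transpose of U P U = U. Injectivity of U^T, contained in
        \<open>low\<close>, then turns it into U P z = z.\<close>
      have "transpose_mat U * (U * P) = transpose_mat U"
        using transpose_mult[OF UP U] UPU s1 by simp
      then have "transpose_mat U *\<^sub>v z' = transpose_mat U *\<^sub>v z"
        unfolding z'_eq using assoc_mult_mat_vec[OF Ut UP z] by simp
      then have "transpose_mat U *\<^sub>v (z' - z) = 0\<^sub>v k"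
        using mult_minus_distrib_mat_vec[OF Ut z' z] Ut z by simp
      then have "\<kappa> * vnorm (z' - z) \<le> 0" using low[of "z' - z"] z z' by simp
      then have "vnorm (z' - z) = 0" using \<kappa> vnorm_nonneg[of "z' - z"] by (simp add: mult_le_0_iff)
      then have "z' - z = 0\<^sub>v d" using z z' by (intro scalar_prod_self_eq_0) (auto simp: vnorm_def)
      then have "(z' - z) $ i = 0" if "i < d" for i using that by simp
      then show ?thesis unfolding z'_def[symmetric] using z z' by (intro eq_vecI) auto
    qed
    have gy: "transpose_mat U *\<^sub>v y = g"
    proof -
      have "g = (P * U * P) *\<^sub>v z" by (simp add: g_def PUP)
      also have "\<dots> = (P * U) *\<^sub>v g" unfolding g_def using PU P z by (intro assoc_mult_mat_vec) auto
      also have "P * U = transpose_mat U * transpose_mat P" using s2 transpose_mult[OF P U] by simp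
      also have "\<dots> *\<^sub>v g = transpose_mat U *\<^sub>v y"
        unfolding y_def using Ut P g by (intro assoc_mult_mat_vec) auto
      finally show ?thesis by simp
    qed
    have gz: "\<kappa> * vnorm g \<le> vnorm z"
    proof (cases "vnorm g = 0")
      case False
      then have g0: "vnorm g > 0" using vnorm_nonneg[of g] by linarith
      \<comment> \<open>As g = U^T y and U g = z, moving U^T across the scalar product gives |g|^2 =
        y . z. Applying \<open>low\<close> to \<open>y\<close> then bounds \<kappa> |g| by
        |z|.\<close>
      have "(vnorm g)\<^sup>2 = y \<bullet> z"
        using transpose_vec_mult_scalar[OF U g y] by (simp add: vnorm_power2 gy Ug)
      also have "\<dots> \<le> vnorm y * vnorm z" using scalar_prod_le_vnorm[OF y z] by linarith
      finally have "\<kappa> * (vnorm g)\<^sup>2 \<le> \<kappa> * (vnorm y * vnorm z)" using \<kappa> by (intro mult_left_mono) auto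
      also have "\<dots> \<le> vnorm g * vnorm z"
        using low[OF y] mult_right_mono[of "\<kappa> * vnorm y" "vnorm g" "vnorm z"] by (simp add: gy mult.assoc)
      finally show ?thesis using g0 by (simp add: power2_eq_square mult.left_commute[of \<kappa>])
    qed simp
    have Wg: "W *\<^sub>v g \<in> carrier_vec e" and Vg: "V *\<^sub>v g \<in> carrier_vec l" using W V g by auto
    have FWg: "F *\<^sub>v (W *\<^sub>v g) \<in> carrier_vec p" and DVg: "Dv *\<^sub>v (V *\<^sub>v g) \<in> carrier_vec p" using F Dv Wg Vg by auto
    have Gz: "G *\<^sub>v z \<in> carrier_vec p" using G z by simp
    have Yg: "Y *\<^sub>v g = G *\<^sub>v z + F *\<^sub>v (W *\<^sub>v g) + Dv *\<^sub>v (V *\<^sub>v g)"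
    proof -
      have "Y *\<^sub>v g = (G * U + F * W) *\<^sub>v g + (Dv * V) *\<^sub>v g"
        unfolding Y using GU FW DV g by (intro add_mult_distrib_mat_vec) auto
      also have "(G * U + F * W) *\<^sub>v g = (G * U) *\<^sub>v g + (F * W) *\<^sub>v g"
        using GU FW g by (intro add_mult_distrib_mat_vec) auto
      also have "(G * U) *\<^sub>v g = G *\<^sub>v z" using assoc_mult_mat_vec[OF G U g] by (simp add: Ug)
      also have "(F * W) *\<^sub>v g = F *\<^sub>v (W *\<^sub>v g)" by (rule assoc_mult_mat_vec[OF F W g])
      also have "(Dv * V) *\<^sub>v g = Dv *\<^sub>v (V *\<^sub>v g)" by (rule assoc_mult_mat_vec[OF Dv V g])
      finally show ?thesis .
    qed
    have "(ols_estimator Y U - G) *\<^sub>v z = (Y * P) *\<^sub>v z - G *\<^sub>v z"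
      unfolding ols_estimator_def P_def[symmetric] using Yc P G z by (intro minus_mult_distrib_mat_vec) auto
    also have "(Y * P) *\<^sub>v z = Y *\<^sub>v g" unfolding g_def by (rule assoc_mult_mat_vec[OF Yc P z])
    also have "Y *\<^sub>v g - G *\<^sub>v z = F *\<^sub>v (W *\<^sub>v g) + Dv *\<^sub>v (V *\<^sub>v g)"
    proof -
      have "(a + b + c) - a = b + c" if "a \<in> carrier_vec p" "b \<in> carrier_vec p" "c \<in> carrier_vec p" for a b c :: "real vec"
        using that by (intro eq_vecI) auto
      then show ?thesis unfolding Yg using Gz FWg DVg by blast
    qed
    finally have "vnorm ((ols_estimator Y U - G) *\<^sub>v z) \<le> vnorm (F *\<^sub>v (W *\<^sub>v g)) + vnorm (Dv *\<^sub>v (V *\<^sub>v g))"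
      using vnorm_triangle[OF FWg DVg] by simp
    also have "\<dots> \<le> spectral_norm F * (\<alpha> * vnorm g) + spectral_norm Dv * (\<beta> * vnorm g)"
    proof (intro add_mono)
      have "vnorm (F *\<^sub>v (W *\<^sub>v g)) \<le> spectral_norm F * vnorm (W *\<^sub>v g)" by (rule spectral_norm_cases(3)[OF F pos(2) Wg])
      also have "\<dots> \<le> spectral_norm F * (\<alpha> * vnorm g)" using bw[OF y] nF by (intro mult_left_mono) (simp_all add: gy)
      finally show "vnorm (F *\<^sub>v (W *\<^sub>v g)) \<le> spectral_norm F * (\<alpha> * vnorm g)" .
      have "vnorm (Dv *\<^sub>v (V *\<^sub>v g)) \<le> spectral_norm Dv * vnorm (V *\<^sub>v g)" by (rule spectral_norm_cases(3)[OF Dv pos(3) Vg])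
      also have "\<dots> \<le> spectral_norm Dv * (\<beta> * vnorm g)" using bv[OF y] nD by (intro mult_left_mono) (simp_all add: gy)
      finally show "vnorm (Dv *\<^sub>v (V *\<^sub>v g)) \<le> spectral_norm Dv * (\<beta> * vnorm g)" .
    qed
    also have "\<dots> = (spectral_norm F * \<alpha> + spectral_norm Dv * \<beta>) / \<kappa> * (\<kappa> * vnorm g)"
      using \<kappa> by (simp add: field_simps)
    also have "\<dots> \<le> (spectral_norm F * \<alpha> + spectral_norm Dv * \<beta>) / \<kappa> * vnorm z"
      using gz nF nD nn \<kappa> by (intro mult_left_mono) auto
    finally show "vnorm ((ols_estimator Y U - G) *\<^sub>v z) \<le> (spectral_norm F * \<alpha> + spectral_norm Dv * \<beta>) / \<kappa> * vnorm z" .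
  qed
qed

section \<open>Noise and input estimates for the Toeplitz data\<close>

lemma measurable_mat_const: "B \<in> carrier_mat nr nc \<Longrightarrow> measurable_mat M nr nc (\<lambda>_. B)"
  by (simp add: measurable_mat_def)

lemma measurable_mat_add:
  assumes "measurable_mat M nr nc A" "measurable_mat M nr nc B"
  shows "measurable_mat M nr nc (\<lambda>\<omega>. A \<omega> + B \<omega>)"
  using assms
  by (intro measurable_matI[where f = "\<lambda>i j \<omega>. A \<omega> $$ (i, j) + B \<omega> $$ (i, j)"])
     (auto simp: measurable_mat_def intro!: borel_measurable_add)

lemma measurable_mat_cong:
  assumes "measurable_mat M nr nc B" "\<And>\<omega>. \<omega> \<in> space M \<Longrightarrow> A \<omega> = B \<omega>"
  shows "measurable_mat M nr nc A"
  using assms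
  by (intro measurable_matI[where f = "\<lambda>i j \<omega>. B \<omega> $$ (i, j)"]) (auto simp: measurable_mat_def)

text \<open>The net costs less than 81 = exp (2 ln 9) per dimension, while 16 * 128/625 is above 3.
  So the term \<open>ln 9\<close> pays for the net and the term \<open>L\<close> leaves at least exp
  (- L).\<close>

lemma noise_exponent_bound:
  assumes L: "L \<ge> 0" and n: "real n \<le> R" and R: "R \<ge> 1"
  shows "(9 * (5/4) ^ 5) ^ n * exp (- (128/625) * (16 * R * (ln 9 + L))) \<le> exp (- L)"
proof -
  have "(9 * (5/4) ^ 5 :: real) \<le> 81" by (simp add: power_divide)
  also have "(81 :: real) = exp (2 * ln 9)"
  proof -
    have "exp (real 2 * ln 9) = exp (ln (9::real)) ^ 2" by (rule exp_of_nat_mult)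
    then show ?thesis by simp
  qed
  finally have "(9 * (5/4) ^ 5 :: real) ^ n \<le> exp (2 * ln 9) ^ n" by (intro power_mono) auto
  also have "\<dots> = exp (real n * (2 * ln 9))" by (rule exp_of_nat_mult[symmetric])
  also have "\<dots> \<le> exp (R * (2 * ln 9))" using n by simp
  finally have "(9 * (5/4) ^ 5) ^ n * exp (- (128/625) * (16 * R * (ln 9 + L))) \<le>
      exp (R * (2 * ln 9)) * exp (- (128/625) * (16 * R * (ln 9 + L)))"
    by (intro mult_right_mono) auto
  also have "\<dots> = exp (R * (2 * ln 9) + - (128/625) * (16 * R * (ln 9 + L)))" by (rule exp_add[symmetric])
  also have "\<dots> \<le> exp (- L)"
  proof -
    have "0 \<le> R * ln 9" using R by simp
    moreover have "1 * L \<le> R * L" using R L by (intro mult_right_mono)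
    ultimately show ?thesis using L by (simp add: algebra_simps)
  qed
  finally show ?thesis .
qed

text \<open>Row \<open>b\<close> and column \<open>(i, t)\<close> of the data matrix \<open>U\<close>, read off the coordinates \<open>g\<close> of the inputs.\<close>
definition toeplitz_entry :: "nat \<Rightarrow> nat \<Rightarrow> nat \<times> nat \<Rightarrow> ((nat \<times> nat) \<times> nat \<Rightarrow> real) \<Rightarrow> real" where
  "toeplitz_entry m b j g = (if b div m \<le> snd j then g ((fst j, snd j - b div m), b mod m) else 0)"

lemma ln_27_eq:
  assumes "T \<ge> 1" "\<delta> > 0"
  shows "ln (27 * real T / \<delta>) = ln 9 + ln (3 * real T / \<delta>)"
proof -
  have "27 * real T / \<delta> = 9 * (3 * real T / \<delta>)" by simp
  moreover have "3 * real T / \<delta> > 0" using assms by simp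
  ultimately show ?thesis by (simp only: ln_mult_pos zero_less_numeral)
qed

text \<open>The shift \<open>a\<close> selects block row \<open>a\<close> of the process noise; the
  measurement noise is the case a = 0. Noise at time t is paired with column t + a of the same
  rollout, and times with t + a \<ge> T drop out.\<close>

lemma (in prob_space) shifted_noise_bound:
  fixes u \<xi> :: "'a \<Rightarrow> (nat \<times> nat) \<times> nat \<Rightarrow> real"
  assumes I: "I = {1..N} \<times> {..<T}" and r: "r \<ge> 1" and m: "m \<ge> 1" and T: "T \<ge> 1"
    and ind: "indep_var (PiM (I \<times> {..<m}) (\<lambda>_. borel)) u (PiM (I \<times> {..<r}) (\<lambda>_. borel)) \<xi>"
    and law: "distr M (PiM (I \<times> {..<r}) (\<lambda>_. borel)) \<xi> = PiM (I \<times> {..<r}) (\<lambda>_. centered_normal \<sigma>)"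
    and \<sigma>: "\<sigma> \<ge> 0" and \<delta>: "0 < \<delta>" "\<delta> < 1"
  shows "\<exists>E\<in>events. prob E \<le> \<delta> / (3 * real T) \<and> (\<forall>\<omega>\<in>space M - E. \<forall>y.
    L2_set (\<lambda>k. \<Sum>j\<in>{j \<in> I. snd j + a < T}. (\<Sum>b<m * T. y b * toeplitz_entry m b (fst j, snd j + a) (u \<omega>)) * \<xi> \<omega> (j, k)) {..<r}
      \<le> \<sigma> * (4 * sqrt (real T * (real m + real r) * ln (27 * real T / \<delta>)))
         * L2_set (\<lambda>j. \<Sum>b<m * T. y b * toeplitz_entry m b j (u \<omega>)) I)"
proof -
  define L where "L = ln (3 * real T / \<delta>)"
  define R where "R = real T * (real m + real r)"
  define s where "s = 4 * sqrt (R * ln (27 * real T / \<delta>))"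
  define K where "K = {j \<in> I. snd j + a < T}"
  define \<rho> where "\<rho> j = (fst j, snd j + a)" for j :: "nat \<times> nat"
  have "3 * real T / \<delta> \<ge> 3" using T \<delta> by (simp add: field_simps)
  then have L: "L \<ge> 0" and eL: "exp (- L) = \<delta> / (3 * real T)" using \<delta> T by (simp_all add: L_def exp_minus)
  have lg: "ln (27 * real T / \<delta>) = ln 9 + L" unfolding L_def by (rule ln_27_eq[OF T \<delta>(1)])
  have lg0: "ln (27 * real T / \<delta>) \<ge> 0" using L by (simp add: lg)
  have R1: "R \<ge> 1" unfolding R_def using T m mult_mono[of 1 "real T" 1 "real m + real r"] by simp
  have s2: "s\<^sup>2 = 16 * R * (ln 9 + L)" using R1 lg0 by (simp add: s_def power_mult_distrib lg)
  \<comment> \<open>The two nets have dimensions r and m T; the larger T (m + r) gives the form of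
    the final constants.\<close>
  have nR: "real (r + m * T) \<le> R"
    using T mult_right_mono[of 1 "real T" "real r"] by (simp add: R_def algebra_simps)
  have f: "toeplitz_entry m b j \<in> borel_measurable (PiM (I \<times> {..<m}) (\<lambda>_. borel))" if "b < m * T" "j \<in> I" for b j
  proof (cases "b div m \<le> snd j")
    case True
    then have eq: "toeplitz_entry m b j = (\<lambda>g. g ((fst j, snd j - b div m), b mod m))"
      by (simp add: toeplitz_entry_def fun_eq_iff)
    have mem: "((fst j, snd j - b div m), b mod m) \<in> I \<times> {..<m}" using that m by (auto simp: I)
    show ?thesis unfolding eq by (rule measurable_component_singleton[OF mem])
  next
    case False
    then have "toeplitz_entry m b j = (\<lambda>g. 0)" by (simp add: toeplitz_entry_def fun_eq_iff)
    then show ?thesis by simp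
  qed
  have fin: "finite I" by (simp add: I)
  have d: "m * T \<ge> 1" using m T by simp
  have s0: "s \<ge> 0" using R1 lg0 by (simp add: s_def)
  have \<rho>: "inj_on \<rho> K" "K \<subseteq> I" "\<rho> ` K \<subseteq> I"
    by (auto simp: \<rho>_def K_def inj_on_def I)
  obtain E where E: "E \<in> events" "prob E \<le> (9 * (5/4) ^ 5) ^ (r + m * T) * exp (- (128/625) * s\<^sup>2)"
    and bound: "\<And>\<omega> x y. \<omega> \<in> space M - E \<Longrightarrow>
      (\<Sum>k<r. x k * (\<Sum>j\<in>K. (\<Sum>b<m * T. y b * toeplitz_entry m b (\<rho> j) (u \<omega>)) * \<xi> \<omega> (j, k)))
        \<le> L2_set x {..<r} * L2_set (\<lambda>i. \<Sum>b<m * T. y b * toeplitz_entry m b i (u \<omega>)) I * (\<sigma> * s)"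
    using noise_uniform_bound[where f = "\<lambda>b j. toeplitz_entry m b j", OF fin fin r d f ind law \<sigma> s0 \<rho>] by blast
  show ?thesis
  proof (rule bexI[of _ E], rule conjI)
    show "E \<in> events" by fact
    have "prob E \<le> exp (- L)"
      using E(2) noise_exponent_bound[OF L nR R1] unfolding s2 by linarith
    then show "prob E \<le> \<delta> / (3 * real T)" by (simp only: eL)
    show "\<forall>\<omega>\<in>space M - E. \<forall>y.
      L2_set (\<lambda>k. \<Sum>j\<in>{j \<in> I. snd j + a < T}. (\<Sum>b<m * T. y b * toeplitz_entry m b (fst j, snd j + a) (u \<omega>)) * \<xi> \<omega> (j, k)) {..<r}
      \<le> \<sigma> * (4 * sqrt (real T * (real m + real r) * ln (27 * real T / \<delta>)))
         * L2_set (\<lambda>j. \<Sum>b<m * T. y b * toeplitz_entry m b j (u \<omega>)) I"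
    proof (intro ballI allI)
      fix \<omega> y assume \<omega>: "\<omega> \<in> space M - E"
      \<comment> \<open>Duality: the noise vector is tested against itself, which turns the bilinear
        bound into a bound for its norm.\<close>
      define x where "x k = (\<Sum>j\<in>K. (\<Sum>b<m * T. y b * toeplitz_entry m b (\<rho> j) (u \<omega>)) * \<xi> \<omega> (j, k))" for k
      define g where "g = L2_set (\<lambda>j. \<Sum>b<m * T. y b * toeplitz_entry m b j (u \<omega>)) I"
      have "(L2_set x {..<r})\<^sup>2 = (\<Sum>k<r. x k * x k)"
        unfolding L2_set_power2 by (simp add: power2_eq_square)
      also have "\<dots> \<le> L2_set x {..<r} * g * (\<sigma> * s)" using bound[OF \<omega>, of x y] unfolding x_def[symmetric] g_def .
      finally have "L2_set x {..<r} * L2_set x {..<r} \<le> L2_set x {..<r} * (\<sigma> * s * g)" by (simp add: power2_eq_square mult_ac)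
      moreover have "\<sigma> * s * g \<ge> 0" using \<sigma> s0 by (simp add: g_def)
      ultimately have "L2_set x {..<r} \<le> \<sigma> * s * g"
        using L2_set_nonneg[of x "{..<r}"] by (cases "L2_set x {..<r} = 0") (auto simp: order_less_le)
      then show "L2_set (\<lambda>k. \<Sum>j\<in>{j \<in> I. snd j + a < T}. (\<Sum>b<m * T. y b * toeplitz_entry m b (fst j, snd j + a) (u \<omega>)) * \<xi> \<omega> (j, k)) {..<r}
        \<le> \<sigma> * (4 * sqrt (real T * (real m + real r) * ln (27 * real T / \<delta>)))
         * L2_set (\<lambda>j. \<Sum>b<m * T. y b * toeplitz_entry m b j (u \<omega>)) I"
        unfolding x_def[abs_def] g_def s_def R_def K_def \<rho>_def .
    qed
  qed
qed

text \<open>The last column of each block of \<open>U\<close> already consists of independent inputs, and the columns of different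
  rollouts are independent.\<close>
lemma (in prob_space) toeplitz_lower_bound:
  fixes u :: "'a \<Rightarrow> (nat \<times> nat) \<times> nat \<Rightarrow> real"
  assumes I: "I = {1..N} \<times> {..<T}" and m: "m \<ge> 1" and T: "T \<ge> 1" and \<sigma>: "\<sigma> > 0"
    and ind: "indep_vars (\<lambda>_. borel) (\<lambda>p \<omega>. u \<omega> p) (I \<times> {..<m})"
    and law: "\<And>p. p \<in> I \<times> {..<m} \<Longrightarrow> distr M borel (\<lambda>\<omega>. u \<omega> p) = centered_normal \<sigma>"
    and L: "L \<ge> 0" and N: "real N \<ge> 8 * real (m * T) + 28 * L"
  shows "\<exists>E\<in>events. prob E \<le> 2 * exp (- 2 * L) \<and> (\<forall>\<omega>\<in>space M - E. \<forall>y.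
    real N / 16 * \<sigma>\<^sup>2 * (\<Sum>b<m * T. (y b)\<^sup>2) \<le> (\<Sum>j\<in>I. (\<Sum>b<m * T. y b * toeplitz_entry m b j (u \<omega>))\<^sup>2))"
proof -
  \<comment> \<open>Row \<open>b\<close> of the last column, at time T - 1, holds coordinate b mod m
    of the input at time T - 1 - b div m. Distinct rows hold distinct inputs, which gives
    independence.\<close>
  define h where "h = (\<lambda>(i, b). ((i :: nat, T - 1 - b div m), b mod m))"
  have dm: "b div m < T" if "b < m * T" for b
    using that m by (simp add: less_mult_imp_div_less mult.commute)
  have hI: "h ` ({1..N} \<times> {..<m * T}) \<subseteq> I \<times> {..<m}"
    using m T by (auto simp: h_def I)
  have inj: "inj_on h ({1..N} \<times> {..<m * T})"
  proof (rule inj_onI)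
    fix p p' assume p: "p \<in> {1..N} \<times> {..<m * T}" "p' \<in> {1..N} \<times> {..<m * T}" and eq: "h p = h p'"
    obtain i b i' b' where pb: "p = (i, b)" "p' = (i', b')" by (cases p, cases p') auto
    have "b div m < T" "b' div m < T" using p dm by (auto simp: pb)
    moreover have "i = i'" "T - 1 - b div m = T - 1 - b' div m" "b mod m = b' mod m" using eq by (auto simp: h_def pb)
    ultimately have "b div m = b' div m" "b mod m = b' mod m" by linarith+
    then have "b = b'" by (metis div_mult_mod_eq)
    then show "p = p'" using \<open>i = i'\<close> by (simp add: pb)
  qed
  have ind': "indep_vars (\<lambda>_. borel) (\<lambda>q \<omega>. u \<omega> (h q)) ({1..N} \<times> {..<m * T})"
    by (rule indep_vars_reindex[OF indep_vars_subset[OF ind hI] inj])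
  have d: "m * T \<ge> 1" using m T by simp
  have law': "distr M borel (\<lambda>\<omega>. u \<omega> (h q)) = centered_normal \<sigma>" if "q \<in> {1..N} \<times> {..<m * T}" for q
    by (rule law) (use hI that in blast)
  obtain E where E: "E \<in> events" "prob E \<le> 2 * exp (- 2 * L)"
    and low: "\<And>\<omega> v. \<omega> \<in> space M - E \<Longrightarrow> real N / 16 * \<sigma>\<^sup>2 * (\<Sum>b<m * T. (v b)\<^sup>2)
      \<le> (\<Sum>i\<in>{1..N}. (\<Sum>b<m * T. v b * u \<omega> (h (i, b)))\<^sup>2)"
    using gaussian_smallest_singular_value[where Z = "\<lambda>q \<omega>. u \<omega> (h q)" and I = "{1..N}" and N = N and d = "m * T" and L = L,
        OF _ _ d \<sigma> ind' law' L N] by auto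
  show ?thesis
  proof (rule bexI[of _ E], intro conjI ballI allI)
    show "E \<in> events" "prob E \<le> 2 * exp (- 2 * L)" by fact+
    fix \<omega> y assume \<omega>: "\<omega> \<in> space M - E"
    let ?g = "\<lambda>j. \<Sum>b<m * T. y b * toeplitz_entry m b j (u \<omega>)"
    have "u \<omega> (h (i, b)) = toeplitz_entry m b (i, T - 1) (u \<omega>)" if "b < m * T" for i b
      using dm[OF that] by (simp add: h_def toeplitz_entry_def)
    then have "(\<Sum>i\<in>{1..N}. (\<Sum>b<m * T. y b * u \<omega> (h (i, b)))\<^sup>2) = (\<Sum>i\<in>{1..N}. (?g (i, T - 1))\<^sup>2)"
      by (intro sum.cong arg_cong[of _ _ "\<lambda>x. x\<^sup>2"]) auto
    also have "\<dots> = (\<Sum>j\<in>(\<lambda>i. (i, T - 1)) ` {1..N}. (?g j)\<^sup>2)"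
      by (subst sum.reindex) (auto simp: inj_on_def)
    also have "\<dots> \<le> (\<Sum>j\<in>I. (?g j)\<^sup>2)" using T by (intro sum_mono2) (auto simp: I)
    finally show "real N / 16 * \<sigma>\<^sup>2 * (\<Sum>b<m * T. (y b)\<^sup>2) \<le> (\<Sum>j\<in>I. (?g j)\<^sup>2)"
      using low[OF \<omega>, of y] by linarith
  qed
qed

section \<open>From vectors and data matrices to coordinates\<close>

lemma iid_normal_vecs_carrier:
  assumes "prob_space M" "iid_normal_vecs M d \<sigma> I X" "j \<in> I" "\<omega> \<in> space M"
  shows "X j \<omega> \<in> carrier_vec d"
proof -
  interpret prob_space M by fact
  have "X j \<in> measurable M (vec_borel d)"
    using assms(2,3) by (auto simp: iid_normal_vecs_def indep_vars_def)
  from measurable_space[OF this assms(4)] show ?thesis by simp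
qed

lemma indep_families_coordinates:
  fixes M :: "'a measure" and X X' :: "'i \<Rightarrow> 'a \<Rightarrow> real vec"
  assumes "prob_space M" and ind: "indep_families M I d X d' X'"
  shows "prob_space.indep_var M
    (PiM (I \<times> {..<d}) (\<lambda>_. borel)) (\<lambda>\<omega>. \<lambda>p\<in>I \<times> {..<d}. X (fst p) \<omega> $ snd p)
    (PiM (I \<times> {..<d'}) (\<lambda>_. borel)) (\<lambda>\<omega>. \<lambda>p\<in>I \<times> {..<d'}. X' (fst p) \<omega> $ snd p)"
proof -
  interpret prob_space M by fact
  define \<Phi> where "\<Phi> d f = (\<lambda>p\<in>I \<times> {..<d}. (f (fst p) :: real vec) $ snd p)" for d :: nat and f
  have \<Phi>: "\<Phi> d \<in> measurable (PiM I (\<lambda>_. vec_borel d)) (PiM (I \<times> {..<d}) (\<lambda>_. borel))" for d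
    unfolding \<Phi>_def
  proof (rule measurable_restrict)
    fix p assume "p \<in> I \<times> {..<d}"
    then have p: "fst p \<in> I" "snd p < d" by auto
    show "(\<lambda>f. f (fst p) $ snd p) \<in> borel_measurable (PiM I (\<lambda>_. vec_borel d))"
      using measurable_component_singleton[OF p(1)] measurable_vec_borel_index[OF p(2)]
      by (rule measurable_compose)
  qed
  have "\<Phi> d \<circ> (\<lambda>\<omega>. \<lambda>j\<in>I. X j \<omega>) = (\<lambda>\<omega>. \<lambda>p\<in>I \<times> {..<d}. X (fst p) \<omega> $ snd p)" for d and X :: "'i \<Rightarrow> 'a \<Rightarrow> real vec"
    by (intro ext) (auto simp: \<Phi>_def restrict_def)
  then show ?thesis
    using indep_var_compose[OF ind[unfolded indep_families_def] \<Phi> \<Phi>] by simp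
qed

lemma hconcat_mult_vec:
  assumes T: "T > 0" and X: "\<And>i. i \<in> {1..N} \<Longrightarrow> X i \<in> carrier_mat r T" and k: "k < r"
  shows "(hconcat r T N X *\<^sub>v vec (N * T) (\<lambda>c. g (c div T + 1, c mod T))) $ k
    = (\<Sum>j\<in>{1..N} \<times> {..<T}. X (fst j) $$ (k, snd j) * g j)"
proof -
  have "(hconcat r T N X *\<^sub>v vec (N * T) (\<lambda>c. g (c div T + 1, c mod T))) $ k
    = (\<Sum>c<N * T. (\<lambda>j. X (fst j) $$ (k, snd j) * g j) (c div T + 1, c mod T))"
    using k by (simp add: hconcat_def scalar_prod_def atLeast0LessThan)
  also have "\<dots> = (\<Sum>j\<in>{1..N} \<times> {..<T}. X (fst j) $$ (k, snd j) * g j)"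
    by (rule sum_hconcat_columns[OF T])
  finally show ?thesis .
qed

lemma hconcat_transpose_mult_vec:
  assumes T: "T > 0" and y: "y \<in> carrier_vec r"
  shows "transpose_mat (hconcat r T N X) *\<^sub>v y
    = vec (N * T) (\<lambda>c. \<Sum>b<r. y $ b * X (c div T + 1) $$ (b, c mod T))"
  using y by (intro eq_vecI) (auto simp: hconcat_def scalar_prod_def atLeast0LessThan mult.commute)

lemma vnorm_hconcat_vec:
  assumes "T > 0"
  shows "vnorm (vec (N * T) (\<lambda>c. g (c div T + 1, c mod T))) = L2_set g ({1..N} \<times> {..<T})"
proof -
  have "vnorm (vec (N * T) (\<lambda>c. g (c div T + 1, c mod T))) = sqrt (\<Sum>c<N * T. (\<lambda>j. (g j)\<^sup>2) (c div T + 1, c mod T))"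
    by (simp add: vnorm_L2_set[of _ "N * T"] L2_set_def)
  also have "(\<Sum>c<N * T. (\<lambda>j. (g j)\<^sup>2) (c div T + 1, c mod T)) = (\<Sum>j\<in>{1..N} \<times> {..<T}. (g j)\<^sup>2)"
    by (rule sum_hconcat_columns[OF assms])
  finally show ?thesis by (simp add: L2_set_def)
qed

text \<open>The estimates produce the factor 4 / (1/4) = 16. For the measurement noise 16 = 8 sqrt 4
  and 4 T \<le> 2 T (T + 1), as T \<ge> 1; for the process noise T^2 \<le> 2 (T^3/3 + T^2/2 + T/6),
  where T^2 is one of the terms on the right.\<close>

lemma error_constants_le:
  assumes T: "T \<ge> 1" and N: "N \<ge> 1" and lg: "lg \<ge> 0" and \<sigma>: "\<sigma>\<^sub>u > 0" "\<sigma>\<^sub>w \<ge> 0" "\<sigma>\<^sub>v \<ge> 0"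
    and nn: "f \<ge> 0" "e \<ge> 0"
  shows "(f * (sqrt (real T) * (\<sigma>\<^sub>w * (4 * sqrt (real T * (real m + real q) * lg)))) +
      e * (\<sigma>\<^sub>v * (4 * sqrt (real T * (real m + real l) * lg)))) / (sqrt (real N) / 4 * \<sigma>\<^sub>u)
    \<le> (\<sigma>\<^sub>v * (8 * e * sqrt (2 * real T * (real T + 1) * (real m + real l) * lg)) +
       \<sigma>\<^sub>w * (16 * f * sqrt ((real T ^ 3 / 3 + real T ^ 2 / 2 + real T / 6) * 2 * (real m + real q) * lg)))
      / \<sigma>\<^sub>u * sqrt (1 / real N)"
proof -
  let ?P = "(real m + real l) * lg" and ?Q = "(real m + real q) * lg"
  have PQ: "?P \<ge> 0" "?Q \<ge> 0" using lg by simp_all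
  have T1: "real T \<ge> 1" using T by simp
  have "16 * sqrt (real T * (real m + real l) * lg) = 8 * sqrt (4 * (real T * ?P))"
    by (simp add: real_sqrt_mult mult.assoc)
  also have "\<dots> \<le> 8 * sqrt (2 * real T * (real T + 1) * (real m + real l) * lg)"
  proof -
    have "4 * real T \<le> 2 * real T * (real T + 1)" using T1 mult_left_mono[of 1 "real T" "real T"] by (simp add: algebra_simps)
    then have "4 * real T * ?P \<le> 2 * real T * (real T + 1) * ?P" using PQ by (intro mult_right_mono)
    then show ?thesis by (simp add: mult.assoc)
  qed
  finally have e1: "16 * sqrt (real T * (real m + real l) * lg) \<le> 8 * sqrt (2 * real T * (real T + 1) * (real m + real l) * lg)" .
  have "16 * (sqrt (real T) * sqrt (real T * (real m + real q) * lg)) = 16 * sqrt ((real T)\<^sup>2 * ?Q)"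
    by (simp add: real_sqrt_mult power2_eq_square mult.assoc)
  also have "\<dots> \<le> 16 * sqrt ((real T ^ 3 / 3 + real T ^ 2 / 2 + real T / 6) * 2 * (real m + real q) * lg)"
  proof -
    have "(real T)\<^sup>2 \<le> (real T ^ 3 / 3 + real T ^ 2 / 2 + real T / 6) * 2" by simp
    then have "(real T)\<^sup>2 * ?Q \<le> (real T ^ 3 / 3 + real T ^ 2 / 2 + real T / 6) * 2 * ?Q"
      using PQ by (intro mult_right_mono)
    then show ?thesis by (simp add: mult.assoc)
  qed
  finally have e2: "16 * (sqrt (real T) * sqrt (real T * (real m + real q) * lg))
    \<le> 16 * sqrt ((real T ^ 3 / 3 + real T ^ 2 / 2 + real T / 6) * 2 * (real m + real q) * lg)" .
  have "(f * (sqrt (real T) * (\<sigma>\<^sub>w * (4 * sqrt (real T * (real m + real q) * lg)))) +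
      e * (\<sigma>\<^sub>v * (4 * sqrt (real T * (real m + real l) * lg)))) / (sqrt (real N) / 4 * \<sigma>\<^sub>u)
    = (\<sigma>\<^sub>v * e * (16 * sqrt (real T * (real m + real l) * lg)) +
       \<sigma>\<^sub>w * f * (16 * (sqrt (real T) * sqrt (real T * (real m + real q) * lg)))) / (\<sigma>\<^sub>u * sqrt (real N))"
    using N \<sigma>(1) by (simp add: field_simps)
  also have "\<dots> \<le> (\<sigma>\<^sub>v * e * (8 * sqrt (2 * real T * (real T + 1) * (real m + real l) * lg)) +
       \<sigma>\<^sub>w * f * (16 * sqrt ((real T ^ 3 / 3 + real T ^ 2 / 2 + real T / 6) * 2 * (real m + real q) * lg))) / (\<sigma>\<^sub>u * sqrt (real N))"
    using \<sigma> nn by (intro divide_right_mono add_mono mult_left_mono e1 e2) auto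
  also have "\<dots> = (\<sigma>\<^sub>v * (8 * e * sqrt (2 * real T * (real T + 1) * (real m + real l) * lg)) +
       \<sigma>\<^sub>w * (16 * f * sqrt ((real T ^ 3 / 3 + real T ^ 2 / 2 + real T / 6) * 2 * (real m + real q) * lg)))
      / \<sigma>\<^sub>u * sqrt (1 / real N)"
    by (simp add: real_sqrt_divide mult_ac)
  finally show ?thesis .
qed

text \<open>The substitution t = s + a in block row \<open>a\<close> leaves the unshifted noise at
  time \<open>s\<close> against the shifted vector \<open>g\<close>. The T blocks, each of norm at
  most \<open>b\<close>, add up in squares, which is the origin of the factor sqrt T.\<close>

lemma toeplitz_input_mult_norm:
  fixes w :: "nat \<Rightarrow> nat \<Rightarrow> real vec"
  assumes T: "T > 0" and q: "q > 0" and I: "I = {1..N} \<times> {..<T}" and b: "b \<ge> 0"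
    and bound: "\<And>a. a < T \<Longrightarrow> L2_set (\<lambda>k. \<Sum>j\<in>{j \<in> I. snd j + a < T}. g (fst j, snd j + a) * w (fst j) (snd j) $ k) {..<q} \<le> b"
  shows "vnorm (hconcat (q * T) T N (\<lambda>i. toeplitz_input q T (w i)) *\<^sub>v vec (N * T) (\<lambda>c. g (c div T + 1, c mod T)))
    \<le> sqrt (real T) * b"
proof -
  let ?W = "hconcat (q * T) T N (\<lambda>i. toeplitz_input q T (w i))" and ?g = "vec (N * T) (\<lambda>c. g (c div T + 1, c mod T))"
  define h where "h a k = (\<Sum>j\<in>{j \<in> I. snd j + a < T}. g (fst j, snd j + a) * w (fst j) (snd j) $ k)" for a k
  have ent: "(?W *\<^sub>v ?g) $ c = h (c div q) (c mod q)" if c: "c < q * T" for c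
  proof -
    let ?a = "c div q"
    have "(?W *\<^sub>v ?g) $ c = (\<Sum>j\<in>I. toeplitz_input q T (w (fst j)) $$ (c, snd j) * g j)"
      unfolding I using c T by (intro hconcat_mult_vec) (auto simp: toeplitz_input_def)
    also have "\<dots> = (\<Sum>j\<in>I. if ?a \<le> snd j then w (fst j) (snd j - ?a) $ (c mod q) * g j else 0)"
      using c by (intro sum.cong refl) (auto simp: toeplitz_input_def I Let_def)
    also have "\<dots> = (\<Sum>j\<in>{j \<in> I. ?a \<le> snd j}. w (fst j) (snd j - ?a) $ (c mod q) * g j)"
      by (rule sum.inter_filter[symmetric]) (simp add: I)
    also have "\<dots> = h ?a (c mod q)"
      unfolding h_def
      by (rule sum.reindex_bij_witness[of _ "\<lambda>j. (fst j, snd j + ?a)" "\<lambda>j. (fst j, snd j - ?a)"])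
         (auto simp: I mult.commute)
    finally show ?thesis .
  qed
  have "(vnorm (?W *\<^sub>v ?g))\<^sup>2 = (\<Sum>c<q * T. ((?W *\<^sub>v ?g) $ c)\<^sup>2)"
  proof -
    have "?W *\<^sub>v ?g \<in> carrier_vec (q * T)" by (intro carrier_vecI) (simp add: hconcat_def)
    then show ?thesis by (simp add: vnorm_L2_set L2_set_power2)
  qed
  also have "\<dots> = (\<Sum>c<q * T. (h (c div q) (c mod q))\<^sup>2)" by (intro sum.cong refl) (simp only: lessThan_iff ent)
  also have "\<dots> = (\<Sum>a<T. \<Sum>k<q. (h a k)\<^sup>2)" by (rule sum_div_mod[OF q])
  also have "\<dots> = (\<Sum>a<T. (L2_set (h a) {..<q})\<^sup>2)" by (simp only: L2_set_power2)
  also have "\<dots> \<le> (\<Sum>a<T. b\<^sup>2)"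
    using bound unfolding h_def[symmetric] by (intro sum_mono power_mono) auto
  also have "\<dots> = (sqrt (real T) * b)\<^sup>2" by (simp add: power_mult_distrib)
  finally show ?thesis by (rule power2_le_imp_le) (simp add: b)
qed

lemma output_row_mult_norm:
  fixes v :: "nat \<Rightarrow> nat \<Rightarrow> real vec"
  assumes T: "T > 0" and I: "I = {1..N} \<times> {..<T}"
  shows "vnorm (hconcat l T N (\<lambda>i. output_row l T (v i)) *\<^sub>v vec (N * T) (\<lambda>c. g (c div T + 1, c mod T)))
    = L2_set (\<lambda>k. \<Sum>j\<in>I. g j * v (fst j) (snd j) $ k) {..<l}"
proof -
  let ?V = "hconcat l T N (\<lambda>i. output_row l T (v i))" and ?g = "vec (N * T) (\<lambda>c. g (c div T + 1, c mod T))"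
  have ent: "(?V *\<^sub>v ?g) $ k = (\<Sum>j\<in>I. g j * v (fst j) (snd j) $ k)" if k: "k < l" for k
  proof -
    have "(?V *\<^sub>v ?g) $ k = (\<Sum>j\<in>I. output_row l T (v (fst j)) $$ (k, snd j) * g j)"
      unfolding I using k T by (intro hconcat_mult_vec) (auto simp: output_row_def)
    also have "\<dots> = (\<Sum>j\<in>I. g j * v (fst j) (snd j) $ k)"
      using k by (intro sum.cong refl) (auto simp: output_row_def I mult.commute)
    finally show ?thesis .
  qed
  have "?V *\<^sub>v ?g \<in> carrier_vec l" by (intro carrier_vecI) (simp add: hconcat_def)
  then have "vnorm (?V *\<^sub>v ?g) = L2_set (\<lambda>k. (?V *\<^sub>v ?g) $ k) {..<l}" by (rule vnorm_L2_set)
  also have "\<dots> = L2_set (\<lambda>k. \<Sum>j\<in>I. g j * v (fst j) (snd j) $ k) {..<l}"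
    by (intro L2_set_cong refl) (simp only: lessThan_iff ent)
  finally show ?thesis .
qed

lemma data_matrix_decomposition:
  assumes I: "I = {1..N} \<times> {..<T}" and T: "T > 0" and m: "m > 0" and q: "q > 0"
    and A: "A \<in> carrier_mat n n" and B: "B \<in> carrier_mat n m" and Bw: "Bw \<in> carrier_mat n q"
    and C: "C \<in> carrier_mat p n" and D: "D \<in> carrier_mat p m" and Dv: "Dv \<in> carrier_mat p l"
    and x0: "\<And>i. i \<in> {1..N} \<Longrightarrow> x i 0 = 0\<^sub>v n"
    and xs: "\<And>i t. i \<in> {1..N} \<Longrightarrow> t < T \<Longrightarrow> x i (Suc t) = A *\<^sub>v x i t + B *\<^sub>v u i t + Bw *\<^sub>v w i t"
    and ys: "\<And>i t. i \<in> {1..N} \<Longrightarrow> t < T \<Longrightarrow> y i t = C *\<^sub>v x i t + D *\<^sub>v u i t + Dv *\<^sub>v v i t"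
    and u: "\<And>i t. (i, t) \<in> I \<Longrightarrow> u i t \<in> carrier_vec m"
    and w: "\<And>i t. (i, t) \<in> I \<Longrightarrow> w i t \<in> carrier_vec q"
    and v: "\<And>i t. (i, t) \<in> I \<Longrightarrow> v i t \<in> carrier_vec l"
  shows "hconcat p T N (\<lambda>i. output_row p T (y i)) =
    markov_row T A B C D * hconcat (m * T) T N (\<lambda>i. toeplitz_input m T (u i)) +
    markov_row T A Bw C (0\<^sub>m p q) * hconcat (q * T) T N (\<lambda>i. toeplitz_input q T (w i)) +
    Dv * hconcat l T N (\<lambda>i. output_row l T (v i))" (is "?Y = ?G * ?U + ?F * ?W + Dv * ?V")
proof -
  have Gc: "?G \<in> carrier_mat p (m * T)" and Fc: "?F \<in> carrier_mat p (q * T)"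
    using B Bw C by (auto simp: markov_row_def)
  have Uc: "?U \<in> carrier_mat (m * T) (N * T)" and Wc: "?W \<in> carrier_mat (q * T) (N * T)"
    and Vc: "?V \<in> carrier_mat l (N * T)" and Yc: "?Y \<in> carrier_mat p (N * T)"
    by (auto simp: hconcat_def)
  have prods: "?G * ?U \<in> carrier_mat p (N * T)" "?F * ?W \<in> carrier_mat p (N * T)" "Dv * ?V \<in> carrier_mat p (N * T)"
    using Gc Fc Uc Wc Vc Dv by auto
  have sumc: "?G * ?U + ?F * ?W + Dv * ?V \<in> carrier_mat p (N * T)"
    by (intro add_carrier_mat prods)
  have entry: "?Y $$ (r, c) = (?G * ?U) $$ (r, c) + (?F * ?W) $$ (r, c) + (Dv * ?V) $$ (r, c)"
    if r: "r < p" and c: "c < N * T" for r c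
  proof -
    define i t where "i = c div T + 1" and "t = c mod T"
    have i: "i \<in> {1..N}" and t: "t < T" unfolding i_def t_def using hconcat_column_index[OF c T] by auto
    have "?Y $$ (r, c) = y i t $ r"
      using r c T by (simp add: hconcat_def output_row_def i_def t_def)
    also have "\<dots> = (\<Sum>k<m * T. ?G $$ (r, k) * toeplitz_input m T (u i) $$ (k, t)) +
        (\<Sum>k<q * T. ?F $$ (r, k) * toeplitz_input q T (w i) $$ (k, t)) + (Dv *\<^sub>v v i t) $ r"
      by (rule output_formula[where x = "x i" and y = "y i" and u = "u i" and w = "w i" and v = "v i",
          OF A B Bw C D Dv x0[OF i] xs[OF i] ys[OF i] u w m q r t]) (use i in \<open>auto simp: I\<close>)
    also have "(\<Sum>k<m * T. ?G $$ (r, k) * toeplitz_input m T (u i) $$ (k, t)) = (?G * ?U) $$ (r, c)"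
    proof -
      have "(?G * ?U) $$ (r, c) = (\<Sum>k<m * T. ?G $$ (r, k) * ?U $$ (k, c))"
        using Gc Uc r c by (simp add: scalar_prod_def atLeast0LessThan)
      also have "\<dots> = (\<Sum>k<m * T. ?G $$ (r, k) * toeplitz_input m T (u i) $$ (k, t))"
        using c by (intro sum.cong refl) (simp add: hconcat_def i_def t_def)
      finally show ?thesis ..
    qed
    also have "(\<Sum>k<q * T. ?F $$ (r, k) * toeplitz_input q T (w i) $$ (k, t)) = (?F * ?W) $$ (r, c)"
    proof -
      have "(?F * ?W) $$ (r, c) = (\<Sum>k<q * T. ?F $$ (r, k) * ?W $$ (k, c))"
        using Fc Wc r c by (simp add: scalar_prod_def atLeast0LessThan)
      also have "\<dots> = (\<Sum>k<q * T. ?F $$ (r, k) * toeplitz_input q T (w i) $$ (k, t))"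
        using c by (intro sum.cong refl) (simp add: hconcat_def i_def t_def)
      finally show ?thesis ..
    qed
    also have "(Dv *\<^sub>v v i t) $ r = (Dv * ?V) $$ (r, c)"
    proof -
      have vc: "v i t \<in> carrier_vec l" using i t by (intro v) (simp add: I)
      have "(Dv * ?V) $$ (r, c) = (\<Sum>k<l. Dv $$ (r, k) * ?V $$ (k, c))"
        using Dv Vc r c by (simp add: scalar_prod_def atLeast0LessThan)
      also have "\<dots> = (\<Sum>k<l. Dv $$ (r, k) * v i t $ k)"
        using c t by (intro sum.cong refl) (simp add: hconcat_def output_row_def i_def t_def)
      also have "\<dots> = (Dv *\<^sub>v v i t) $ r" using vc Dv r by (simp add: scalar_prod_def atLeast0LessThan)
      finally show ?thesis ..
    qed
    finally show ?thesis .
  qed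
  show ?thesis
  proof (rule eq_matI)
    show "dim_row ?Y = dim_row (?G * ?U + ?F * ?W + Dv * ?V)" "dim_col ?Y = dim_col (?G * ?U + ?F * ?W + Dv * ?V)"
      by (simp_all only: carrier_matD[OF Yc] carrier_matD[OF sumc])
    fix r c assume "r < dim_row (?G * ?U + ?F * ?W + Dv * ?V)" "c < dim_col (?G * ?U + ?F * ?W + Dv * ?V)"
    then have rc: "r < p" "c < N * T" by (simp_all only: carrier_matD[OF sumc])
    have "(X1 + X2 + X3) $$ (r, c) = X1 $$ (r, c) + X2 $$ (r, c) + X3 $$ (r, c)"
      if "X1 \<in> carrier_mat p (N * T)" "X2 \<in> carrier_mat p (N * T)" "X3 \<in> carrier_mat p (N * T)" for X1 X2 X3 :: "real mat"
      using that rc by simp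
    from this[OF prods] show "?Y $$ (r, c) = (?G * ?U + ?F * ?W + Dv * ?V) $$ (r, c)"
      by (simp only: entry[OF rc])
  qed
qed

section \<open>Measurability of the data and the final probability estimate\<close>

lemma measurable_mat_hconcat:
  assumes T: "T > 0"
    and X: "\<And>i k t. i \<in> {1..N} \<Longrightarrow> k < r \<Longrightarrow> t < T \<Longrightarrow> (\<lambda>\<omega>. X i \<omega> $$ (k, t)) \<in> borel_measurable M"
  shows "measurable_mat M r (N * T) (\<lambda>\<omega>. hconcat r T N (\<lambda>i. X i \<omega>))"
proof (rule measurable_matI[where f = "\<lambda>k c \<omega>. X (c div T + 1) \<omega> $$ (k, c mod T)"])
  fix k c assume "k < r" "c < N * T"
  then show "(\<lambda>\<omega>. X (c div T + 1) \<omega> $$ (k, c mod T)) \<in> borel_measurable M"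
    using hconcat_column_index[OF _ T] by (intro X) auto
qed (auto simp: hconcat_def)

lemma measurable_mat_toeplitz:
  assumes T: "T > 0" and m: "m > 0"
    and u: "\<And>i t k. i \<in> {1..N} \<Longrightarrow> t < T \<Longrightarrow> k < m \<Longrightarrow> (\<lambda>\<omega>. u i t \<omega> $ k) \<in> borel_measurable M"
  shows "measurable_mat M (m * T) (N * T) (\<lambda>\<omega>. hconcat (m * T) T N (\<lambda>i. toeplitz_input m T (\<lambda>t. u i t \<omega>)))"
proof (rule measurable_mat_hconcat[OF T])
  fix i k t assume i: "i \<in> {1..N}" and k: "k < m * T" and t: "t < T"
  have "(\<lambda>\<omega>. if k div m \<le> t then u i (t - k div m) \<omega> $ (k mod m) else 0) \<in> borel_measurable M"
    using u[OF i, of "t - k div m" "k mod m"] t m by (cases "k div m \<le> t") auto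
  then show "(\<lambda>\<omega>. toeplitz_input m T (\<lambda>t. u i t \<omega>) $$ (k, t)) \<in> borel_measurable M"
    using k t by (simp add: toeplitz_input_def Let_def)
qed

text \<open>With e = \<delta> / (3 T) the T shifts cost \<delta> / 3 and the measurement noise at
  most \<delta> / 3. The input estimate has two exceptional events; the doubled exponent makes each
  e^2, so that 2 e^2 \<le> \<delta> / 3, whereas 2 e would exceed the budget for T = 1.\<close>

lemma failure_probability_le:
  assumes T: "T \<ge> 1" and \<delta>: "0 < \<delta>" "\<delta> < 1"
  shows "2 * exp (- 2 * ln (3 * real T / \<delta>)) + (real T * (\<delta> / (3 * real T)) + \<delta> / (3 * real T)) \<le> \<delta>"
proof -
  define e where "e = \<delta> / (3 * real T)"
  have e: "0 < e" "e \<le> \<delta> / 3" "real T * e = \<delta> / 3"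
    using T \<delta> by (simp_all add: e_def field_simps)
  have "exp (- 2 * ln (3 * real T / \<delta>)) = exp (- ln (3 * real T / \<delta>)) * exp (- ln (3 * real T / \<delta>))"
    by (simp flip: exp_add)
  also have "exp (- ln (3 * real T / \<delta>)) = e" using T \<delta> by (simp add: exp_minus e_def)
  also have "e * e \<le> e * (1/3)" using e \<delta> by (intro mult_left_mono) auto
  finally have "2 * exp (- 2 * ln (3 * real T / \<delta>)) \<le> \<delta> / 3" using e by linarith
  then show ?thesis unfolding e_def[symmetric] using e by linarith
qed

theorem theorem3p1:
  fixes M :: "'a measure"
    and n p m q l N T :: nat
    and A B B\<^sub>w C D D\<^sub>v :: "real mat"
    and \<sigma>\<^sub>u \<sigma>\<^sub>w \<sigma>\<^sub>v \<delta> :: real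
    and x y u w v :: "nat \<Rightarrow> nat \<Rightarrow> 'a \<Rightarrow> real vec"
    and I :: "(nat \<times> nat) set"
    and Y U :: "'a \<Rightarrow> real mat"
    and G F :: "real mat"
    and C\<^sub>1 C\<^sub>2 :: real
  defines "I \<equiv> {1..N} \<times> {..<T}"
    and "Y \<equiv> \<lambda>\<omega>. hconcat p T N (\<lambda>i. output_row p T (\<lambda>t. y i t \<omega>))"
    and "U \<equiv> \<lambda>\<omega>. hconcat (m * T) T N (\<lambda>i. toeplitz_input m T (\<lambda>t. u i t \<omega>))"
    and "G \<equiv> markov_row T A B C D"
    and "F \<equiv> markov_row T A B\<^sub>w C (0\<^sub>m p q)"
    and "C\<^sub>1 \<equiv> 8 * spectral_norm D\<^sub>v *
           sqrt (2 * real T * (real T + 1) * (real m + real l) * ln (27 * real T / \<delta>))"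
    and "C\<^sub>2 \<equiv> 16 * spectral_norm F *
           sqrt ((real T ^ 3 / 3 + real T ^ 2 / 2 + real T / 6) *
                 2 * (real m + real q) * ln (27 * real T / \<delta>))"
  assumes "prob_space M"
    and "p \<ge> 1" "m \<ge> 1" "q \<ge> 1" "l \<ge> 1" "N \<ge> 1" "T \<ge> 1"
    and "A \<in> carrier_mat n n" "B \<in> carrier_mat n m" "B\<^sub>w \<in> carrier_mat n q"
    and "C \<in> carrier_mat p n" "D \<in> carrier_mat p m" "D\<^sub>v \<in> carrier_mat p l"
    and "\<sigma>\<^sub>u > 0" "\<sigma>\<^sub>w \<ge> 0" "\<sigma>\<^sub>v \<ge> 0"
    and "\<And>i \<omega>. i \<in> {1..N} \<Longrightarrow> \<omega> \<in> space M \<Longrightarrow> x i 0 \<omega> = 0\<^sub>v n"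
    and "\<And>i t \<omega>. i \<in> {1..N} \<Longrightarrow> t < T \<Longrightarrow> \<omega> \<in> space M \<Longrightarrow>
           x i (Suc t) \<omega> = A *\<^sub>v x i t \<omega> + B *\<^sub>v u i t \<omega> + B\<^sub>w *\<^sub>v w i t \<omega>"
    and "\<And>i t \<omega>. i \<in> {1..N} \<Longrightarrow> t < T \<Longrightarrow> \<omega> \<in> space M \<Longrightarrow>
           y i t \<omega> = C *\<^sub>v x i t \<omega> + D *\<^sub>v u i t \<omega> + D\<^sub>v *\<^sub>v v i t \<omega>"
    and "iid_normal_vecs M m \<sigma>\<^sub>u I (\<lambda>(i, t). u i t)"
    and "iid_normal_vecs M q \<sigma>\<^sub>w I (\<lambda>(i, t). w i t)"
    and "iid_normal_vecs M l \<sigma>\<^sub>v I (\<lambda>(i, t). v i t)"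
    and "indep_families M I m (\<lambda>(i, t). u i t) q (\<lambda>(i, t). w i t)"
    and "indep_families M I m (\<lambda>(i, t). u i t) l (\<lambda>(i, t). v i t)"
    and "0 < \<delta>" "\<delta> < 1"
    and "real N \<ge> 8 * real m * real T + 4 * (real m + real q + real l + 4) * ln (3 * real T / \<delta>)"
  shows "measure M {\<omega> \<in> space M.
           spectral_norm (ols_estimator (Y \<omega>) (U \<omega>) - G)
             \<le> (\<sigma>\<^sub>v * C\<^sub>1 + \<sigma>\<^sub>w * C\<^sub>2) / \<sigma>\<^sub>u * sqrt (1 / real N)} \<ge> 1 - \<delta>"
proof -
  note M = assms(8) and pos = assms(9-14) and A = assms(15) and B = assms(16) and B\<^sub>w = assms(17)
    and C = assms(18) and D = assms(19) and D\<^sub>v = assms(20) and \<sigma> = assms(21-23)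
    and x0 = assms(24) and xs = assms(25) and ys = assms(26) and iu = assms(27) and iw = assms(28)
    and iv = assms(29) and fw = assms(30) and fv = assms(31) and \<delta> = assms(32,33) and N = assms(34)
  interpret prob_space M by fact
  have I: "I = {1..N} \<times> {..<T}" by (simp add: I_def)
  let ?Y = "\<lambda>\<omega>. hconcat p T N (\<lambda>i. output_row p T (\<lambda>t. y i t \<omega>))"
  let ?U = "\<lambda>\<omega>. hconcat (m * T) T N (\<lambda>i. toeplitz_input m T (\<lambda>t. u i t \<omega>))"
  let ?G = "markov_row T A B C D"
  let ?F = "markov_row T A B\<^sub>w C (0\<^sub>m p q)"
  let ?W = "\<lambda>\<omega>. hconcat (q * T) T N (\<lambda>i. toeplitz_input q T (\<lambda>t. w i t \<omega>))"
  let ?V = "\<lambda>\<omega>. hconcat l T N (\<lambda>i. output_row l T (\<lambda>t. v i t \<omega>))"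
  let ?bound = "(\<sigma>\<^sub>v * (8 * spectral_norm D\<^sub>v *
        sqrt (2 * real T * (real T + 1) * (real m + real l) * ln (27 * real T / \<delta>))) +
      \<sigma>\<^sub>w * (16 * spectral_norm ?F * sqrt ((real T ^ 3 / 3 + real T ^ 2 / 2 + real T / 6) *
        2 * (real m + real q) * ln (27 * real T / \<delta>)))) / \<sigma>\<^sub>u * sqrt (1 / real N)"
  have T: "T > 0" and m: "m > 0" and q: "q > 0" and l: "l > 0" using pos by auto
  have fin: "finite I" and ne: "I \<noteq> {}" using pos T by (auto simp: I lessThan_empty_iff)
  have \<sigma>u: "\<sigma>\<^sub>u \<ge> 0" using \<sigma> by simp
  define \<xi>u where "\<xi>u \<omega> = (\<lambda>p\<in>I \<times> {..<m}. (\<lambda>(i, t). u i t) (fst p) \<omega> $ snd p)" for \<omega>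
  define \<xi>w where "\<xi>w \<omega> = (\<lambda>p\<in>I \<times> {..<q}. (\<lambda>(i, t). w i t) (fst p) \<omega> $ snd p)" for \<omega>
  define \<xi>v where "\<xi>v \<omega> = (\<lambda>p\<in>I \<times> {..<l}. (\<lambda>(i, t). v i t) (fst p) \<omega> $ snd p)" for \<omega>
  note cu = iid_normal_vecs_coordinates[OF M \<sigma>u fin ne pos(2) iu]
  note cw = iid_normal_vecs_coordinates[OF M \<sigma>(2) fin ne pos(3) iw]
  note cv = iid_normal_vecs_coordinates[OF M \<sigma>(3) fin ne pos(4) iv]
  have \<xi>u: "\<xi>u \<omega> ((i, t), k) = u i t \<omega> $ k" if "(i, t) \<in> I" "k < m" for \<omega> i t k using that by (simp add: \<xi>u_def)
  have \<xi>w: "\<xi>w \<omega> ((i, t), k) = w i t \<omega> $ k" if "(i, t) \<in> I" "k < q" for \<omega> i t k using that by (simp add: \<xi>w_def)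
  have \<xi>v: "\<xi>v \<omega> ((i, t), k) = v i t \<omega> $ k" if "(i, t) \<in> I" "k < l" for \<omega> i t k using that by (simp add: \<xi>v_def)
  have uc: "u i t \<omega> \<in> carrier_vec m" if "(i, t) \<in> I" "\<omega> \<in> space M" for i t \<omega>
    using iid_normal_vecs_carrier[OF M iu that] by simp
  have wc: "w i t \<omega> \<in> carrier_vec q" if "(i, t) \<in> I" "\<omega> \<in> space M" for i t \<omega>
    using iid_normal_vecs_carrier[OF M iw that] by simp
  have vc: "v i t \<omega> \<in> carrier_vec l" if "(i, t) \<in> I" "\<omega> \<in> space M" for i t \<omega>
    using iid_normal_vecs_carrier[OF M iv that] by simp
  have um: "(\<lambda>\<omega>. u i t \<omega> $ k) \<in> borel_measurable M" if "i \<in> {1..N}" "t < T" "k < m" for i t k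
    using cu(2)[of "(i, t)" k] that by (simp add: I)
  have wm: "(\<lambda>\<omega>. w i t \<omega> $ k) \<in> borel_measurable M" if "i \<in> {1..N}" "t < T" "k < q" for i t k
    using cw(2)[of "(i, t)" k] that by (simp add: I)
  have vm: "(\<lambda>\<omega>. v i t \<omega> $ k) \<in> borel_measurable M" if "i \<in> {1..N}" "t < T" "k < l" for i t k
    using cv(2)[of "(i, t)" k] that by (simp add: I)
  have Gc: "?G \<in> carrier_mat p (m * T)" and Fc: "?F \<in> carrier_mat p (q * T)"
    using B B\<^sub>w C by (auto simp: markov_row_def)
  have Uc: "?U \<omega> \<in> carrier_mat (m * T) (N * T)" and Wc: "?W \<omega> \<in> carrier_mat (q * T) (N * T)"
    and Vc: "?V \<omega> \<in> carrier_mat l (N * T)" for \<omega>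
    by (auto simp: hconcat_def)
  have Yeq: "?Y \<omega> = ?G * ?U \<omega> + ?F * ?W \<omega> + D\<^sub>v * ?V \<omega>" if \<omega>: "\<omega> \<in> space M" for \<omega>
    by (rule data_matrix_decomposition[OF I T m q A B B\<^sub>w C D D\<^sub>v, where x = "\<lambda>i t. x i t \<omega>"])
       (use x0 xs ys uc wc vc \<omega> in auto)
  define L where "L = ln (3 * real T / \<delta>)"
  have "3 * real T / \<delta> \<ge> 3" using T \<delta> by (simp add: field_simps)
  then have L: "L \<ge> 0" using \<delta> T by (simp add: L_def)
  have lg: "ln (27 * real T / \<delta>) \<ge> 0" using ln_27_eq[OF pos(6) \<delta>(1)] L by (simp add: L_def)
  \<comment> \<open>Each of m, q, l is at least 1, so m + q + l + 4 \<ge> 7; this is the 28 of the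
    input estimate.\<close>
  have "4 * 7 * L \<le> 4 * (real m + real q + real l + 4) * L"
    using L pos by (intro mult_right_mono) auto
  then have NL: "real N \<ge> 8 * real (m * T) + 28 * L" using N by (simp add: L_def)
  define g where "g \<omega> z j = (\<Sum>b<m * T. z b * toeplitz_entry m b j (\<xi>u \<omega>))" for \<omega> z j
  define sw where "sw = \<sigma>\<^sub>w * (4 * sqrt (real T * (real m + real q) * ln (27 * real T / \<delta>)))"
  define sv where "sv = \<sigma>\<^sub>v * (4 * sqrt (real T * (real m + real l) * ln (27 * real T / \<delta>)))"
  have s0: "sw \<ge> 0" "sv \<ge> 0" using \<sigma> lg by (simp_all add: sw_def sv_def)
  have indU: "indep_vars (\<lambda>_. borel) (\<lambda>p \<omega>. \<xi>u \<omega> p) (I \<times> {..<m})"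
    by (rule indep_vars_cong[THEN iffD1, OF _ _ _ cu(4)]) (auto simp: \<xi>u_def)
  have lawU: "distr M borel (\<lambda>\<omega>. \<xi>u \<omega> p) = centered_normal \<sigma>\<^sub>u" if "p \<in> I \<times> {..<m}" for p
    using cu(3)[OF that] that by (simp add: \<xi>u_def)
  obtain E0 where E0: "E0 \<in> events" "prob E0 \<le> 2 * exp (- 2 * L)"
    and low: "\<And>\<omega> z. \<omega> \<in> space M - E0 \<Longrightarrow>
      real N / 16 * \<sigma>\<^sub>u\<^sup>2 * (\<Sum>b<m * T. (z b)\<^sup>2) \<le> (\<Sum>j\<in>I. (g \<omega> z j)\<^sup>2)"
    using toeplitz_lower_bound[OF I pos(2) pos(6) \<sigma>(1) indU lawU L NL] unfolding g_def by blast
  have indW: "indep_var (PiM (I \<times> {..<m}) (\<lambda>_. borel)) \<xi>u (PiM (I \<times> {..<q}) (\<lambda>_. borel)) \<xi>w"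
    using indep_families_coordinates[OF M fw] unfolding \<xi>u_def[abs_def] \<xi>w_def[abs_def] .
  have indV: "indep_var (PiM (I \<times> {..<m}) (\<lambda>_. borel)) \<xi>u (PiM (I \<times> {..<l}) (\<lambda>_. borel)) \<xi>v"
    using indep_families_coordinates[OF M fv] unfolding \<xi>u_def[abs_def] \<xi>v_def[abs_def] .
  note noise_w = shifted_noise_bound[OF I pos(3) pos(2) pos(6) indW cw(1)[folded \<xi>w_def[abs_def]] \<sigma>(2) \<delta>,
      folded g_def sw_def]
  note noise_v = shifted_noise_bound[OF I pos(4) pos(2) pos(6) indV cv(1)[folded \<xi>v_def[abs_def]] \<sigma>(3) \<delta>,
      of 0, folded g_def sv_def]
  \<comment> \<open>One exceptional event per shift, uniform in the vector \<open>z\<close>; those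
    with a < T enter \<open>bad\<close>.\<close>
  have "\<forall>a. \<exists>E. E \<in> events \<and> prob E \<le> \<delta> / (3 * real T) \<and> (\<forall>\<omega>\<in>space M - E. \<forall>z.
      L2_set (\<lambda>k. \<Sum>j\<in>{j \<in> I. snd j + a < T}. g \<omega> z (fst j, snd j + a) * \<xi>w \<omega> (j, k)) {..<q}
        \<le> sw * L2_set (\<lambda>j. g \<omega> z j) I)"
    using noise_w by blast
  from choice[OF this] obtain Ew where Ew: "\<And>a. Ew a \<in> events" "\<And>a. prob (Ew a) \<le> \<delta> / (3 * real T)"
    and bw: "\<And>a \<omega> z. \<omega> \<in> space M - Ew a \<Longrightarrow>
      L2_set (\<lambda>k. \<Sum>j\<in>{j \<in> I. snd j + a < T}. g \<omega> z (fst j, snd j + a) * \<xi>w \<omega> (j, k)) {..<q}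
        \<le> sw * L2_set (\<lambda>j. g \<omega> z j) I"
    by blast
  obtain Ev where Ev: "Ev \<in> events" "prob Ev \<le> \<delta> / (3 * real T)"
    and bv: "\<And>\<omega> z. \<omega> \<in> space M - Ev \<Longrightarrow>
      L2_set (\<lambda>k. \<Sum>j\<in>{j \<in> I. snd j + 0 < T}. g \<omega> z (fst j, snd j + 0) * \<xi>v \<omega> (j, k)) {..<l}
        \<le> sv * L2_set (\<lambda>j. g \<omega> z j) I"
    using noise_v by blast
  define bad where "bad = E0 \<union> ((\<Union>a\<in>{..<T}. Ew a) \<union> Ev)"
  have UE: "(\<Union>a\<in>{..<T}. Ew a) \<in> events" using Ew by (intro sets.finite_UN) auto
  have bad: "bad \<in> events" unfolding bad_def using E0 Ev UE by auto
  have "prob (\<Union>a\<in>{..<T}. Ew a) \<le> (\<Sum>a<T. prob (Ew a))"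
    using Ew by (intro finite_measure_subadditive_finite) auto
  also have "\<dots> \<le> (\<Sum>a<T. \<delta> / (3 * real T))" by (intro sum_mono Ew)
  finally have pw: "prob (\<Union>a\<in>{..<T}. Ew a) \<le> real T * (\<delta> / (3 * real T))" by simp
  have "prob bad \<le> prob E0 + prob ((\<Union>a\<in>{..<T}. Ew a) \<union> Ev)"
    unfolding bad_def using E0 Ev UE by (intro measure_subadditive) auto
  also have "prob ((\<Union>a\<in>{..<T}. Ew a) \<union> Ev) \<le> prob (\<Union>a\<in>{..<T}. Ew a) + prob Ev"
    using Ev UE by (intro measure_subadditive) auto
  finally have pbad: "prob bad \<le> \<delta>"
    using E0(2) Ev(2) pw failure_probability_le[OF pos(6) \<delta>] unfolding L_def by linarith
  have good: "spectral_norm (ols_estimator (?Y \<omega>) (?U \<omega>) - ?G) \<le> ?bound" if \<omega>: "\<omega> \<in> space M - bad" for \<omega>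
  proof -
    have \<omega>M: "\<omega> \<in> space M" and \<omega>0: "\<omega> \<in> space M - E0" and \<omega>v: "\<omega> \<in> space M - Ev"
      and \<omega>w: "\<And>a. a < T \<Longrightarrow> \<omega> \<in> space M - Ew a"
      using \<omega> by (auto simp: bad_def)
    define gz where "gz z = g \<omega> (\<lambda>b. z $ b)" for z :: "real vec"
    have Ut: "transpose_mat (?U \<omega>) *\<^sub>v z = vec (N * T) (\<lambda>c. gz z (c div T + 1, c mod T))"
      if z: "z \<in> carrier_vec (m * T)" for z
      unfolding hconcat_transpose_mult_vec[OF T z]
    proof (rule eq_vecI)
      fix c assume "c < dim_vec (vec (N * T) (\<lambda>c. gz z (c div T + 1, c mod T)))"
      then have c: "c < N * T" by simp
      note ci = hconcat_column_index[OF c T]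
      have "toeplitz_input m T (\<lambda>t. u (c div T + 1) t \<omega>) $$ (b, c mod T)
          = toeplitz_entry m b (c div T + 1, c mod T) (\<xi>u \<omega>)" if b: "b < m * T" for b
      proof -
        have "(c div T + 1, c mod T - b div m) \<in> I" using ci by (auto simp: I)
        then show ?thesis using b ci m by (simp add: toeplitz_input_def toeplitz_entry_def Let_def \<xi>u)
      qed
      then show "vec (N * T) (\<lambda>c. \<Sum>b<m * T. z $ b * toeplitz_input m T (\<lambda>t. u (c div T + 1) t \<omega>) $$ (b, c mod T)) $ c
        = vec (N * T) (\<lambda>c. gz z (c div T + 1, c mod T)) $ c"
        using c by (simp add: gz_def g_def)
    qed simp
    have nU: "vnorm (transpose_mat (?U \<omega>) *\<^sub>v z) = L2_set (gz z) I" if z: "z \<in> carrier_vec (m * T)" for z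
      unfolding Ut[OF z] vnorm_hconcat_vec[OF T] I ..
    have "spectral_norm (ols_estimator (?Y \<omega>) (?U \<omega>) - ?G) \<le>
        (spectral_norm ?F * (sqrt (real T) * sw) + spectral_norm D\<^sub>v * sv) / (sqrt (real N) / 4 * \<sigma>\<^sub>u)"
    proof (rule ols_error_bound[OF Uc Gc Fc Wc D\<^sub>v Vc Yeq[OF \<omega>M]])
      show "0 < m * T" "0 < q * T" "0 < l" using m q l T by auto
      show "0 < sqrt (real N) / 4 * \<sigma>\<^sub>u" using \<sigma> pos by simp
      show "0 \<le> sqrt (real T) * sw" "0 \<le> sv" using s0 by auto
      fix z :: "real vec" assume z: "z \<in> carrier_vec (m * T)"
      have gzn: "L2_set (gz z) I \<ge> 0" by simp
      show "sqrt (real N) / 4 * \<sigma>\<^sub>u * vnorm z \<le> vnorm (transpose_mat (?U \<omega>) *\<^sub>v z)"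
        unfolding nU[OF z]
      proof (rule power2_le_imp_le[OF _ gzn])
        have "(sqrt (real N) / 4 * \<sigma>\<^sub>u * vnorm z)\<^sup>2 = real N / 16 * \<sigma>\<^sub>u\<^sup>2 * (\<Sum>b<m * T. (z $ b)\<^sup>2)"
          by (simp add: power_mult_distrib power_divide vnorm_L2_set[OF z] L2_set_power2)
        also have "\<dots> \<le> (L2_set (gz z) I)\<^sup>2"
          unfolding L2_set_power2 gz_def by (rule low[OF \<omega>0])
        finally show "(sqrt (real N) / 4 * \<sigma>\<^sub>u * vnorm z)\<^sup>2 \<le> (L2_set (gz z) I)\<^sup>2" .
      qed
      have "vnorm (?W \<omega> *\<^sub>v vec (N * T) (\<lambda>c. gz z (c div T + 1, c mod T))) \<le> sqrt (real T) * (sw * L2_set (gz z) I)"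
      proof (rule toeplitz_input_mult_norm[OF T q I])
        show "0 \<le> sw * L2_set (gz z) I" using s0 by simp
        fix a assume a: "a < T"
        have "(\<Sum>j\<in>{j \<in> I. snd j + a < T}. gz z (fst j, snd j + a) * w (fst j) (snd j) \<omega> $ k)
            = (\<Sum>j\<in>{j \<in> I. snd j + a < T}. g \<omega> (\<lambda>b. z $ b) (fst j, snd j + a) * \<xi>w \<omega> (j, k))" if "k < q" for k
          using that by (intro sum.cong refl) (auto simp: gz_def \<xi>w)
        then have "L2_set (\<lambda>k. \<Sum>j\<in>{j \<in> I. snd j + a < T}. gz z (fst j, snd j + a) * w (fst j) (snd j) \<omega> $ k) {..<q}
            = L2_set (\<lambda>k. \<Sum>j\<in>{j \<in> I. snd j + a < T}. g \<omega> (\<lambda>b. z $ b) (fst j, snd j + a) * \<xi>w \<omega> (j, k)) {..<q}"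
          by (intro L2_set_cong refl) simp
        also have "\<dots> \<le> sw * L2_set (gz z) I" unfolding gz_def by (rule bw[OF \<omega>w[OF a]])
        finally show "L2_set (\<lambda>k. \<Sum>j\<in>{j \<in> I. snd j + a < T}. gz z (fst j, snd j + a) * w (fst j) (snd j) \<omega> $ k) {..<q}
          \<le> sw * L2_set (gz z) I" .
      qed
      then show "vnorm (?W \<omega> *\<^sub>v (transpose_mat (?U \<omega>) *\<^sub>v z)) \<le> sqrt (real T) * sw * vnorm (transpose_mat (?U \<omega>) *\<^sub>v z)"
        unfolding nU[OF z] unfolding Ut[OF z] by (simp only: mult.assoc)
      have I0: "{j \<in> I. snd j + 0 < T} = I" by (auto simp: I)
      have "(\<Sum>j\<in>I. gz z j * v (fst j) (snd j) \<omega> $ k) = (\<Sum>j\<in>I. g \<omega> (\<lambda>b. z $ b) (fst j, snd j + 0) * \<xi>v \<omega> (j, k))"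
        if "k < l" for k
        using that by (intro sum.cong refl) (auto simp: gz_def \<xi>v)
      then have "L2_set (\<lambda>k. \<Sum>j\<in>I. gz z j * v (fst j) (snd j) \<omega> $ k) {..<l}
          = L2_set (\<lambda>k. \<Sum>j\<in>I. g \<omega> (\<lambda>b. z $ b) (fst j, snd j + 0) * \<xi>v \<omega> (j, k)) {..<l}"
        by (intro L2_set_cong refl) simp
      also have "\<dots> \<le> sv * L2_set (gz z) I" using bv[OF \<omega>v, of "\<lambda>b. z $ b"] unfolding I0 gz_def .
      finally show "vnorm (?V \<omega> *\<^sub>v (transpose_mat (?U \<omega>) *\<^sub>v z)) \<le> sv * vnorm (transpose_mat (?U \<omega>) *\<^sub>v z)"
        unfolding nU[OF z] unfolding Ut[OF z]
        by (subst output_row_mult_norm[where v = "\<lambda>i t. v i t \<omega>", OF T I])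
    qed
    also have "\<dots> \<le> ?bound"
      unfolding sw_def sv_def
    proof (rule error_constants_le[OF pos(6) pos(5) lg \<sigma>])
      show "0 \<le> spectral_norm ?F" using spectral_norm_cases(2)[OF Fc] q T by simp
      show "0 \<le> spectral_norm D\<^sub>v" using spectral_norm_cases(2)[OF D\<^sub>v l] .
    qed
    finally show ?thesis .
  qed
  have Um: "measurable_mat M (m * T) (N * T) ?U" by (rule measurable_mat_toeplitz[OF T m um])
  have Wm: "measurable_mat M (q * T) (N * T) ?W" by (rule measurable_mat_toeplitz[OF T q wm])
  have Vm: "measurable_mat M l (N * T) ?V"
    by (rule measurable_mat_hconcat[OF T]) (simp add: output_row_def vm)
  have Ym: "measurable_mat M p (N * T) ?Y"
    \<comment> \<open>Measurability of the outputs is deduced from \<open>Yeq\<close>, which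
      expresses them on the space through inputs and noises.\<close>
    by (rule measurable_mat_cong[OF measurable_mat_add[OF measurable_mat_add[OF
          measurable_mat_mult[OF measurable_mat_const[OF Gc] Um]
          measurable_mat_mult[OF measurable_mat_const[OF Fc] Wm]]
          measurable_mat_mult[OF measurable_mat_const[OF D\<^sub>v] Vm]] Yeq])
  have "measurable_mat M p (m * T) (\<lambda>\<omega>. ols_estimator (?Y \<omega>) (?U \<omega>) - ?G)"
    unfolding ols_estimator_def
    by (intro measurable_mat_diff_const[OF _ Gc] measurable_mat_mult[OF Ym] measurable_mat_pseudo_inverse[OF Um])
  \<comment> \<open>A set outside the sigma-algebra has measure 0 by convention, so containing the
    complement of \<open>bad\<close> gives a lower bound only once this is known.\<close>
  then have sets: "{\<omega> \<in> space M. spectral_norm (ols_estimator (?Y \<omega>) (?U \<omega>) - ?G) \<le> ?bound} \<in> events"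
    by (rule spectral_norm_le_sets) (use m T in simp)
  have "1 - \<delta> \<le> 1 - prob bad" using pbad by simp
  also have "\<dots> = prob (space M - bad)" by (rule prob_compl[OF bad, symmetric])
  also have "\<dots> \<le> prob {\<omega> \<in> space M. spectral_norm (ols_estimator (?Y \<omega>) (?U \<omega>) - ?G) \<le> ?bound}"
    using good by (intro finite_measure_mono sets) auto
  finally show ?thesis unfolding Y_def U_def G_def F_def C\<^sub>1_def C\<^sub>2_def .
qed

end
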